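(* Let $\Omega\subset\mathbb{R}^2$ be a bounded domain with Lipschitz boundary and let $\beta_2=\beta_3=\beta_4=\frac12$. For $t>0$ define ${\bm\beta}^t:=(t,\frac{1}{\sqrt2},\frac1{\sqrt2},\frac1{\sqrt2})$. Then, for any $1\le p<2$, the functionals $R_{{\bm\beta}^t}$ $\Gamma$-converge to $\mathrm{ICTV}$ with respect to the strong topology of $L^p(\Omega)$ as $t\to\infty$, where $R_{{\bm\beta}^t}$ and $\mathrm{ICTV}$ are extended by $+\infty$ on $L^p(\Omega)\setminus BV(\Omega)$.
   Context: $\mathcal{M}(\Omega,\mathbb{R}^d)$ is the space of finite $\mathbb{R}^d$-valued Radon measures on $\Omega$ with the dual norm $\|\mu\|_{\mathcal{M}(\Omega,\mathbb{R}^d)}=\sup\{\sum_{i=1}^d\int_\Omega\varphi_i\,d\mu_i:\varphi\in C_0(\Omega,\mathbb{R}^d),\ \|\varphi\|_\infty\le1\}$, where $\|\varphi\|_\infty$ is the supremum of the pointwise Euclidean norm. The norm is set to $+\infty$ for distributions that are not finite Radon measures. $\nabla u$ is the distributional gradient. For $w=(w_1,w_2)\in\mathcal{M}(\Omega,\mathbb{R}^2)$, with derivatives in the sense of distributions, $\mathrm{curl}(w)=\partial_{x_1}w_2-\partial_{x_2}w_1$, $\mathrm{div}(w)=\partial_{x_1}w_1+\partial_{x_2}w_2$, $\mathrm{sh}_1(w)=\partial_{x_2}w_2-\partial_{x_1}w_1$, $\mathrm{sh}_2(w)=\partial_{x_2}w_1+\partial_{x_1}w_2$, and $\nabla_Nw=(\mathrm{curl}(w),\mathrm{div}(w),\mathrm{sh}_1(w),\mathrm{sh}_2(w))^\top$.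 For a vector ${\bm\beta}=(\sqrt{\beta_1},\sqrt{\beta_2},\sqrt{\beta_3},\sqrt{\beta_4})$ with $\beta_i\ge0$, $$R_{\bm\beta}(u)=\inf_{w\in\mathcal{M}(\Omega,\mathbb{R}^2)}\|\nabla u-w\|_{\mathcal{M}(\Omega,\mathbb{R}^2)}+\|\mathrm{diag}({\bm\beta})\nabla_Nw\|_{\mathcal{M}(\Omega,\mathbb{R}^4)}.$$ With $\nabla w=(\partial_{x_1}w_1,\partial_{x_2}w_1,\partial_{x_1}w_2,\partial_{x_2}w_2)^\top$ (vectorised), $$\mathrm{ICTV}(u)=\inf_{w\in\mathcal{M}(\Omega,\mathbb{R}^2),\ \mathrm{curl}(w)=0}\|\nabla u-w\|_{\mathcal{M}(\Omega,\mathbb{R}^2)}+\|\nabla w\|_{\mathcal{M}(\Omega,\mathbb{R}^4)}.$$ *)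

theory Defs
  imports "HOL-Analysis.Analysis"
begin

section \<open>Finite vector-valued Radon measures\<close>

text \<open>
  The library has no signed or vector measures. A finite \<open>real^'d\<close>-valued Radon measure on \<open>\<Omega>\<close> is a
  countably additive set function on the Borel subsets of \<open>\<Omega>\<close>; for the open sets \<open>\<Omega>\<close> used below
  finiteness and inner regularity of the variation are then automatic. Additivity on the constant
  sequence of empty sets forces the value \<open>0\<close> on the empty set. The value \<open>0\<close> prescribed outside the
  \<open>\<sigma>\<close>-algebra makes equality of functions coincide with equality of measures.
\<close>

definition borel_sets :: "(real^2) set \<Rightarrow> (real^2) set set" where
  "borel_sets \<Omega> = sets (restrict_space borel \<Omega>)"

definition radon_measures :: "(real^2) set \<Rightarrow> ((real^2) set \<Rightarrow> real^'d) set" where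
  "radon_measures \<Omega> = {\<mu>.
     (\<forall>A :: nat \<Rightarrow> (real^2) set. (\<forall>n. A n \<in> borel_sets \<Omega>) \<and> disjoint_family A
        \<longrightarrow> (\<lambda>n. \<mu> (A n)) sums \<mu> (\<Union>n. A n)) \<and>
     (\<forall>A. A \<notin> borel_sets \<Omega> \<longrightarrow> \<mu> A = 0)}"

text \<open>
  Positive part of the Jordan decomposition of a real measure \<open>m\<close>. The truncation of negative
  values by \<open>ennreal\<close> is harmless, since \<open>B = {}\<close> already contributes \<open>0\<close> to the supremum.
\<close>

definition pos_variation :: "(real^2) set \<Rightarrow> ((real^2) set \<Rightarrow> real) \<Rightarrow> (real^2) measure" where
  "pos_variation \<Omega> m =
     measure_of \<Omega> (borel_sets \<Omega>) (\<lambda>A. SUP B\<in>{B \<in> borel_sets \<Omega>. B \<subseteq> A}. ennreal (m B))"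

definition signed_integral ::
    "(real^2) set \<Rightarrow> ((real^2) set \<Rightarrow> real) \<Rightarrow> (real^2 \<Rightarrow> real) \<Rightarrow> real" where
  "signed_integral \<Omega> m \<phi> =
     (\<integral>x. \<phi> x \<partial>pos_variation \<Omega> m) - (\<integral>x. \<phi> x \<partial>pos_variation \<Omega> (\<lambda>A. - m A))"

definition C0 :: "(real^2) set \<Rightarrow> (real^2 \<Rightarrow> real^'d) set" where
  "C0 \<Omega> = {\<phi>. continuous_on \<Omega> \<phi> \<and> (\<forall>e>0. compact {x\<in>\<Omega>. e \<le> norm (\<phi> x)})}"

definition dual_norm :: "(real^2) set \<Rightarrow> ((real^2) set \<Rightarrow> real^'d) \<Rightarrow> ereal" where
  "dual_norm \<Omega> \<mu> = (SUP \<phi>\<in>{\<phi>. \<phi> \<in> C0 \<Omega> \<and> (\<forall>x\<in>\<Omega>. norm (\<phi> x) \<le> 1)}.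
     ereal (\<Sum>i\<in>UNIV. signed_integral \<Omega> (\<lambda>A. \<mu> A $ i) (\<lambda>x. \<phi> x $ i)))"


section \<open>Distributions\<close>

definition partial :: "2 \<Rightarrow> (real^2 \<Rightarrow> real) \<Rightarrow> real^2 \<Rightarrow> real" where
  "partial i f x = frechet_derivative f (at x) (axis i 1)"

text \<open>\<open>C\<^sup>\<infinity>\<close>: all iterated partial derivatives, of every order, are differentiable everywhere.\<close>

definition smooth :: "(real^2 \<Rightarrow> real) \<Rightarrow> bool" where
  "smooth f \<longleftrightarrow> (\<forall>is x. foldr partial is f differentiable (at x))"

definition test_functions :: "(real^2) set \<Rightarrow> (real^2 \<Rightarrow> real) set" where
  "test_functions \<Omega> =
     {\<phi>. smooth \<phi> \<and> compact (closure {x. \<phi> x \<noteq> 0}) \<and> closure {x. \<phi> x \<noteq> 0} \<subseteq> \<Omega>}"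

text \<open>
  A distribution is given by its action on test functions; its values at other functions are
  irrelevant. A vector-valued distribution acts on scalar test functions componentwise.
\<close>

type_synonym distr = "(real^2 \<Rightarrow> real) \<Rightarrow> real"
type_synonym 'd vdistr = "(real^2 \<Rightarrow> real) \<Rightarrow> real^'d"

definition distr_deriv :: "2 \<Rightarrow> distr \<Rightarrow> distr" where
  "distr_deriv i T = (\<lambda>\<phi>. - T (partial i \<phi>))"

definition distr_of_fun :: "(real^2) set \<Rightarrow> (real^2 \<Rightarrow> real) \<Rightarrow> distr" where
  "distr_of_fun \<Omega> u = (\<lambda>\<phi>. \<integral>x. u x * \<phi> x \<partial>(lebesgue_on \<Omega>))"

definition distr_of_measure :: "(real^2) set \<Rightarrow> ((real^2) set \<Rightarrow> real^'d) \<Rightarrow> ('d::finite) vdistr" where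
  "distr_of_measure \<Omega> \<mu> = (\<lambda>\<phi>. \<chi> i. signed_integral \<Omega> (\<lambda>A. \<mu> A $ i) \<phi>)"

definition distr_comp :: "(real^2) set \<Rightarrow> ((real^2) set \<Rightarrow> real^'d) \<Rightarrow> 'd \<Rightarrow> distr" where
  "distr_comp \<Omega> \<mu> i = (\<lambda>\<phi>. distr_of_measure \<Omega> \<mu> \<phi> $ i)"

definition represents ::
    "(real^2) set \<Rightarrow> ((real^2) set \<Rightarrow> real^'d) \<Rightarrow> ('d::finite) vdistr \<Rightarrow> bool" where
  "represents \<Omega> \<mu> T \<longleftrightarrow> \<mu> \<in> radon_measures \<Omega> \<and>
     (\<forall>\<phi>\<in>test_functions \<Omega>. T \<phi> = distr_of_measure \<Omega> \<mu> \<phi>)"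

text \<open>
  The norm of a distribution, equal to \<open>\<infinity>\<close> if it is not a finite Radon measure. For open \<open>\<Omega>\<close> the
  representing measure is unique, so the choice operator picks that measure.
\<close>

definition M_norm :: "(real^2) set \<Rightarrow> ('d::finite) vdistr \<Rightarrow> ereal" where
  "M_norm \<Omega> T =
     (if \<exists>\<mu>. represents \<Omega> \<mu> T then dual_norm \<Omega> (SOME \<mu>. represents \<Omega> \<mu> T) else \<infinity>)"

definition grad :: "(real^2) set \<Rightarrow> (real^2 \<Rightarrow> real) \<Rightarrow> 2 vdistr" where
  "grad \<Omega> u = (\<lambda>\<phi>. \<chi> i. distr_deriv i (distr_of_fun \<Omega> u) \<phi>)"

definition curl :: "(real^2) set \<Rightarrow> ((real^2) set \<Rightarrow> real^2) \<Rightarrow> distr" where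
  "curl \<Omega> w =
     (\<lambda>\<phi>. distr_deriv 1 (distr_comp \<Omega> w 2) \<phi> - distr_deriv 2 (distr_comp \<Omega> w 1) \<phi>)"

definition divergence :: "(real^2) set \<Rightarrow> ((real^2) set \<Rightarrow> real^2) \<Rightarrow> distr" where
  "divergence \<Omega> w =
     (\<lambda>\<phi>. distr_deriv 1 (distr_comp \<Omega> w 1) \<phi> + distr_deriv 2 (distr_comp \<Omega> w 2) \<phi>)"

definition sh1 :: "(real^2) set \<Rightarrow> ((real^2) set \<Rightarrow> real^2) \<Rightarrow> distr" where
  "sh1 \<Omega> w =
     (\<lambda>\<phi>. distr_deriv 2 (distr_comp \<Omega> w 2) \<phi> - distr_deriv 1 (distr_comp \<Omega> w 1) \<phi>)"

definition sh2 :: "(real^2) set \<Rightarrow> ((real^2) set \<Rightarrow> real^2) \<Rightarrow> distr" where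
  "sh2 \<Omega> w =
     (\<lambda>\<phi>. distr_deriv 2 (distr_comp \<Omega> w 1) \<phi> + distr_deriv 1 (distr_comp \<Omega> w 2) \<phi>)"

lemma vector_4 [simp]:
  "(vector [a, b, c, d] :: 'a::zero^4) $ 1 = a"
  "(vector [a, b, c, d] :: 'a::zero^4) $ 2 = b"
  "(vector [a, b, c, d] :: 'a::zero^4) $ 3 = c"
  "(vector [a, b, c, d] :: 'a::zero^4) $ 4 = d"
  by (simp_all add: vector_def)

definition nabla_N :: "(real^2) set \<Rightarrow> ((real^2) set \<Rightarrow> real^2) \<Rightarrow> 4 vdistr" where
  "nabla_N \<Omega> w = (\<lambda>\<phi>. vector [curl \<Omega> w \<phi>, divergence \<Omega> w \<phi>, sh1 \<Omega> w \<phi>, sh2 \<Omega> w \<phi>])"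

definition nabla :: "(real^2) set \<Rightarrow> ((real^2) set \<Rightarrow> real^2) \<Rightarrow> 4 vdistr" where
  "nabla \<Omega> w = (\<lambda>\<phi>. vector
     [distr_deriv 1 (distr_comp \<Omega> w 1) \<phi>, distr_deriv 2 (distr_comp \<Omega> w 1) \<phi>,
      distr_deriv 1 (distr_comp \<Omega> w 2) \<phi>, distr_deriv 2 (distr_comp \<Omega> w 2) \<phi>])"

definition diag :: "real^'d \<Rightarrow> real^'d^'d" where
  "diag b = (\<chi> i j. if i = j then b $ i else 0)"


section \<open>The functionals\<close>

text \<open>The argument \<open>b\<close> is the weight vector itself, that is, its entries are the square roots of the \<open>\<beta>\<^sub>i\<close>.\<close>

definition R_functional :: "(real^2) set \<Rightarrow> real^4 \<Rightarrow> (real^2 \<Rightarrow> real) \<Rightarrow> ereal" where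
  "R_functional \<Omega> b u = (INF w\<in>radon_measures \<Omega>.
     M_norm \<Omega> (\<lambda>\<phi>. grad \<Omega> u \<phi> - distr_of_measure \<Omega> w \<phi>)
     + M_norm \<Omega> (\<lambda>\<phi>. diag b *v nabla_N \<Omega> w \<phi>))"

definition ICTV :: "(real^2) set \<Rightarrow> (real^2 \<Rightarrow> real) \<Rightarrow> ereal" where
  "ICTV \<Omega> u = (INF w\<in>{w \<in> radon_measures \<Omega>. \<forall>\<phi>\<in>test_functions \<Omega>. curl \<Omega> w \<phi> = 0}.
     M_norm \<Omega> (\<lambda>\<phi>. grad \<Omega> u \<phi> - distr_of_measure \<Omega> w \<phi>) + M_norm \<Omega> (nabla \<Omega> w))"

definition BV :: "(real^2) set \<Rightarrow> (real^2 \<Rightarrow> real) set" where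
  "BV \<Omega> = {u. integrable (lebesgue_on \<Omega>) u \<and> (\<exists>\<mu>. represents \<Omega> \<mu> (grad \<Omega> u))}"

definition extend_infinity ::
    "(real^2) set \<Rightarrow> ((real^2 \<Rightarrow> real) \<Rightarrow> ereal) \<Rightarrow> (real^2 \<Rightarrow> real) \<Rightarrow> ereal" where
  "extend_infinity \<Omega> F u = (if u \<in> BV \<Omega> then F u else \<infinity>)"


section \<open>Lebesgue spaces, \<open>\<Gamma>\<close>-convergence and Lipschitz domains\<close>

text \<open>
  Elements of \<open>L\<^sup>p(\<Omega>)\<close> are represented by functions on \<open>real^2\<close>, of which only the values on \<open>\<Omega>\<close> matter;
  the functionals above depend only on the almost everywhere equality class, and \<open>Lp_dist\<close> is a
  pseudometric.
\<close>

definition Lp :: "(real^2) set \<Rightarrow> real \<Rightarrow> (real^2 \<Rightarrow> real) set" where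
  "Lp \<Omega> p = {u \<in> borel_measurable (lebesgue_on \<Omega>).
     integrable (lebesgue_on \<Omega>) (\<lambda>x. \<bar>u x\<bar> powr p)}"

definition Lp_dist :: "(real^2) set \<Rightarrow> real \<Rightarrow> (real^2 \<Rightarrow> real) \<Rightarrow> (real^2 \<Rightarrow> real) \<Rightarrow> real" where
  "Lp_dist \<Omega> p u v = (\<integral>x. \<bar>u x - v x\<bar> powr p \<partial>(lebesgue_on \<Omega>)) powr (1 / p)"

definition gamma_converges ::
    "'a set \<Rightarrow> ('a \<Rightarrow> 'a \<Rightarrow> real) \<Rightarrow> (nat \<Rightarrow> 'a \<Rightarrow> ereal) \<Rightarrow> ('a \<Rightarrow> ereal) \<Rightarrow> bool" where
  "gamma_converges X d F G \<longleftrightarrow> (\<forall>u\<in>X.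
     (\<forall>v. (\<forall>n. v n \<in> X) \<and> (\<lambda>n. d (v n) u) \<longlonglongrightarrow> 0 \<longrightarrow> G u \<le> liminf (\<lambda>n. F n (v n))) \<and>
     (\<exists>v. (\<forall>n. v n \<in> X) \<and> (\<lambda>n. d (v n) u) \<longlonglongrightarrow> 0 \<and> limsup (\<lambda>n. F n (v n)) \<le> G u))"

text \<open>
  \<open>\<Gamma>\<close>-convergence of a family with a continuous parameter \<open>t > 0\<close> as \<open>t\<close> tends to infinity:
  \<open>\<Gamma>\<close>-convergence along every sequence of parameters tending to infinity.
\<close>

definition gamma_converges_at_top ::
    "'a set \<Rightarrow> ('a \<Rightarrow> 'a \<Rightarrow> real) \<Rightarrow> (real \<Rightarrow> 'a \<Rightarrow> ereal) \<Rightarrow> ('a \<Rightarrow> ereal) \<Rightarrow> bool" where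
  "gamma_converges_at_top X d F G \<longleftrightarrow>
     (\<forall>t. (\<forall>n. 0 < t n) \<and> filterlim t at_top sequentially
        \<longrightarrow> gamma_converges X d (\<lambda>n. F (t n)) G)"

text \<open>
  Near each boundary point, \<open>\<Omega>\<close> is the strict epigraph of a Lipschitz function in suitable orthonormal
  coordinates.
\<close>

definition lipschitz_boundary :: "(real^2) set \<Rightarrow> bool" where
  "lipschitz_boundary \<Omega> \<longleftrightarrow> (\<forall>z\<in>frontier \<Omega>. \<exists>r>0. \<exists>e1 e2 :: real^2. \<exists>L. \<exists>\<gamma> :: real \<Rightarrow> real.
     norm e1 = 1 \<and> norm e2 = 1 \<and> e1 \<bullet> e2 = 0 \<and> L-lipschitz_on UNIV \<gamma> \<and>
     \<Omega> \<inter> ball z r = {x \<in> ball z r. \<gamma> (x \<bullet> e1) < x \<bullet> e2})"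

definition bounded_lipschitz_domain :: "(real^2) set \<Rightarrow> bool" where
  "bounded_lipschitz_domain \<Omega> \<longleftrightarrow>
     open \<Omega> \<and> connected \<Omega> \<and> \<Omega> \<noteq> {} \<and> bounded \<Omega> \<and> lipschitz_boundary \<Omega>"

end

theory Submission
  imports Defs
begin

text \<open>
  All measure norms are computed on test functions: a distribution is a finite Radon measure iff it is
  bounded for the supremum norm (Riesz), and by density its norm is the supremum of its pairings with
  smooth compactly supported fields of norm at most \<open>1\<close>. In this form the norm is lower semicontinuous
  under pointwise convergence of distributions.

  Up to the factor \<open>\<surd>2\<close>, \<open>\<nabla>\<^sub>N w\<close> is an orthogonal transformation of \<open>\<nabla> w\<close>. So for curl-free \<open>w\<close>
  the two second-order terms agree, which makes constant sequences recovery sequences, while for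
  \<open>t \<ge> 1 / \<surd>2\<close> the term in \<open>R\<close> controls \<open>\<nabla> w\<close> and \<open>t |curl w|\<close>.

  For the lower bound take almost optimal \<open>w\<^sub>n\<close> for \<open>v\<^sub>n\<close>. On every test function \<open>\<nabla> v\<^sub>n\<close> converges and
  \<open>\<nabla> v\<^sub>n - w\<^sub>n\<close> is bounded, so Tychonoff's theorem gives a curl-free limit distribution \<open>W\<close> with
  \<open>\<nabla> u - W\<close> and \<open>\<nabla> W\<close> finite measures. That \<open>W\<close> is itself a finite measure, and hence \<open>u \<in> BV\<close>, is
  where the Lipschitz boundary enters: near each point of the closure there are two independent vectors
  \<open>a\<close> along which the domain can be translated into itself, and writing a test function as its average
  along \<open>a\<close> plus a derivative in direction \<open>a\<close> bounds \<open>a \<bullet> W\<close> by \<open>\<parallel>u\<parallel>\<^sub>1\<close>, \<open>\<parallel>\<nabla> u - W\<parallel>\<close> and \<open>\<parallel>\<nabla> W\<parallel>\<close>.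
\<close>

section \<open>Smooth functions\<close>

text \<open>The obstacle is that v_n converges only in L^p. Nothing bounds the gradients of v_n as
  measures, and the bound on w_n at a test function f involves derivatives of f. So weak-star
  compactness of measures does not apply directly, the limit is at first a mere distribution, and
  its regularity is recovered after the passage to the limit. For this a bound may use f only
  through its supremum, while pairing f with the gradient of u costs a derivative of f. Averaging
  pays for it: the derivative of a mean along \<open>a\<close> in direction \<open>a\<close> is a
  difference of two values of f.

  The Riesz theorem is needed for functionals without a sign, known on smooth functions only. The
  positive part is built on open sets from competitors with values in [0,1], the negative part by
  the same construction for - T, and a layer-cake estimate shows that T is their difference.

  In terms of the four partial derivatives the rows of the natural gradient are orthogonal of length
  sqrt 2. Thus the weight 1 / sqrt 2 normalises a row, and t \<ge> 1 / sqrt 2 says that the curl row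
  weighs at least as much as the others.\<close>

primrec cdiff :: "nat \<Rightarrow> (real^2 \<Rightarrow> real) \<Rightarrow> bool" where
  "cdiff 0 f \<longleftrightarrow> (\<forall>x. f differentiable (at x))"
| "cdiff (Suc n) f \<longleftrightarrow> (\<forall>x. f differentiable (at x)) \<and> (\<forall>i. cdiff n (partial i f))"

lemma cdiff_differentiable: "cdiff n f \<Longrightarrow> f differentiable (at x)"
  by (cases n) auto

lemma cdiff_mono: "cdiff n f \<Longrightarrow> m \<le> n \<Longrightarrow> cdiff m f"
proof (induction m arbitrary: f n)
  case 0
  then show ?case by (auto intro: cdiff_differentiable)
next
  case (Suc m)
  then obtain k where "n = Suc k" "m \<le> k" by (cases n) auto
  with Suc show ?case by auto
qed

text \<open>Differentiating a product or a composition produces sums of new products, so closure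
  properties call for an induction on the order with the functions left general.
  \<open>cdiff\<close> provides it; the fixed index lists in \<open>smooth\<close> do not.\<close>

lemma cdiff_iff_foldr:
  "cdiff n f \<longleftrightarrow> (\<forall>is x. length is \<le> n \<longrightarrow> foldr partial is f differentiable (at x))"
proof (induction n arbitrary: f)
  case 0
  then show ?case by simp
next
  case (Suc n)
  show ?case
  proof
    assume L: "cdiff (Suc n) f"
    show "\<forall>is x. length is \<le> Suc n \<longrightarrow> foldr partial is f differentiable at x"
    proof (intro allI impI)
      fix "is" :: "2 list" and x :: "real^2" assume "length is \<le> Suc n"
      \<comment> \<open>\<open>foldr\<close> applies the last index of the list to \<open>f\<close>
        first, and this is the derivative that \<open>cdiff\<close> peels off.\<close>
      then show "foldr partial is f differentiable at x"
        using L by (cases "is" rule: rev_cases) (auto simp: Suc)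
    qed
  next
    assume R: "\<forall>is x. length is \<le> Suc n \<longrightarrow> foldr partial is f differentiable at x"
    have "foldr partial is (partial i f) differentiable at x" if "length is \<le> n" for "is" i x
      using R[rule_format, of "is @ [i]" x] that by simp
    with R[rule_format, of "[]"] show "cdiff (Suc n) f" by (auto simp: Suc)
  qed
qed

lemma smooth_iff_cdiff: "smooth f \<longleftrightarrow> (\<forall>n. cdiff n f)"
  unfolding smooth_def cdiff_iff_foldr by auto

lemma smooth_differentiable: "smooth f \<Longrightarrow> f differentiable (at x)"
  using smooth_iff_cdiff cdiff_differentiable by blast

lemma smooth_partial: "smooth f \<Longrightarrow> smooth (partial i f)"
  unfolding smooth_iff_cdiff using cdiff.simps(2) by blast

lemma smooth_continuous_on: "smooth f \<Longrightarrow> continuous_on S f"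
  by (simp add: continuous_at_imp_continuous_on differentiable_imp_continuous_within smooth_differentiable)

lemma partial_eqI: "(f has_derivative f') (at x) \<Longrightarrow> partial i f x = f' (axis i 1)"
  unfolding partial_def by (metis frechet_derivative_at)

lemma has_derivative_frechet:
  "f differentiable (at x) \<Longrightarrow> (f has_derivative frechet_derivative f (at x)) (at x)"
  using frechet_derivative_works by blast

lemma has_derivative_partial:
  assumes "f differentiable (at x)"
  shows "(f has_derivative (\<lambda>h. \<Sum>i\<in>UNIV. h $ i * partial i f x)) (at x)"
proof -
  let ?D = "frechet_derivative f (at x)"
  have D: "(f has_derivative ?D) (at x)" by (rule has_derivative_frechet[OF assms])
  then have lin: "linear ?D" by (simp add: has_derivative_linear)
  have "?D h = (\<Sum>i\<in>UNIV. h $ i * partial i f x)" for h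
  proof -
    have "?D h = ?D (\<Sum>i\<in>UNIV. (h $ i) *s axis i 1)" by (simp add: basis_expansion)
    also have "\<dots> = (\<Sum>i\<in>UNIV. h $ i * ?D (axis i 1))"
      by (simp add: linear_sum[OF lin] linear_scale[OF lin] scalar_mult_eq_scaleR)
    finally show ?thesis by (simp add: partial_def)
  qed
  then have "?D = (\<lambda>h. \<Sum>i\<in>UNIV. h $ i * partial i f x)" by blast
  with D show ?thesis by simp
qed

lemma partial_const: "partial i (\<lambda>x. c) = (\<lambda>x. 0)"
  by (rule ext) (auto intro!: partial_eqI[THEN trans] derivative_eq_intros)

lemma partial_add:
  assumes "\<And>x. f differentiable (at x)" "\<And>x. g differentiable (at x)"
  shows "partial i (\<lambda>x. f x + g x) = (\<lambda>x. partial i f x + partial i g x)"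
  by (rule ext, rule partial_eqI[THEN trans],
      rule has_derivative_add[OF has_derivative_frechet has_derivative_frechet])
     (auto simp: assms partial_def)

lemma partial_mult:
  assumes "\<And>x. f differentiable (at x)" "\<And>x. g differentiable (at x)"
  shows "partial i (\<lambda>x. f x * g x) = (\<lambda>x. f x * partial i g x + partial i f x * g x)"
  by (rule ext, rule partial_eqI[THEN trans],
      rule has_derivative_mult[OF has_derivative_frechet has_derivative_frechet])
     (auto simp: assms partial_def)

lemma partial_comp:
  assumes "\<And>x. g differentiable (at x)" "\<And>y. (F has_real_derivative F' y) (at y)"
  shows "partial i (\<lambda>x. F (g x)) = (\<lambda>x. F' (g x) * partial i g x)"
proof
  fix x
  have "((\<lambda>x. F (g x)) has_derivative (\<lambda>h. F' (g x) * frechet_derivative g (at x) h)) (at x)"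
    using has_derivative_compose[OF has_derivative_frechet[OF assms(1)[of x]]
        has_field_derivative_imp_has_derivative[OF assms(2)[of "g x"]]]
    by simp
  from partial_eqI[OF this] show "partial i (\<lambda>x. F (g x)) x = F' (g x) * partial i g x"
    by (simp add: partial_def)
qed

lemma differentiable_comp:
  assumes "g differentiable (at x)" "(F has_real_derivative F') (at (g x))"
  shows "(\<lambda>x. F (g x)) differentiable (at (x::real^2))"
  using has_derivative_compose[OF has_derivative_frechet[OF assms(1)]
        has_field_derivative_imp_has_derivative[OF assms(2)]]
  by (auto simp: differentiable_def)

lemma cdiff_const: "cdiff n (\<lambda>x. c)"
  by (induction n arbitrary: c) (auto simp: partial_const)

lemma cdiff_add: "cdiff n f \<Longrightarrow> cdiff n g \<Longrightarrow> cdiff n (\<lambda>x. f x + g x)"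
  by (induction n arbitrary: f g) (auto simp: partial_add)

lemma cdiff_mult: "cdiff n f \<Longrightarrow> cdiff n g \<Longrightarrow> cdiff n (\<lambda>x. f x * g x)"
proof (induction n arbitrary: f g)
  case 0
  then show ?case by auto
next
  case (Suc n)
  have "cdiff n f" "cdiff n g" using Suc.prems cdiff_mono le_Suc_eq by blast+
  with Suc show ?case by (auto simp: partial_mult intro!: cdiff_add)
qed

lemma cdiff_inverse:
  assumes "cdiff n g" "\<And>x. g x \<noteq> 0"
  shows "cdiff n (\<lambda>x. inverse (g x))"
  using assms
proof (induction n)
  case 0
  then show ?case by auto
next
  case (Suc n)
  have gn: "cdiff n g" using Suc.prems cdiff_mono le_Suc_eq by blast
  \<comment> \<open>The derivative is again expressed through \<open>inverse (g x)\<close>, so the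
    induction hypothesis together with closure under products suffices.\<close>
  have "partial i (\<lambda>x. inverse (g x)) =
      (\<lambda>x. (-1) * (inverse (g x) * inverse (g x)) * partial i g x)" for i
  proof
    fix x
    have "((\<lambda>x. inverse (g x)) has_derivative
        (\<lambda>h. - (inverse (g x) * frechet_derivative g (at x) h * inverse (g x)))) (at x)"
      using Suc.prems(1) by (intro Deriv.has_derivative_inverse[where f=g] Suc.prems(2) has_derivative_frechet) auto
    from partial_eqI[OF this]
    show "partial i (\<lambda>x. inverse (g x)) x =
        (-1) * (inverse (g x) * inverse (g x)) * partial i g x"
      by (simp add: partial_def)
  qed
  moreover have "cdiff n (\<lambda>x. (-1) * (inverse (g x) * inverse (g x)) * partial i g x)" for i
    using Suc gn by (intro cdiff_mult cdiff_const) auto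
  ultimately show ?case using Suc.prems by auto
qed

lemma smooth_const: "smooth (\<lambda>x. c)"
  by (simp add: smooth_iff_cdiff cdiff_const)

lemma smooth_add: "smooth f \<Longrightarrow> smooth g \<Longrightarrow> smooth (\<lambda>x. f x + g x)"
  by (simp add: smooth_iff_cdiff cdiff_add)

lemma smooth_mult: "smooth f \<Longrightarrow> smooth g \<Longrightarrow> smooth (\<lambda>x. f x * g x)"
  by (simp add: smooth_iff_cdiff cdiff_mult)

lemma smooth_cmult: "smooth f \<Longrightarrow> smooth (\<lambda>x. c * f x)"
  by (intro smooth_mult smooth_const)

lemma smooth_diff: "smooth f \<Longrightarrow> smooth g \<Longrightarrow> smooth (\<lambda>x. f x - g x)"
  using smooth_add[of f "\<lambda>x. -1 * g x"] smooth_cmult[of g "-1"] by simp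

lemma smooth_sum: "(\<And>i. i \<in> I \<Longrightarrow> smooth (f i)) \<Longrightarrow> smooth (\<lambda>x. \<Sum>i\<in>I. f i x)"
  by (induction I rule: infinite_finite_induct) (auto intro: smooth_const smooth_add)

lemma smooth_divide: "smooth f \<Longrightarrow> smooth g \<Longrightarrow> (\<And>x. g x \<noteq> 0) \<Longrightarrow> smooth (\<lambda>x. f x / g x)"
  unfolding divide_inverse by (intro smooth_mult) (auto simp: smooth_iff_cdiff cdiff_inverse)

lemma smooth_bounded_linear:
  assumes "bounded_linear f"
  shows "smooth f"
proof -
  have d: "(f has_derivative f) (at x)" for x
    by (rule bounded_linear_imp_has_derivative[OF assms])
  then have "partial i f = (\<lambda>x. f (axis i 1))" for i
    by (intro ext partial_eqI)
  then have "cdiff n f" for n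
    using d by (cases n) (auto simp: cdiff_const differentiable_def)
  then show ?thesis by (simp add: smooth_iff_cdiff)
qed

lemma smooth_real_polynomial_function:
  "real_polynomial_function f \<Longrightarrow> smooth f"
  by (induction rule: real_polynomial_function.induct)
     (auto intro: smooth_bounded_linear smooth_const smooth_add smooth_mult)


subsection \<open>Bump functions\<close>

text \<open>The functions exp (-1/x) / x^k, extended by 0, form a family in which each derivative is
  a linear combination of members. Smoothness of every order then follows from the first derivative,
  by induction with \<open>k\<close> left general.\<close>

definition bump_profile :: "nat \<Rightarrow> real \<Rightarrow> real" where
  "bump_profile k x = (if x \<le> 0 then 0 else exp (- inverse x) * inverse x ^ k)"

lemma bump_profile_tendsto:
  "((\<lambda>x. bump_profile k x) \<longlongrightarrow> 0) (at_right 0)"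
proof -
  have "((\<lambda>x::real. x ^ k / exp x) \<longlongrightarrow> 0) at_top"
    by (rule tendsto_power_div_exp_0)
  then have "((\<lambda>x::real. inverse x ^ k / exp (inverse x)) \<longlongrightarrow> 0) (at_right 0)"
    by (rule filterlim_compose[OF _ filterlim_inverse_at_top_right])
  moreover have "\<forall>\<^sub>F x::real in at_right 0. inverse x ^ k / exp (inverse x) = bump_profile k x"
    by (auto simp: eventually_at_right_field bump_profile_def exp_minus field_simps intro: exI[of _ 1])
  ultimately show ?thesis by (rule Lim_transform_eventually)
qed

lemma bump_profile_deriv:
  "(bump_profile k has_real_derivative (bump_profile (k + 2) x - k * bump_profile (k + 1) x)) (at x)"
proof -
  consider "x < 0" | "x > 0" | "x = 0" by linarith
  then show ?thesis
  proof cases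
    case 1
    have "((\<lambda>x. 0) has_real_derivative 0) (at x)" by simp
    then have "(bump_profile k has_real_derivative 0) (at x)"
      by (rule has_field_derivative_transform_within_open[where S="{..<0}"])
        (use 1 in \<open>auto simp: bump_profile_def\<close>)
    with 1 show ?thesis by (simp add: bump_profile_def)
  next
    case 2
    have "((\<lambda>x. exp (- inverse x) * inverse x ^ k) has_real_derivative
        (bump_profile (k + 2) x - k * bump_profile (k + 1) x)) (at x)"
    proof -
      have i: "(inverse has_real_derivative - (inverse x)\<^sup>2) (at x)"
        using DERIV_inverse[of x] 2 by (simp add: numeral_2_eq_2)
      have e: "((\<lambda>x. exp (- inverse x)) has_real_derivative exp (- inverse x) * (inverse x)\<^sup>2) (at x)"
        using DERIV_fun_exp[OF DERIV_minus[OF i]] by simp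
      have p: "((\<lambda>x. inverse x ^ k) has_real_derivative - (real k * inverse x ^ (k + 1))) (at x)"
        using DERIV_power[OF i, of k] by (cases k) (auto simp: power2_eq_square ac_simps)
      have "exp (- inverse x) * (inverse x)\<^sup>2 * inverse x ^ k + - (real k * inverse x ^ (k + 1)) * exp (- inverse x)
          = bump_profile (k + 2) x - k * bump_profile (k + 1) x"
        using 2 by (simp add: bump_profile_def power_add power2_eq_square)
      with DERIV_mult[OF e p] show ?thesis by simp
    qed
    then show ?thesis
      by (rule has_field_derivative_transform_within_open[where S="{0<..}"])
        (use 2 in \<open>auto simp: bump_profile_def\<close>)
  next
    case 3
    have *: "((\<lambda>y. (bump_profile k y - bump_profile k 0) / (y - 0)) \<longlongrightarrow> 0) (at 0)"
    proof -
      \<comment> \<open>To the right of 0 the difference quotient is the next profile,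
        \<open>bump_profile (Suc k)\<close>.\<close>
      have "((\<lambda>y. (bump_profile k y - bump_profile k 0) / (y - 0)) \<longlongrightarrow> 0) (at_right 0)"
        by (rule Lim_transform_eventually[OF bump_profile_tendsto[of "Suc k"]])
          (auto simp: eventually_at_right_field bump_profile_def field_simps intro: exI[of _ 1])
      moreover have "((\<lambda>y. (bump_profile k y - bump_profile k 0) / (y - 0)) \<longlongrightarrow> 0) (at_left 0)"
        by (rule Lim_transform_eventually[OF tendsto_const])
          (auto simp: eventually_at_left_field bump_profile_def field_simps intro: exI[of _ "-1"])
      ultimately show ?thesis by (simp add: filterlim_at_split)
    qed
    then have "(bump_profile k has_real_derivative 0) (at 0)"
      by (simp add: has_field_derivative_iff)
    with 3 show ?thesis by (simp add: bump_profile_def)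
  qed
qed

lemma cdiff_bump_profile:
  "cdiff n g \<Longrightarrow> cdiff n (\<lambda>x. bump_profile k (g x))"
proof (induction n arbitrary: k)
  case 0
  then show ?case using differentiable_comp[OF _ bump_profile_deriv] by auto
next
  case (Suc n)
  have gn: "cdiff n g" using Suc.prems cdiff_mono le_Suc_eq by blast
  have p: "partial i (\<lambda>x. bump_profile k (g x)) =
      (\<lambda>x. (bump_profile (k + 2) (g x) + (- real k) * bump_profile (k + 1) (g x)) * partial i g x)" for i
    using partial_comp[of g "bump_profile k", OF _ bump_profile_deriv] Suc.prems by simp
  have "cdiff n (\<lambda>x. (bump_profile (k + 2) (g x) + (- real k) * bump_profile (k + 1) (g x)) * partial i g x)" for i
    using Suc gn by (intro cdiff_mult cdiff_add cdiff_const) auto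
  then show ?case
    using Suc.prems differentiable_comp[OF _ bump_profile_deriv] by (auto simp: p)
qed

lemma smooth_bump_profile: "smooth g \<Longrightarrow> smooth (\<lambda>x. bump_profile k (g x))"
  by (simp add: smooth_iff_cdiff cdiff_bump_profile)

lemma bump_profile_nonneg: "0 \<le> bump_profile k x"
  by (simp add: bump_profile_def)

lemma bump_profile_pos_iff: "0 < bump_profile k x \<longleftrightarrow> 0 < x"
  by (simp add: bump_profile_def)

definition bump :: "real^2 \<Rightarrow> real \<Rightarrow> real^2 \<Rightarrow> real" where
  "bump z r x = bump_profile 0 (r\<^sup>2 - (x - z) \<bullet> (x - z))"

lemma smooth_bump: "smooth (bump z r)"
proof -
  have "smooth (\<lambda>x. r\<^sup>2 - (\<Sum>i\<in>UNIV. (x $ i - z $ i) * (x $ i - z $ i)))"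
    by (intro smooth_diff smooth_const smooth_sum smooth_mult smooth_bounded_linear bounded_linear_vec_nth)
  then have "smooth (\<lambda>x. r\<^sup>2 - (x - z) \<bullet> (x - z))"
    by (simp add: inner_vec_def)
  then show ?thesis unfolding bump_def[abs_def] by (rule smooth_bump_profile)
qed

lemma bump_nonneg: "0 \<le> bump z r x"
  by (simp add: bump_def bump_profile_nonneg)

lemma bump_pos_iff: "0 < r \<Longrightarrow> 0 < bump z r x \<longleftrightarrow> x \<in> ball z r"
proof -
  assume "0 < r"
  then have "(dist z x < r) \<longleftrightarrow> (dist z x)\<^sup>2 < r\<^sup>2"
    by (metis abs_of_nonneg abs_square_less_1 less_eq_real_def power2_less_imp_less power_strict_mono zero_le_dist zero_less_numeral)
  moreover have "(x - z) \<bullet> (x - z) = (dist z x)\<^sup>2"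
    by (simp add: dist_norm power2_norm_eq_inner norm_minus_commute)
  ultimately show ?thesis by (auto simp: bump_def bump_profile_pos_iff)
qed


subsection \<open>Test functions and partitions of unity\<close>

abbreviation supp :: "(real^2 \<Rightarrow> real) \<Rightarrow> (real^2) set" where
  "supp f \<equiv> closure {x. f x \<noteq> 0}"

lemma test_functions_smooth: "f \<in> test_functions U \<Longrightarrow> smooth f"
  and test_functions_compact_supp: "f \<in> test_functions U \<Longrightarrow> compact (supp f)"
  and test_functions_supp: "f \<in> test_functions U \<Longrightarrow> supp f \<subseteq> U"
  by (auto simp: test_functions_def)

lemma test_functions_continuous: "f \<in> test_functions U \<Longrightarrow> continuous_on S f"
  by (rule smooth_continuous_on[OF test_functions_smooth])

lemma notin_supp: "x \<notin> supp f \<Longrightarrow> f x = 0"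
  using closure_subset[of "{x. f x \<noteq> 0}"] by blast

lemma test_functions_eq_0: "f \<in> test_functions U \<Longrightarrow> x \<notin> U \<Longrightarrow> f x = 0"
  using test_functions_supp notin_supp by blast

lemma test_functionsI:
  assumes "smooth f" "compact K" "K \<subseteq> U" "\<And>x. x \<notin> K \<Longrightarrow> f x = 0"
  shows "f \<in> test_functions U"
proof -
  have "supp f \<subseteq> K" using assms(2,4) by (intro closure_minimal) (auto simp: compact_imp_closed)
  moreover from this have "compact (supp f)" using compact_Int_closed[OF assms(2) closed_closure[of "{x. f x \<noteq> 0}"]] by (simp add: Int_absorb1)
  ultimately show ?thesis using assms by (auto simp: test_functions_def)
qed

lemma test_functions_mono: "f \<in> test_functions U \<Longrightarrow> U \<subseteq> V \<Longrightarrow> f \<in> test_functions V"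
  by (auto simp: test_functions_def)

lemma test_functions_0: "(\<lambda>x. 0) \<in> test_functions U"
  by (rule test_functionsI[where K="{}"]) (auto simp: smooth_const)

lemma test_functions_add:
  assumes f: "f \<in> test_functions U" and g: "g \<in> test_functions U"
  shows "(\<lambda>x. f x + g x) \<in> test_functions U"
proof (rule test_functionsI)
  show "smooth (\<lambda>x. f x + g x)" by (intro smooth_add test_functions_smooth[OF f] test_functions_smooth[OF g])
  show "compact (supp f \<union> supp g)"
    by (intro compact_Un test_functions_compact_supp[OF f] test_functions_compact_supp[OF g])
  show "supp f \<union> supp g \<subseteq> U" using test_functions_supp[OF f] test_functions_supp[OF g] by blast
  show "f x + g x = 0" if "x \<notin> supp f \<union> supp g" for x
    using that notin_supp[of x f] notin_supp[of x g] by simp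
qed

lemma test_functions_mult:
  assumes f: "f \<in> test_functions U" and g: "smooth g"
  shows "(\<lambda>x. g x * f x) \<in> test_functions U"
proof (rule test_functionsI)
  show "smooth (\<lambda>x. g x * f x)" by (intro smooth_mult test_functions_smooth[OF f] g)
  show "g x * f x = 0" if "x \<notin> supp f" for x
    using that notin_supp[of x f] by simp
qed (rule test_functions_compact_supp[OF f] test_functions_supp[OF f])+

lemma test_functions_mult_local:
  assumes f: "f \<in> test_functions U" and g: "g \<in> test_functions V"
  shows "(\<lambda>x. g x * f x) \<in> test_functions (U \<inter> V)"
proof (rule test_functionsI)
  show "smooth (\<lambda>x. g x * f x)" by (intro smooth_mult test_functions_smooth[OF f] test_functions_smooth[OF g])
  show "compact (supp f \<inter> supp g)"
    by (intro compact_Int test_functions_compact_supp[OF f] test_functions_compact_supp[OF g])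
  show "supp f \<inter> supp g \<subseteq> U \<inter> V" using test_functions_supp[OF f] test_functions_supp[OF g] by blast
  show "g x * f x = 0" if "x \<notin> supp f \<inter> supp g" for x
    using that notin_supp[of x f] notin_supp[of x g] by auto
qed

lemma test_functions_cmult: "f \<in> test_functions U \<Longrightarrow> (\<lambda>x. c * f x) \<in> test_functions U"
  by (simp add: test_functions_mult smooth_const)

lemma test_functions_uminus: "f \<in> test_functions U \<Longrightarrow> (\<lambda>x. - f x) \<in> test_functions U"
  using test_functions_cmult[of f U "-1"] by simp

lemma test_functions_diff:
  "f \<in> test_functions U \<Longrightarrow> g \<in> test_functions U \<Longrightarrow> (\<lambda>x. f x - g x) \<in> test_functions U"
  using test_functions_add[of f U "\<lambda>x. - g x"] test_functions_uminus[of g] by simp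

lemma test_functions_sum:
  "(\<And>i. i \<in> I \<Longrightarrow> f i \<in> test_functions U) \<Longrightarrow> (\<lambda>x. \<Sum>i\<in>I. f i x) \<in> test_functions U"
  by (induction I rule: infinite_finite_induct) (auto intro: test_functions_0 test_functions_add)

lemma test_functions_partial:
  assumes "f \<in> test_functions U"
  shows "partial i f \<in> test_functions U"
proof (rule test_functionsI[where K="supp f"])
  fix x assume x: "x \<notin> supp f"
  have "((\<lambda>x. 0) has_derivative (\<lambda>h. 0)) (at x)" by simp
  then have "(f has_derivative (\<lambda>h. 0)) (at x)"
  proof (rule has_derivative_transform_within_open[where s="- supp f"])
    show "0 = f y" if "y \<in> - supp f" for y using that notin_supp[of y f] by simp
  qed (use x in \<open>auto\<close>)
  then show "partial i f x = 0" by (rule partial_eqI)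
qed (intro smooth_partial test_functions_smooth[OF assms] test_functions_compact_supp[OF assms]
      test_functions_supp[OF assms])+

lemma test_functions_bounded:
  assumes "f \<in> test_functions U"
  obtains M where "0 \<le> M" "\<And>x. \<bar>f x\<bar> \<le> M"
proof -
  have "compact (f ` supp f)"
    by (intro compact_continuous_image smooth_continuous_on test_functions_smooth[OF assms]
        test_functions_compact_supp[OF assms])
  then obtain M where M: "\<And>y. y \<in> f ` supp f \<Longrightarrow> norm y \<le> M"
    by (meson bounded_iff compact_imp_bounded)
  have "\<bar>f x\<bar> \<le> max M 0" for x
    using M[of "f x"] notin_supp[of x f] by (cases "x \<in> supp f") auto
  then show thesis using that[of "max M 0"] by auto
qed

text \<open>Bumps on finitely many balls are grouped by the set that contains the ball and divided
  by a smooth function that equals their sum on \<open>K\<close>. Off \<open>K\<close> the sum may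
  vanish, so the denominator is corrected there.\<close>

lemma partition_of_unity:
  fixes U :: "'i \<Rightarrow> (real^2) set"
  assumes K: "compact K" and I: "finite I" and op: "\<And>i. i \<in> I \<Longrightarrow> open (U i)" and cov: "K \<subseteq> (\<Union>i\<in>I. U i)"
  obtains \<eta> where "\<And>i. i \<in> I \<Longrightarrow> \<eta> i \<in> test_functions (U i)" "\<And>i x. 0 \<le> \<eta> i x"
    "\<And>x. (\<Sum>i\<in>I. \<eta> i x) \<le> 1" "\<And>x. x \<in> K \<Longrightarrow> (\<Sum>i\<in>I. \<eta> i x) = 1"
proof -
  \<comment> \<open>Closed balls, because the closure of the set where a bump is nonzero must still
    lie in \<open>U i\<close>.\<close>
  have "\<exists>i r. i \<in> I \<and> 0 < r \<and> cball x r \<subseteq> U i" if "x \<in> K" for x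
    using cov op that by (metis UN_E open_contains_cball subsetD)
  then obtain ix r where ir: "\<And>x. x \<in> K \<Longrightarrow> ix x \<in> I \<and> 0 < r x \<and> cball x (r x) \<subseteq> U (ix x)"
    by metis
  have "K \<subseteq> (\<Union>x\<in>K. ball x (r x))" using ir by auto
  then obtain X where X: "X \<subseteq> K" "finite X" "K \<subseteq> (\<Union>x\<in>X. ball x (r x))"
    using compactE_image[OF K, of K "\<lambda>x. ball x (r x)"] by (metis open_ball)
  define b where "b i y = (\<Sum>x\<in>{x\<in>X. ix x = i}. bump x (r x) y)" for i y
  define g where "g y = (\<Sum>i\<in>I. b i y)" for y
  have b0: "0 \<le> b i y" for i y unfolding b_def by (intro sum_nonneg bump_nonneg)
  have g0: "0 \<le> g y" for y unfolding g_def by (intro sum_nonneg b0)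
  have sb: "smooth (b i)" for i unfolding b_def[abs_def] by (intro smooth_sum smooth_bump)
  have sg: "smooth g" unfolding g_def[abs_def] by (intro smooth_sum sb)
  have gK: "0 < g y" if "y \<in> K" for y
  proof -
    obtain x where x: "x \<in> X" "y \<in> ball x (r x)" using X(3) \<open>y \<in> K\<close> by blast
    then have "0 < bump x (r x) y" using bump_pos_iff ir X by blast
    also have "\<dots> \<le> b (ix x) y" unfolding b_def
      using x X bump_nonneg by (intro member_le_sum) auto
    also have "\<dots> \<le> g y" unfolding g_def
      using x X ir I b0 by (intro member_le_sum) auto
    finally show ?thesis .
  qed
  obtain \<delta> where \<delta>: "0 < \<delta>" "\<And>y. y \<in> K \<Longrightarrow> \<delta> \<le> g y"
  proof (cases "K = {}")
    case True then show thesis using that[of 1] by auto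
  next
    case False
    then obtain y0 where "y0 \<in> K" "\<And>y. y \<in> K \<Longrightarrow> g y0 \<le> g y"
      using continuous_attains_inf[OF K _ smooth_continuous_on[OF sg]] by blast
    then show thesis using that[of "g y0"] gK by blast
  qed
  \<comment> \<open>The correction vanishes where \<open>g\<close> is at least \<delta>, hence on
    \<open>K\<close>, and is positive where \<open>g\<close> is 0. Being nonnegative, it keeps
    \<open>g y / G y\<close> below 1.\<close>
  define G where "G y = g y + bump_profile 0 (\<delta> - g y)" for y
  have G: "0 < G y" "g y \<le> G y" for y
  proof -
    show "0 < G y" using g0[of y] \<delta>(1) bump_profile_pos_iff[of 0 "\<delta> - g y"] bump_profile_nonneg[of 0 "\<delta> - g y"]
      unfolding G_def by (cases "g y = 0") auto
    show "g y \<le> G y" unfolding G_def by (simp add: bump_profile_nonneg)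
  qed
  have GK: "G y = g y" if "y \<in> K" for y
    using \<delta>(2)[OF that] by (simp add: G_def bump_profile_def)
  have sG: "smooth G" unfolding G_def[abs_def]
    by (intro smooth_add sg smooth_bump_profile smooth_diff smooth_const)
  define \<eta> where "\<eta> i y = b i y / G y" for i y
  have sum: "(\<Sum>i\<in>I. \<eta> i y) = g y / G y" for y
    by (simp add: \<eta>_def g_def sum_divide_distrib)
  show thesis
  proof
    fix i assume i: "i \<in> I"
    show "\<eta> i \<in> test_functions (U i)"
    proof (rule test_functionsI[where K="\<Union>x\<in>{x\<in>X. ix x = i}. cball x (r x)"])
      show "smooth (\<eta> i)" unfolding \<eta>_def[abs_def] using G(1) by (intro smooth_divide sb sG) (metis less_irrefl)
      show "compact (\<Union>x\<in>{x\<in>X. ix x = i}. cball x (r x))" using X by (intro compact_UN) auto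
      show "(\<Union>x\<in>{x\<in>X. ix x = i}. cball x (r x)) \<subseteq> U i" using ir X by blast
      fix y assume y: "y \<notin> (\<Union>x\<in>{x\<in>X. ix x = i}. cball x (r x))"
      have "bump x (r x) y = 0" if "x \<in> X" "ix x = i" for x
      proof -
        have "y \<notin> ball x (r x)" using y that by auto
        then have "\<not> 0 < bump x (r x) y" using bump_pos_iff ir X that by blast
        then show ?thesis using bump_nonneg[of x "r x" y] by simp
      qed
      then show "\<eta> i y = 0" by (simp add: \<eta>_def b_def)
    qed
  next
    show "0 \<le> \<eta> i x" for i x unfolding \<eta>_def using b0 G(1) by (simp add: less_imp_le)
    show "(\<Sum>i\<in>I. \<eta> i x) \<le> 1" for x unfolding sum using G by simp
    show "(\<Sum>i\<in>I. \<eta> i x) = 1" if "x \<in> K" for x unfolding sum GK[OF that] using gK[OF that] by simp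
  qed
qed

lemma smooth_cutoff:
  assumes "compact K" "open U" "K \<subseteq> U"
  obtains \<eta> where "\<eta> \<in> test_functions U" "\<And>x. 0 \<le> \<eta> x" "\<And>x. \<eta> x \<le> 1" "\<And>x. x \<in> K \<Longrightarrow> \<eta> x = 1"
proof -
  obtain \<eta> :: "unit \<Rightarrow> real^2 \<Rightarrow> real" where "\<And>i. i \<in> {()} \<Longrightarrow> \<eta> i \<in> test_functions U" "\<And>i x. 0 \<le> \<eta> i x"
    "\<And>x. (\<Sum>i\<in>{()}. \<eta> i x) \<le> 1" "\<And>x. x \<in> K \<Longrightarrow> (\<Sum>i\<in>{()}. \<eta> i x) = 1"
    using partition_of_unity[OF assms(1), of "{()}" "\<lambda>_. U"] assms by auto
  then show thesis using that[of "\<eta> ()"] by auto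
qed

subsection \<open>Averages along a segment\<close>

text \<open>Weighted mean over the segment from \<open>x\<close> back to \<open>x - a\<close>. Two
  weights occur later: with 1 the derivative of the mean along \<open>a\<close> is a difference of
  values of \<open>f\<close>, with \<open>1 - s\<close> it is \<open>f\<close> minus the unweighted
  mean.\<close>

definition seg_avg :: "(real \<Rightarrow> real) \<Rightarrow> real^2 \<Rightarrow> (real^2 \<Rightarrow> real) \<Rightarrow> real^2 \<Rightarrow> real" where
  "seg_avg \<omega> a f x = integral {0..1} (\<lambda>s. \<omega> s * f (x - s *\<^sub>R a))"

lemma continuous_on_smooth_compose:
  "smooth f \<Longrightarrow> continuous_on S g \<Longrightarrow> continuous_on S (\<lambda>x. f (g x))"
  by (rule continuous_on_compose2[of UNIV f]) (auto intro: smooth_continuous_on)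

lemma continuous_on_segment: "smooth f \<Longrightarrow> continuous_on S (\<lambda>s. f (x - s *\<^sub>R a))"
  by (intro continuous_on_smooth_compose continuous_intros)

lemma has_derivative_seg_avg:
  assumes f: "smooth f" and \<omega>: "continuous_on {0..1} \<omega>"
  shows "(seg_avg \<omega> a f has_derivative (\<lambda>h. \<Sum>i\<in>UNIV. h $ i * seg_avg \<omega> a (partial i f) x)) (at x)"
proof -
  define gr where "gr y = (\<chi> i. partial i f y)" for y
  have cgr: "continuous_on S (\<lambda>x. gr (g x))" if "continuous_on S g" for S and g :: "'b::t2_space \<Rightarrow> real^2"
    unfolding gr_def using that
    by (intro continuous_on_vec_lambda continuous_on_smooth_compose smooth_partial f)
  \<comment> \<open>\<open>leibniz_rule\<close> asks for the derivative as a bounded linear function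
    that depends continuously on both arguments. The gradient is therefore packaged as an inner
    product.\<close>
  define F where "F x t = \<omega> t *\<^sub>R blinfun_inner_right (gr (x - t *\<^sub>R a))" for x t
  have Fapp: "blinfun_apply (F x t) = (\<lambda>h. \<omega> t * (\<Sum>i\<in>UNIV. h $ i * partial i f (x - t *\<^sub>R a)))" for x t
    by (rule ext) (simp add: F_def gr_def inner_vec_def blinfun.scaleR_left mult.commute)
  have \<omega>0: "continuous_on (cbox 0 1) \<omega>" using \<omega> by (simp add: cbox_interval)
  have \<omega>': "continuous_on (UNIV \<times> cbox 0 1) (\<lambda>p::(real^2)\<times>real. \<omega> (snd p))"
    by (rule continuous_on_compose2[OF \<omega>]) (auto intro!: continuous_intros)
  have D: "((\<lambda>x. integral (cbox 0 1) (\<lambda>s. \<omega> s * f (x - s *\<^sub>R a))) has_derivative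
      integral (cbox 0 1) (F x)) (at x within UNIV)"
  proof (rule leibniz_rule)
    fix x t assume "t \<in> cbox 0 (1::real)"
    have "(f has_derivative (\<lambda>h. \<Sum>i\<in>UNIV. h $ i * partial i f (x - t *\<^sub>R a))) (at (x - t *\<^sub>R a))"
      by (rule has_derivative_partial[OF smooth_differentiable[OF f]])
    moreover have "((\<lambda>x. x - t *\<^sub>R a) has_derivative (\<lambda>h. h)) (at x)"
      by (auto intro!: derivative_eq_intros)
    ultimately have "((\<lambda>x. f (x - t *\<^sub>R a)) has_derivative (\<lambda>h. \<Sum>i\<in>UNIV. h $ i * partial i f (x - t *\<^sub>R a))) (at x)"
      using has_derivative_compose by blast
    from has_derivative_mult_right[OF this, of "\<omega> t"]
    show "((\<lambda>x. \<omega> t * f (x - t *\<^sub>R a)) has_derivative blinfun_apply (F x t)) (at x within UNIV)"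
      unfolding Fapp .
  next
    fix x :: "real^2" show "(\<lambda>s. \<omega> s * f (x - s *\<^sub>R a)) integrable_on cbox 0 1"
      by (intro integrable_continuous continuous_on_mult \<omega>0 continuous_on_segment f)
  next
    show "continuous_on (UNIV \<times> cbox 0 1) (\<lambda>(x, t). F x t)"
      unfolding F_def split_beta
      by (intro continuous_intros \<omega>' cgr bounded_linear.continuous_on[OF bounded_linear_blinfun_inner_right])
  qed auto
  have iF: "F x integrable_on cbox 0 1"
    unfolding F_def
    by (intro integrable_continuous continuous_on_scaleR \<omega>0 cgr
        bounded_linear.continuous_on[OF bounded_linear_blinfun_inner_right]
        continuous_on_diff continuous_on_const continuous_on_id)
  have "blinfun_apply (integral (cbox 0 1) (F x)) h = (\<Sum>i\<in>UNIV. h $ i * seg_avg \<omega> a (partial i f) x)" for h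
  proof -
    have "blinfun_apply (integral (cbox 0 1) (F x)) h = integral (cbox 0 1) (\<lambda>t. \<Sum>i\<in>UNIV. h $ i * (\<omega> t * partial i f (x - t *\<^sub>R a)))"
      unfolding blinfun_apply_integral[OF iF]
      by (simp add: Fapp sum_distrib_left mult_ac)
    also have "\<dots> = (\<Sum>i\<in>UNIV. integral (cbox 0 1) (\<lambda>t. h $ i * (\<omega> t * partial i f (x - t *\<^sub>R a))))"
      by (intro integral_sum integrable_continuous continuous_on_mult \<omega>0 finite
          continuous_on_const continuous_on_segment smooth_partial f)
    also have "\<dots> = (\<Sum>i\<in>UNIV. h $ i * seg_avg \<omega> a (partial i f) x)"
      by (simp add: seg_avg_def)
    finally show ?thesis .
  qed
  then have "blinfun_apply (integral (cbox 0 1) (F x)) = (\<lambda>h. \<Sum>i\<in>UNIV. h $ i * seg_avg \<omega> a (partial i f) x)"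
    by blast
  then show ?thesis using D by (simp add: seg_avg_def[abs_def] cbox_interval)
qed

lemma partial_seg_avg:
  assumes "smooth f" "continuous_on {0..1} \<omega>"
  shows "partial i (seg_avg \<omega> a f) = seg_avg \<omega> a (partial i f)"
proof
  fix x
  show "partial i (seg_avg \<omega> a f) x = seg_avg \<omega> a (partial i f) x"
    using partial_eqI[OF has_derivative_seg_avg[OF assms, of a x], of i]
    by (simp add: axis_def if_distrib[of "\<lambda>u. u * _"] cong: if_cong)
qed

lemma smooth_seg_avg:
  assumes f: "smooth f" and \<omega>: "continuous_on {0..1} \<omega>"
  shows "smooth (seg_avg \<omega> a f)"
proof -
  have d: "seg_avg \<omega> a g differentiable (at x)" if "smooth g" for g x
    using has_derivative_seg_avg[OF that \<omega>] unfolding differentiable_def by blast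
  have "cdiff n (seg_avg \<omega> a f)" for n
    using f
  proof (induction n arbitrary: f)
    case 0
    then show ?case by (simp add: d)
  next
    case (Suc n)
    then show ?case by (simp add: d partial_seg_avg[OF _ \<omega>] smooth_partial)
  qed
  then show ?thesis by (simp add: smooth_iff_cdiff)
qed

lemma abs_seg_avg_le:
  assumes f: "smooth f" and \<omega>: "continuous_on {0..1} \<omega>" "\<And>s. s \<in> {0..1} \<Longrightarrow> \<bar>\<omega> s\<bar> \<le> 1"
    and M: "\<And>x. \<bar>f x\<bar> \<le> M"
  shows "\<bar>seg_avg \<omega> a f x\<bar> \<le> M"
proof -
  have "norm (integral {0..1} (\<lambda>s. \<omega> s * f (x - s *\<^sub>R a))) \<le> M * (1 - 0)"
  proof (rule integral_bound)
    show "continuous_on {0..1} (\<lambda>s. \<omega> s * f (x - s *\<^sub>R a))"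
      using \<omega> by (intro continuous_intros continuous_on_smooth_compose[OF f])
    show "norm (\<omega> s * f (x - s *\<^sub>R a)) \<le> M" if "s \<in> {0..1}" for s
      using mult_mono[OF \<omega>(2)[OF that] M[of "x - s *\<^sub>R a"]] by (simp add: abs_mult)
  qed simp
  then show ?thesis by (simp add: seg_avg_def)
qed

text \<open>The mean at \<open>x\<close> reads \<open>f\<close> behind \<open>x\<close>, so the
  support of \<open>f\<close> is swept forward along \<open>a\<close>. The swept set is the
  continuous image of a compact product, and it stays in \<open>V\<close> as soon as
  \<open>U\<close> can be slid along \<open>a\<close> inside \<open>V\<close>.\<close>

lemma test_functions_seg_avg:
  assumes f: "f \<in> test_functions U" and \<omega>: "continuous_on {0..1} \<omega>"
    and U: "\<And>x s. x \<in> U \<Longrightarrow> s \<in> {0..1} \<Longrightarrow> x + s *\<^sub>R a \<in> V"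
  shows "seg_avg \<omega> a f \<in> test_functions V"
proof (rule test_functionsI)
  let ?K = "(\<lambda>(x, s). x + s *\<^sub>R a) ` (supp f \<times> {0..1})"
  show "smooth (seg_avg \<omega> a f)" by (rule smooth_seg_avg[OF test_functions_smooth[OF f] \<omega>])
  show "compact ?K"
  proof (intro compact_continuous_image compact_Times test_functions_compact_supp[OF f] compact_Icc)
    show "continuous_on (supp f \<times> {0..1}) (\<lambda>(x, s). x + s *\<^sub>R a)"
      unfolding split_beta by (intro continuous_intros)
  qed
  show "?K \<subseteq> V"
  proof (rule image_subsetI)
    fix p assume "p \<in> supp f \<times> {0..1::real}"
    then have "fst p \<in> U" "snd p \<in> {0..1}"
      using test_functions_supp[OF f] by (auto simp only: mem_Times_iff)
    with U show "(\<lambda>(x, s). x + s *\<^sub>R a) p \<in> V" by (simp add: split_beta)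
  qed
  fix x assume x: "x \<notin> ?K"
  have "f (x - s *\<^sub>R a) = 0" if "s \<in> {0..1}" for s
  proof (rule notin_supp, rule notI)
    assume "x - s *\<^sub>R a \<in> supp f"
    then have "(\<lambda>(x, s). x + s *\<^sub>R a) (x - s *\<^sub>R a, s) \<in> ?K"
      using that by (intro imageI SigmaI)
    with x show False by simp
  qed
  then have "integral {0..1} (\<lambda>s. \<omega> s * f (x - s *\<^sub>R a)) = integral {0..1} (\<lambda>s::real. 0)"
    by (intro integral_cong) simp
  then show "seg_avg \<omega> a f x = 0" by (simp add: seg_avg_def)
qed

lemma has_real_derivative_along_segment:
  assumes "smooth f"
  shows "((\<lambda>s. f (x - s *\<^sub>R a)) has_real_derivative - (\<Sum>i\<in>UNIV. a $ i * partial i f (x - s *\<^sub>R a))) (at s within S)"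
proof -
  have "(f has_derivative (\<lambda>h. \<Sum>i\<in>UNIV. h $ i * partial i f (x - s *\<^sub>R a))) (at (x - s *\<^sub>R a))"
    by (rule has_derivative_partial[OF smooth_differentiable[OF assms]])
  moreover have "((\<lambda>s. x - s *\<^sub>R a) has_derivative (\<lambda>h. - (h *\<^sub>R a))) (at s within S)"
    by (auto intro!: derivative_eq_intros)
  ultimately have "((\<lambda>s. f (x - s *\<^sub>R a)) has_derivative (\<lambda>h. \<Sum>i\<in>UNIV. (- (h *\<^sub>R a)) $ i * partial i f (x - s *\<^sub>R a))) (at s within S)"
    using has_derivative_compose by blast
  moreover have "(\<lambda>h. \<Sum>i\<in>UNIV. (- (h *\<^sub>R a)) $ i * partial i f (x - s *\<^sub>R a)) =
      (*) (- (\<Sum>i\<in>UNIV. a $ i * partial i f (x - s *\<^sub>R a)))"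
    by (rule ext) (simp add: sum_negf sum_distrib_left mult_ac)
  ultimately show ?thesis by (simp only: has_field_derivative_def)
qed

text \<open>Along the segment the directional derivative is minus the derivative in \<open>s\<close>
  of \<open>f (x - s *\<^sub>R a)\<close>, so the fundamental theorem of calculus leaves only the
  two end values.\<close>

lemma directional_partial_seg_avg_1:
  assumes f: "smooth f"
  shows "(\<Sum>i\<in>UNIV. a $ i * partial i (seg_avg (\<lambda>_. 1) a f) x) = f x - f (x - a)"
proof -
  have "((\<lambda>s. - (\<Sum>i\<in>UNIV. a $ i * partial i f (x - s *\<^sub>R a))) has_integral f (x - 1 *\<^sub>R a) - f (x - 0 *\<^sub>R a)) {0..1}"
    by (rule fundamental_theorem_of_calculus)
      (simp_all only: zero_le_one has_real_derivative_iff_has_vector_derivative[symmetric]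
        has_real_derivative_along_segment[OF f])
  from has_integral_neg[OF this]
  have "integral {0..1} (\<lambda>s. \<Sum>i\<in>UNIV. a $ i * partial i f (x - s *\<^sub>R a)) = f x - f (x - a)"
    by (simp add: integral_unique)
  moreover have "integral {0..1} (\<lambda>s. \<Sum>i\<in>UNIV. a $ i * partial i f (x - s *\<^sub>R a))
      = (\<Sum>i\<in>UNIV. integral {0..1} (\<lambda>s. a $ i * partial i f (x - s *\<^sub>R a)))"
    by (intro integral_sum integrable_continuous_interval continuous_on_mult finite
        continuous_on_diff continuous_on_const continuous_on_id continuous_on_segment smooth_partial f)
  ultimately show ?thesis
    by (simp add: partial_seg_avg f) (simp add: seg_avg_def)
qed

text \<open>Integration by parts in \<open>s\<close>: the weight \<open>1 - s\<close> kills the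
  boundary term at \<open>s = 1\<close>, and its own derivative produces the unweighted
  mean.\<close>

lemma directional_partial_seg_avg_weighted:
  assumes f: "smooth f"
  shows "(\<Sum>i\<in>UNIV. a $ i * partial i (seg_avg (\<lambda>s. 1 - s) a f) x) = f x - seg_avg (\<lambda>_. 1) a f x"
proof -
  let ?D = "\<lambda>s. \<Sum>i\<in>UNIV. a $ i * partial i f (x - s *\<^sub>R a)"
  have "((\<lambda>s. - f (x - s *\<^sub>R a) + (1 - s) * - ?D s) has_integral (1 - 1) * f (x - 1 *\<^sub>R a) - (1 - 0) * f (x - 0 *\<^sub>R a)) {0..1}"
  proof (rule fundamental_theorem_of_calculus)
    fix s :: real
    have d1: "((\<lambda>s. 1 - s) has_real_derivative - 1) (at s within {0..1})"
      by (auto intro!: derivative_eq_intros)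
    show "((\<lambda>s. (1 - s) * f (x - s *\<^sub>R a)) has_vector_derivative - f (x - s *\<^sub>R a) + (1 - s) * - ?D s) (at s within {0..1})"
      unfolding has_real_derivative_iff_has_vector_derivative[symmetric]
      using DERIV_mult[OF d1 has_real_derivative_along_segment[OF f, of x a s "{0..1}"]]
      by (simp add: mult.commute)
  qed simp
  from has_integral_neg[OF this]
  have I: "((\<lambda>s. f (x - s *\<^sub>R a) + (1 - s) * ?D s) has_integral f x) {0..1}"
    by (simp add: algebra_simps)
  have i1: "(\<lambda>s. f (x - s *\<^sub>R a)) integrable_on {0..1}"
    by (intro integrable_continuous_interval continuous_on_segment f)
  have i2: "(\<lambda>s. (1 - s) * ?D s) integrable_on {0..1}"
    by (intro integrable_continuous_interval continuous_on_sum continuous_on_mult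
        continuous_on_diff continuous_on_const continuous_on_id continuous_on_segment smooth_partial f)
  have "f x = integral {0..1} (\<lambda>s. f (x - s *\<^sub>R a)) + integral {0..1} (\<lambda>s. (1 - s) * ?D s)"
    using integral_unique[OF I] integral_add[OF i1 i2] by simp
  moreover have "integral {0..1} (\<lambda>s. (1 - s) * ?D s)
      = (\<Sum>i\<in>UNIV. a $ i * seg_avg (\<lambda>s. 1 - s) a (partial i f) x)"
  proof -
    have "integral {0..1} (\<lambda>s. (1 - s) * ?D s) =
        integral {0..1} (\<lambda>s. \<Sum>i\<in>UNIV. a $ i * ((1 - s) * partial i f (x - s *\<^sub>R a)))"
      by (simp add: sum_distrib_left mult_ac)
    also have "\<dots> = (\<Sum>i\<in>UNIV. integral {0..1} (\<lambda>s. a $ i * ((1 - s) * partial i f (x - s *\<^sub>R a))))"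
      by (intro integral_sum integrable_continuous_interval continuous_on_mult finite
        continuous_on_diff continuous_on_const continuous_on_id continuous_on_segment smooth_partial f)
    finally show ?thesis by (simp add: seg_avg_def)
  qed
  moreover have "continuous_on {0..1} (\<lambda>s::real. 1 - s)" by (intro continuous_intros)
  ultimately show ?thesis
    by (simp add: partial_seg_avg[OF f]) (simp add: seg_avg_def)
qed

section \<open>Jordan decomposition\<close>

locale real_measure =
  fixes \<Omega> :: "(real^2) set" and m :: "(real^2) set \<Rightarrow> real"
  assumes sums_UN: "(\<And>n. A n \<in> borel_sets \<Omega>) \<Longrightarrow> disjoint_family A \<Longrightarrow>
    (\<lambda>n::nat. m (A n)) sums m (\<Union>n. A n)"

lemma sigma_algebra_borel_sets: "sigma_algebra \<Omega> (borel_sets \<Omega>)"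
  using sets.sigma_algebra_axioms[of "restrict_space borel \<Omega>"] by (simp add: borel_sets_def space_restrict_space)

lemma ennreal_add_le: "ennreal (a + b) \<le> ennreal a + ennreal b"
  by (cases "0 \<le> a"; cases "0 \<le> b")
    (auto simp: ennreal_neg ennreal_plus[symmetric] simp del: ennreal_plus intro: ennreal_leI)

lemma ennreal_sum_le: "ennreal (\<Sum>i\<in>I. f i) \<le> (\<Sum>i\<in>I. ennreal (f i))"
proof (induction I rule: infinite_finite_induct)
  case (insert x F)
  have "ennreal (f x + sum f F) \<le> ennreal (f x) + ennreal (sum f F)" by (rule ennreal_add_le)
  also have "\<dots> \<le> ennreal (f x) + (\<Sum>i\<in>F. ennreal (f i))" by (intro add_left_mono insert)
  finally show ?case using insert by simp
qed auto

context real_measure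
begin

interpretation sigma_algebra \<Omega> "borel_sets \<Omega>" by (rule sigma_algebra_borel_sets)

lemma m_empty: "m {} = 0"
proof -
  have "(\<lambda>n::nat. m {}) sums m {}"
    using sums_UN[of "\<lambda>_. {}"] by (auto simp: disjoint_family_on_def)
  then have "(\<lambda>n::nat. m {}) \<longlonglongrightarrow> 0" by (intro summable_LIMSEQ_zero) (rule sums_summable)
  then show ?thesis by (simp add: LIMSEQ_const_iff)
qed

lemma m_Un:
  assumes A: "A \<in> borel_sets \<Omega>" and B: "B \<in> borel_sets \<Omega>" and AB: "A \<inter> B = {}"
  shows "m (A \<union> B) = m A + m B"
proof -
  have "(\<lambda>n. m (binaryset A B n)) sums m (\<Union>n. binaryset A B n)"
    using A B AB by (intro sums_UN) (auto simp: binaryset_def disjoint_family_on_def)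
  moreover have "(\<lambda>n. m (binaryset A B n)) sums (m A + m B)"
    by (rule binaryset_sums) (rule m_empty)
  ultimately show ?thesis by (simp add: UN_binaryset_eq sums_unique2)
qed

lemma m_Diff: "A \<in> borel_sets \<Omega> \<Longrightarrow> B \<in> borel_sets \<Omega> \<Longrightarrow> B \<subseteq> A \<Longrightarrow> m (A - B) = m A - m B"
  using m_Un[of "A - B" B] Diff[of A B] by (simp add: Un_absorb2 Int_commute)

text \<open>A set on which \<open>m\<close> is unbounded splits into two parts, one of which is
  again such a set. Iterating, the discarded parts are pairwise disjoint and have mass at least 1 in
  absolute value, so the series of their masses cannot converge.\<close>

lemma bounded_range: "\<exists>c. \<forall>B\<in>borel_sets \<Omega>. \<bar>m B\<bar> \<le> c"
proof (rule ccontr)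
  define unb where "unb A \<longleftrightarrow> (\<forall>c. \<exists>B\<in>borel_sets \<Omega>. B \<subseteq> A \<and> c < \<bar>m B\<bar>)" for A
  assume "\<not> (\<exists>c. \<forall>B\<in>borel_sets \<Omega>. \<bar>m B\<bar> \<le> c)"
  then have 0: "unb \<Omega>" unfolding unb_def using sets_into_space by (metis not_le)
  have step: "\<exists>A'. (A' \<in> borel_sets \<Omega> \<and> unb A') \<and> (A' \<subseteq> A \<and> 1 \<le> \<bar>m (A - A')\<bar>)"
    if A: "A \<in> borel_sets \<Omega> \<and> unb A" for A
  proof -
    \<comment> \<open>The excess over 1 + |m A| makes both \<open>m B\<close> and
      \<open>m (A - B)\<close> larger than 1 in absolute value, so either part may be the discarded
      one.\<close>
    from A obtain B where B: "B \<in> borel_sets \<Omega>" "B \<subseteq> A" "1 + \<bar>m A\<bar> < \<bar>m B\<bar>"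
      unfolding unb_def by blast
    have d: "m (A - B) = m A - m B" using m_Diff A B by blast
    have AB: "A - B \<in> borel_sets \<Omega>" using A B by blast
    show ?thesis
    proof (cases "unb B")
      case True
      then show ?thesis using B AB d by (intro exI[of _ B]) auto
    next
      case F: False
      have "unb (A - B)"
      proof (rule ccontr)
        assume "\<not> unb (A - B)"
        then obtain c1 where c1: "\<And>C. C \<in> borel_sets \<Omega> \<Longrightarrow> C \<subseteq> A - B \<Longrightarrow> \<bar>m C\<bar> \<le> c1"
          unfolding unb_def by (metis not_le)
        from F obtain c2 where c2: "\<And>C. C \<in> borel_sets \<Omega> \<Longrightarrow> C \<subseteq> B \<Longrightarrow> \<bar>m C\<bar> \<le> c2"
          unfolding unb_def by (metis not_le)
        from A obtain C where C: "C \<in> borel_sets \<Omega>" "C \<subseteq> A" "c1 + c2 < \<bar>m C\<bar>"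
          unfolding unb_def by blast
        have "m ((C - B) \<union> (C \<inter> B)) = m (C - B) + m (C \<inter> B)"
          using C B by (intro m_Un) auto
        then have "m C = m (C - B) + m (C \<inter> B)" by (simp add: Un_Diff_Int)
        moreover have "\<bar>m (C - B)\<bar> \<le> c1" using C B by (intro c1) auto
        moreover have "\<bar>m (C \<inter> B)\<bar> \<le> c2" using C B by (intro c2) auto
        ultimately show False using C by linarith
      qed
      moreover have "A - (A - B) = B" using B by blast
      ultimately show ?thesis using B AB by (intro exI[of _ "A - B"]) auto
    qed
  qed
  have "\<exists>S. \<forall>n::nat. (S n \<in> borel_sets \<Omega> \<and> unb (S n)) \<and> (S (Suc n) \<subseteq> S n \<and> 1 \<le> \<bar>m (S n - S (Suc n))\<bar>)"
    by (rule dependent_nat_choice) (use 0 step in auto)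
  then obtain S where S: "\<And>n::nat. S n \<in> borel_sets \<Omega>" "\<And>n. S (Suc n) \<subseteq> S n"
    "\<And>n. 1 \<le> \<bar>m (S n - S (Suc n))\<bar>" by blast
  have mono: "S j \<subseteq> S i" if "i \<le> j" for i j
    using S(2) that by (rule lift_Suc_antimono_le)
  have "disjoint_family (\<lambda>n. S n - S (Suc n))"
    unfolding disjoint_family_on_def
  proof (intro ballI impI)
    fix i j :: nat assume "i \<noteq> j"
    then consider "Suc i \<le> j" | "Suc j \<le> i" by linarith
    then show "(S i - S (Suc i)) \<inter> (S j - S (Suc j)) = {}"
      using mono by cases blast+
  qed
  then have "(\<lambda>n. m (S n - S (Suc n))) sums m (\<Union>n. S n - S (Suc n))"
    using S by (intro sums_UN) auto
  then have "(\<lambda>n. m (S n - S (Suc n))) \<longlonglongrightarrow> 0"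
    by (intro summable_LIMSEQ_zero) (rule sums_summable)
  then have "\<forall>\<^sub>F n in sequentially. \<bar>m (S n - S (Suc n))\<bar> < 1"
    using tendstoD[of "\<lambda>n. m (S n - S (Suc n))" 0 sequentially 1] by simp
  then obtain N where "\<bar>m (S N - S (Suc N))\<bar> < 1" by (auto simp: eventually_sequentially)
  with S(3)[of N] show False by simp
qed

definition pv :: "(real^2) set \<Rightarrow> ennreal" where
  "pv A = (SUP B\<in>{B \<in> borel_sets \<Omega>. B \<subseteq> A}. ennreal (m B))"

lemma le_pv: "B \<in> borel_sets \<Omega> \<Longrightarrow> B \<subseteq> A \<Longrightarrow> ennreal (m B) \<le> pv A"
  unfolding pv_def by (rule SUP_upper) auto

lemma pv_leI: "(\<And>B. B \<in> borel_sets \<Omega> \<Longrightarrow> B \<subseteq> A \<Longrightarrow> ennreal (m B) \<le> c) \<Longrightarrow> pv A \<le> c"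
  unfolding pv_def by (rule SUP_least) auto

lemma pv_mono: "A \<subseteq> B \<Longrightarrow> pv A \<le> pv B"
  by (rule pv_leI) (auto intro: le_pv)

lemma pv_superadd:
  assumes "A \<in> borel_sets \<Omega>" "B \<in> borel_sets \<Omega>" "A \<inter> B = {}"
  shows "pv A + pv B \<le> pv (A \<union> B)"
proof -
  have *: "ennreal (m C) + ennreal (m D) \<le> pv (A \<union> B)"
    if C: "C \<in> borel_sets \<Omega>" "C \<subseteq> A" and D: "D \<in> borel_sets \<Omega>" "D \<subseteq> B" for C D
  proof -
    \<comment> \<open>\<open>ennreal\<close> is additive only on nonnegative reals. A set of
      negative mass is replaced by the empty set, which has the same \<open>ennreal\<close>
      value.\<close>
    define C' where "C' = (if 0 \<le> m C then C else {})"
    define D' where "D' = (if 0 \<le> m D then D else {})"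
    have C': "C' \<in> borel_sets \<Omega>" "C' \<subseteq> A" "ennreal (m C) = ennreal (m C')" "0 \<le> m C'"
      using C by (auto simp: C'_def m_empty ennreal_neg)
    have D': "D' \<in> borel_sets \<Omega>" "D' \<subseteq> B" "ennreal (m D) = ennreal (m D')" "0 \<le> m D'"
      using D by (auto simp: D'_def m_empty ennreal_neg)
    have "m (C' \<union> D') = m C' + m D'" using C' D' assms by (intro m_Un) auto
    then have "ennreal (m C) + ennreal (m D) = ennreal (m (C' \<union> D'))"
      using C' D' by simp
    also have "\<dots> \<le> pv (A \<union> B)" using C' D' by (intro le_pv) auto
    finally show ?thesis .
  qed
  have ne: "{C \<in> borel_sets \<Omega>. C \<subseteq> A} \<noteq> {}" for A by auto
  have "ennreal (m C) + pv B \<le> pv (A \<union> B)" if C: "C \<in> borel_sets \<Omega>" "C \<subseteq> A" for C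
    unfolding pv_def[of B] using * C by (subst ennreal_SUP_add_right[OF ne]) (auto intro!: SUP_least)
  then show ?thesis
    unfolding pv_def[of A] by (subst ennreal_SUP_add_left[OF ne, symmetric]) (auto intro!: SUP_least)
qed

text \<open>Superadditivity passes to countable disjoint unions through partial sums. For the other
  inequality a competitor \<open>B\<close> is cut along the sets \<open>A n\<close> and countable
  additivity of \<open>m\<close> is applied to the pieces.\<close>

lemma measure_space_pv: "measure_space \<Omega> (borel_sets \<Omega>) pv"
proof -
  have pos: "positive (borel_sets \<Omega>) pv"
  proof -
    have "pv {} \<le> 0" by (rule pv_leI) (auto simp: m_empty)
    then show ?thesis by (simp add: positive_def)
  qed
  moreover have "countably_additive (borel_sets \<Omega>) pv"
    unfolding countably_additive_def
  proof (intro allI impI antisym)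
    fix A :: "nat \<Rightarrow> (real^2) set"
    assume A: "range A \<subseteq> borel_sets \<Omega>" and dis: "disjoint_family A" and UA: "\<Union>(range A) \<in> borel_sets \<Omega>"
    show "(\<Sum>i. pv (A i)) \<le> pv (\<Union>(range A))"
    proof (rule suminf_le_const)
      fix n
      have "(\<Sum>i<n. pv (A i)) \<le> pv (\<Union>i<n. A i)"
      proof (induction n)
        case 0
        then show ?case using pos by (simp add: positive_def)
      next
        case (Suc n)
        have "A i \<inter> A n = {}" if "i < n" for i
          using disjoint_family_onD[OF dis, of i n] that by simp
        then have "(\<Union>i<n. A i) \<inter> A n = {}" by blast
        moreover have "(\<Union>i<n. A i) \<in> borel_sets \<Omega>" using A by (intro finite_UN) auto
        ultimately have "pv (\<Union>i<n. A i) + pv (A n) \<le> pv ((\<Union>i<n. A i) \<union> A n)"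
          using A by (intro pv_superadd) auto
        then have "(\<Sum>i<n. pv (A i)) + pv (A n) \<le> pv ((\<Union>i<n. A i) \<union> A n)"
          using add_right_mono[OF Suc] by (rule order_trans[rotated])
        then show ?case by (simp add: lessThan_Suc Un_commute add.commute)
      qed
      also have "\<dots> \<le> pv (\<Union>(range A))" by (rule pv_mono) auto
      finally show "(\<Sum>i<n. pv (A i)) \<le> pv (\<Union>(range A))" .
    qed simp
    show "pv (\<Union>(range A)) \<le> (\<Sum>i. pv (A i))"
    proof (rule pv_leI)
      fix B assume B: "B \<in> borel_sets \<Omega>" "B \<subseteq> \<Union>(range A)"
      have "(\<lambda>n. m (B \<inter> A n)) sums m (\<Union>n. B \<inter> A n)"
      proof (rule sums_UN)
        show "B \<inter> A n \<in> borel_sets \<Omega>" for n using A B by blast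
        show "disjoint_family (\<lambda>n. B \<inter> A n)" by (rule disjoint_family_subset[OF dis]) simp
      qed
      moreover have "(\<Union>n. B \<inter> A n) = B" using B by blast
      ultimately have "(\<lambda>n. \<Sum>i<n. m (B \<inter> A i)) \<longlonglongrightarrow> m B" by (simp add: sums_def)
      then have "(\<lambda>n. ennreal (\<Sum>i<n. m (B \<inter> A i))) \<longlonglongrightarrow> ennreal (m B)" by (rule tendsto_ennrealI)
      moreover have "ennreal (\<Sum>i<n. m (B \<inter> A i)) \<le> (\<Sum>i. pv (A i))" for n
      proof -
        have "ennreal (\<Sum>i<n. m (B \<inter> A i)) \<le> (\<Sum>i<n. ennreal (m (B \<inter> A i)))" by (rule ennreal_sum_le)
        also have "\<dots> \<le> (\<Sum>i<n. pv (A i))" using A B by (intro sum_mono le_pv) auto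
        also have "\<dots> \<le> (\<Sum>i. pv (A i))" by (rule sum_le_suminf) auto
        finally show ?thesis .
      qed
      ultimately show "ennreal (m B) \<le> (\<Sum>i. pv (A i))" by (intro LIMSEQ_le_const2) auto
    qed
  qed
  ultimately show ?thesis by (simp add: measure_space_def sigma_algebra_borel_sets)
qed

lemma sets_pos_variation: "sets (pos_variation \<Omega> m) = borel_sets \<Omega>"
  and space_pos_variation: "space (pos_variation \<Omega> m) = \<Omega>"
  by (simp_all add: pos_variation_def)

lemma emeasure_pos_variation: "A \<in> borel_sets \<Omega> \<Longrightarrow> emeasure (pos_variation \<Omega> m) A = pv A"
  unfolding pos_variation_def pv_def[abs_def, symmetric]
  using measure_space_pv by (intro emeasure_measure_of_sigma) (auto simp: measure_space_def)

lemma finite_measure_pos_variation: "finite_measure (pos_variation \<Omega> m)"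
proof
  obtain c where c: "\<And>B. B \<in> borel_sets \<Omega> \<Longrightarrow> \<bar>m B\<bar> \<le> c" using bounded_range by blast
  have "pv \<Omega> \<le> ennreal c"
    using c by (intro pv_leI ennreal_leI) (meson abs_le_D1)
  then show "emeasure (pos_variation \<Omega> m) (space (pos_variation \<Omega> m)) \<noteq> \<infinity>"
    using emeasure_pos_variation[of \<Omega>] by (auto simp: space_pos_variation top_unique)
qed

lemma measure_pos_variation_ge:
  assumes "A \<in> borel_sets \<Omega>" "B \<in> borel_sets \<Omega>" "B \<subseteq> A"
  shows "m B \<le> measure (pos_variation \<Omega> m) A"
proof -
  interpret finite_measure "pos_variation \<Omega> m" by (rule finite_measure_pos_variation)
  have "ennreal (m B) \<le> ennreal (measure (pos_variation \<Omega> m) A)"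
    using le_pv[OF assms(2,3)] emeasure_pos_variation[OF assms(1)] by (simp add: emeasure_eq_measure)
  then show ?thesis by (simp add: ennreal_le_iff)
qed

lemma measure_pos_variation_le:
  assumes "A \<in> borel_sets \<Omega>" "\<And>B. B \<in> borel_sets \<Omega> \<Longrightarrow> B \<subseteq> A \<Longrightarrow> m B \<le> c"
  shows "measure (pos_variation \<Omega> m) A \<le> c"
proof -
  interpret finite_measure "pos_variation \<Omega> m" by (rule finite_measure_pos_variation)
  have "0 \<le> c" using assms(2)[of "{}"] by (simp add: m_empty)
  have "pv A \<le> ennreal c" using assms(2) by (intro pv_leI ennreal_leI)
  then show ?thesis
    using emeasure_pos_variation[OF assms(1)] \<open>0 \<le> c\<close> by (metis emeasure_eq_measure ennreal_le_iff)
qed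

lemma uminus: "real_measure \<Omega> (\<lambda>A. - m A)"
  by standard (simp add: sums_UN sums_minus)

end

text \<open>Complementation inside \<open>A\<close> turns a competitor \<open>B\<close> for
  \<open>m\<close> into the competitor \<open>A - B\<close> for \<open>- m\<close>, and the two
  values differ by exactly \<open>m A\<close>; hence so do the two suprema.\<close>

lemma (in real_measure) jordan:
  assumes A: "A \<in> borel_sets \<Omega>"
  shows "m A = measure (pos_variation \<Omega> m) A - measure (pos_variation \<Omega> (\<lambda>A. - m A)) A"
proof -
  interpret sigma_algebra \<Omega> "borel_sets \<Omega>" by (rule sigma_algebra_borel_sets)
  interpret n: real_measure \<Omega> "\<lambda>A. - m A" by (rule uminus)
  have "measure (pos_variation \<Omega> m) A \<le> m A + measure (pos_variation \<Omega> (\<lambda>A. - m A)) A"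
  proof (rule measure_pos_variation_le[OF A])
    fix B assume B: "B \<in> borel_sets \<Omega>" "B \<subseteq> A"
    then have "- m (A - B) \<le> measure (pos_variation \<Omega> (\<lambda>A. - m A)) A"
      using A by (intro n.measure_pos_variation_ge) auto
    then show "m B \<le> m A + measure (pos_variation \<Omega> (\<lambda>A. - m A)) A" using m_Diff[OF A B] by simp
  qed
  moreover have "measure (pos_variation \<Omega> (\<lambda>A. - m A)) A \<le> - m A + measure (pos_variation \<Omega> m) A"
  proof (rule n.measure_pos_variation_le[OF A])
    fix B assume B: "B \<in> borel_sets \<Omega>" "B \<subseteq> A"
    then have "m (A - B) \<le> measure (pos_variation \<Omega> m) A"
      using A by (intro measure_pos_variation_ge) auto
    then show "- m B \<le> - m A + measure (pos_variation \<Omega> m) A" using m_Diff[OF A B] by simp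
  qed
  ultimately show ?thesis by simp
qed


section \<open>Integration against a signed measure\<close>

lemma measurable_borel_sets:
  "sets Q = borel_sets \<Omega> \<Longrightarrow> continuous_on \<Omega> \<phi> \<Longrightarrow> \<phi> \<in> borel_measurable Q"
  unfolding borel_sets_def
  using borel_measurable_continuous_on_restrict measurable_cong_sets by blast

lemma measurable_sets_eq:
  "sets P = borel_sets \<Omega> \<Longrightarrow> sets Q = borel_sets \<Omega> \<Longrightarrow> (\<phi> :: _ \<Rightarrow> real) \<in> borel_measurable P \<Longrightarrow> \<phi> \<in> borel_measurable Q"
  using measurable_cong_sets[of P Q "borel :: real measure" borel] by metis

lemma space_borel_sets:
  assumes "sets Q = borel_sets \<Omega>"
  shows "space Q = \<Omega>"
  using sets_eq_imp_space_eq[of Q "restrict_space borel \<Omega>"] assms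
  by (simp add: borel_sets_def space_restrict_space)

lemma integrable_bounded:
  fixes \<phi> :: "real^2 \<Rightarrow> real"
  assumes "finite_measure Q" "sets Q = borel_sets \<Omega>" "\<phi> \<in> borel_measurable Q" "\<And>x. x \<in> \<Omega> \<Longrightarrow> \<bar>\<phi> x\<bar> \<le> M"
  shows "integrable Q \<phi>"
  using assms(3,4) space_borel_sets[OF assms(2)]
  by (intro finite_measure.integrable_const_bound[OF assms(1), of _ M]) auto

lemma abs_integral_le:
  fixes \<phi> :: "real^2 \<Rightarrow> real"
  assumes Q: "finite_measure Q" "sets Q = borel_sets \<Omega>"
    and \<phi>: "\<phi> \<in> borel_measurable Q" "\<And>x. x \<in> \<Omega> \<Longrightarrow> \<bar>\<phi> x\<bar> \<le> M"
  shows "\<bar>\<integral>x. \<phi> x \<partial>Q\<bar> \<le> M * measure Q \<Omega>"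
proof -
  interpret finite_measure Q by fact
  have "\<bar>\<integral>x. \<phi> x \<partial>Q\<bar> \<le> (\<integral>x. \<bar>\<phi> x\<bar> \<partial>Q)" by (rule integral_abs_bound)
  also have "\<dots> \<le> (\<integral>x. M \<partial>Q)"
    using integrable_bounded[OF Q \<phi>] \<phi>(2) by (intro integral_mono) (auto simp: space_borel_sets[OF Q(2)])
  finally show ?thesis by (simp add: space_borel_sets[OF Q(2)] mult.commute)
qed

text \<open>Rounding the integrand down to a multiple of \<open>e\<close> replaces the integral by a
  finite sum in which the measure enters only through its values on level sets. The margin 1 in the
  bound for \<open>K\<close> keeps every rounded value inside the summation range.\<close>

lemma integral_step_approx:
  fixes \<phi> :: "real^2 \<Rightarrow> real"
  assumes Q: "finite_measure Q" "sets Q = borel_sets \<Omega>"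
    and \<phi>: "\<phi> \<in> borel_measurable Q" "\<And>x. x \<in> \<Omega> \<Longrightarrow> \<bar>\<phi> x\<bar> \<le> M"
    and e: "0 < e" and K: "M / e + 1 \<le> of_int K"
  shows "\<bar>(\<integral>x. \<phi> x \<partial>Q) - (\<Sum>k\<in>{-K..K}. e * of_int k * measure Q {x\<in>\<Omega>. \<lfloor>\<phi> x / e\<rfloor> = k})\<bar> \<le> e * measure Q \<Omega>"
proof -
  interpret finite_measure Q by fact
  note sp = space_borel_sets[OF Q(2)]
  have [measurable]: "\<phi> \<in> borel_measurable Q" by fact
  define A where "A k = {x\<in>\<Omega>. \<lfloor>\<phi> x / e\<rfloor> = k}" for k
  have A: "A k \<in> sets Q" for k
    unfolding A_def sp[symmetric] by measurable
  define s where "s x = (\<Sum>k\<in>{-K..K}. e * of_int k * indicator (A k) x)" for x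
  have is_: "integrable Q s"
    unfolding s_def using A by (intro Bochner_Integration.integrable_sum integrable_mult_right integrable_real_indicator)
      (auto simp: less_top[symmetric])
  have Is: "(\<integral>x. s x \<partial>Q) = (\<Sum>k\<in>{-K..K}. e * of_int k * measure Q (A k))"
    unfolding s_def using A
    by (subst Bochner_Integration.integral_sum) (auto simp: less_top[symmetric] sets.Int_space_eq2)
  have s: "s x = e * of_int \<lfloor>\<phi> x / e\<rfloor>" if x: "x \<in> \<Omega>" for x
  proof -
    have "\<bar>\<phi> x / e\<bar> \<le> M / e" using \<phi>(2)[OF x] e by (simp add: divide_right_mono)
    then have "\<bar>\<phi> x / e\<bar> \<le> of_int K - 1" using K by linarith
    then have "- of_int K \<le> \<phi> x / e" "\<phi> x / e < of_int K + 1" by linarith+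
    then have mem: "\<lfloor>\<phi> x / e\<rfloor> \<in> {-K..K}" by (simp add: le_floor_iff floor_le_iff)
    have "s x = (\<Sum>k\<in>{-K..K}. if k = \<lfloor>\<phi> x / e\<rfloor> then e * of_int k else 0)"
      unfolding s_def A_def using x by (intro sum.cong) (auto simp: indicator_def)
    then show ?thesis using mem by simp
  qed
  have "\<bar>\<phi> x - s x\<bar> \<le> e" if x: "x \<in> \<Omega>" for x
  proof -
    have "\<phi> x - s x = e * (\<phi> x / e - of_int \<lfloor>\<phi> x / e\<rfloor>)"
      using e by (simp add: s[OF x] right_diff_distrib)
    moreover have "\<bar>\<phi> x / e - of_int \<lfloor>\<phi> x / e\<rfloor>\<bar> \<le> 1" by linarith
    ultimately show ?thesis using e by (simp add: abs_mult)
  qed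
  moreover have "(\<lambda>x. \<phi> x - s x) \<in> borel_measurable Q"
    using borel_measurable_integrable[OF is_] by measurable
  ultimately have "\<bar>\<integral>x. \<phi> x - s x \<partial>Q\<bar> \<le> e * measure Q \<Omega>"
    using abs_integral_le[OF Q] by blast
  moreover have "(\<integral>x. \<phi> x - s x \<partial>Q) = (\<integral>x. \<phi> x \<partial>Q) - (\<integral>x. s x \<partial>Q)"
    by (rule Bochner_Integration.integral_diff[OF integrable_bounded[OF Q \<phi>] is_])
  ultimately show ?thesis unfolding Is unfolding A_def by argo
qed

lemma le_0_if_le_mult:
  fixes x C :: real
  assumes "\<And>e. 0 < e \<Longrightarrow> x \<le> e * C" "0 \<le> C"
  shows "x \<le> 0"
proof (rule ccontr)
  assume x: "\<not> x \<le> 0"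
  then have "x \<le> x / (C + 1) * C" using assms by (intro assms(1)) auto
  also have "\<dots> < x" using x assms(2) by (simp add: field_simps)
  finally show False by simp
qed

text \<open>Level-set sums see only values of \<open>m\<close>, so every decomposition of
  \<open>m\<close> into two finite measures gives the same difference of integrals. The lemma is
  meant for decompositions that are not known to be the Jordan decomposition, such as the one built
  in \<open>riesz\<close>.\<close>

lemma signed_integral_eq:
  fixes \<phi> :: "real^2 \<Rightarrow> real"
  assumes m: "real_measure \<Omega> m"
    and P: "finite_measure P" "sets P = borel_sets \<Omega>" and N: "finite_measure N" "sets N = borel_sets \<Omega>"
    and PN: "\<And>A. A \<in> borel_sets \<Omega> \<Longrightarrow> m A = measure P A - measure N A"
    and \<phi>: "\<phi> \<in> borel_measurable P" "\<And>x. x \<in> \<Omega> \<Longrightarrow> \<bar>\<phi> x\<bar> \<le> M"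
  shows "signed_integral \<Omega> m \<phi> = (\<integral>x. \<phi> x \<partial>P) - (\<integral>x. \<phi> x \<partial>N)"
proof -
  interpret m: real_measure \<Omega> m by (rule m)
  interpret n: real_measure \<Omega> "\<lambda>A. - m A" by (rule m.uminus)
  let ?P = "pos_variation \<Omega> m" and ?N = "pos_variation \<Omega> (\<lambda>A. - m A)"
  note fP = m.finite_measure_pos_variation m.sets_pos_variation
  note fN = n.finite_measure_pos_variation n.sets_pos_variation
  have meas: "\<phi> \<in> borel_measurable N" "\<phi> \<in> borel_measurable ?P" "\<phi> \<in> borel_measurable ?N"
    by (rule measurable_sets_eq[OF P(2) _ \<phi>(1)], fact N fP fN)+
  define C where "C = measure P \<Omega> + measure N \<Omega> + measure ?P \<Omega> + measure ?N \<Omega>"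
  define X where "X = signed_integral \<Omega> m \<phi> - ((\<integral>x. \<phi> x \<partial>P) - (\<integral>x. \<phi> x \<partial>N))"
  have "\<bar>X\<bar> \<le> e * C" if e: "0 < e" for e
  proof -
    define K where "K = \<lceil>M / e + 1\<rceil>"
    have K: "M / e + 1 \<le> of_int K" unfolding K_def by simp
    define S where "S Q = (\<Sum>k\<in>{-K..K}. e * of_int k * measure Q {x\<in>\<Omega>. \<lfloor>\<phi> x / e\<rfloor> = k})" for Q :: "(real^2) measure"
    have A: "{x\<in>\<Omega>. \<lfloor>\<phi> x / e\<rfloor> = k} \<in> borel_sets \<Omega>" for k
    proof -
      have [measurable]: "\<phi> \<in> borel_measurable P" by fact
      have "{x\<in>space P. \<lfloor>\<phi> x / e\<rfloor> = k} \<in> sets P" by measurable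
      then show ?thesis by (simp add: P(2) space_borel_sets[OF P(2)])
    qed
    have "S ?P - S ?N = S P - S N"
      unfolding S_def sum_subtractf[symmetric] right_diff_distrib[symmetric]
      using m.jordan[OF A] PN[OF A] by simp
    moreover have "\<bar>(\<integral>x. \<phi> x \<partial>P) - S P\<bar> \<le> e * measure P \<Omega>" unfolding S_def
      by (rule integral_step_approx[OF P \<phi> e K])
    moreover have "\<bar>(\<integral>x. \<phi> x \<partial>N) - S N\<bar> \<le> e * measure N \<Omega>" unfolding S_def
      by (rule integral_step_approx[OF N meas(1) \<phi>(2) e K])
    moreover have "\<bar>(\<integral>x. \<phi> x \<partial>?P) - S ?P\<bar> \<le> e * measure ?P \<Omega>" unfolding S_def
      by (rule integral_step_approx[OF fP meas(2) \<phi>(2) e K])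
    moreover have "\<bar>(\<integral>x. \<phi> x \<partial>?N) - S ?N\<bar> \<le> e * measure ?N \<Omega>" unfolding S_def
      by (rule integral_step_approx[OF fN meas(3) \<phi>(2) e K])
    ultimately show ?thesis unfolding X_def C_def signed_integral_def distrib_left by linarith
  qed
  moreover have "0 \<le> C" unfolding C_def by simp
  ultimately have "\<bar>X\<bar> \<le> 0" by (rule le_0_if_le_mult)
  then show ?thesis by (simp add: X_def)
qed

context real_measure
begin

lemma integrable_variations:
  fixes \<phi> :: "real^2 \<Rightarrow> real"
  assumes "continuous_on \<Omega> \<phi>" "\<And>x. x \<in> \<Omega> \<Longrightarrow> \<bar>\<phi> x\<bar> \<le> M"
  shows "integrable (pos_variation \<Omega> m) \<phi>" "integrable (pos_variation \<Omega> (\<lambda>A. - m A)) \<phi>"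
proof -
  interpret n: real_measure \<Omega> "\<lambda>A. - m A" by (rule uminus)
  show "integrable (pos_variation \<Omega> m) \<phi>" "integrable (pos_variation \<Omega> (\<lambda>A. - m A)) \<phi>"
    using assms finite_measure_pos_variation sets_pos_variation n.finite_measure_pos_variation n.sets_pos_variation
    by (metis integrable_bounded measurable_borel_sets)+
qed

lemma signed_integral_add:
  assumes "continuous_on \<Omega> f" "\<And>x. x \<in> \<Omega> \<Longrightarrow> \<bar>f x\<bar> \<le> M" "continuous_on \<Omega> g" "\<And>x. x \<in> \<Omega> \<Longrightarrow> \<bar>g x\<bar> \<le> M'"
  shows "signed_integral \<Omega> m (\<lambda>x. f x + g x) = signed_integral \<Omega> m f + signed_integral \<Omega> m g"
  unfolding signed_integral_def
  using integrable_variations[OF assms(1,2)] integrable_variations[OF assms(3,4)] by simp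

text \<open>Each of the two integrals is 0 by default if the function is not integrable, and scaling
  by a nonzero constant does not change integrability.\<close>

lemma signed_integral_cmult: "signed_integral \<Omega> m (\<lambda>x. c * f x) = c * signed_integral \<Omega> m f"
  unfolding signed_integral_def by (simp add: right_diff_distrib)

lemma abs_signed_integral_le:
  "\<exists>C\<ge>0. \<forall>\<phi> M. continuous_on \<Omega> \<phi> \<longrightarrow> (\<forall>x\<in>\<Omega>. \<bar>\<phi> x\<bar> \<le> M) \<longrightarrow> \<bar>signed_integral \<Omega> m \<phi>\<bar> \<le> C * M"
proof -
  interpret n: real_measure \<Omega> "\<lambda>A. - m A" by (rule uminus)
  let ?C = "measure (pos_variation \<Omega> m) \<Omega> + measure (pos_variation \<Omega> (\<lambda>A. - m A)) \<Omega>"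
  have "\<bar>signed_integral \<Omega> m \<phi>\<bar> \<le> ?C * M" if "continuous_on \<Omega> \<phi>" "\<And>x. x \<in> \<Omega> \<Longrightarrow> \<bar>\<phi> x\<bar> \<le> M" for \<phi> M
    using abs_integral_le[OF finite_measure_pos_variation sets_pos_variation measurable_borel_sets[OF sets_pos_variation that(1)] that(2)]
      abs_integral_le[OF n.finite_measure_pos_variation n.sets_pos_variation measurable_borel_sets[OF n.sets_pos_variation that(1)] that(2)]
    unfolding signed_integral_def distrib_right by (simp add: mult.commute)
  then show ?thesis by (intro exI[of _ ?C]) auto
qed

end

section \<open>The Riesz representation of functionals on test functions\<close>

locale test_functional =
  fixes \<Omega> :: "(real^2) set" and T :: "(real^2 \<Rightarrow> real) \<Rightarrow> real" and C :: real
  assumes open_domain: "open \<Omega>"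
    and add: "f \<in> test_functions \<Omega> \<Longrightarrow> g \<in> test_functions \<Omega> \<Longrightarrow> T (\<lambda>x. f x + g x) = T f + T g"
    and cmult: "f \<in> test_functions \<Omega> \<Longrightarrow> T (\<lambda>x. c * f x) = c * T f"
    and bound: "f \<in> test_functions \<Omega> \<Longrightarrow> (\<And>x. \<bar>f x\<bar> \<le> M) \<Longrightarrow> \<bar>T f\<bar> \<le> C * M"
begin

lemma zero: "T (\<lambda>x. 0) = 0"
  using cmult[OF test_functions_0, of 0] by simp

lemma C_nonneg: "0 \<le> C"
  using bound[OF test_functions_0, of 1] by (simp add: zero)

lemma diff: "f \<in> test_functions \<Omega> \<Longrightarrow> g \<in> test_functions \<Omega> \<Longrightarrow> T (\<lambda>x. f x - g x) = T f - T g"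
  using add[of f "\<lambda>x. (-1) * g x"] cmult[of g "-1"] test_functions_cmult[of g \<Omega> "-1"] by simp

lemma sum:
  "finite I \<Longrightarrow> (\<And>i. i \<in> I \<Longrightarrow> f i \<in> test_functions \<Omega>) \<Longrightarrow> T (\<lambda>x. \<Sum>i\<in>I. f i x) = (\<Sum>i\<in>I. T (f i))"
proof (induction I rule: finite_induct)
  case empty
  then show ?case by (simp add: zero)
next
  case (insert i I)
  then show ?case by (simp add: add test_functions_sum)
qed

lemma uminus: "test_functional \<Omega> (\<lambda>f. - T f) C"
  by standard (simp_all add: open_domain add cmult bound)

section \<open>The Riesz outer measure of a functional without a sign condition\<close>

definition adm :: "(real^2) set \<Rightarrow> (real^2 \<Rightarrow> real) set" where
  "adm U = {f \<in> test_functions U. \<forall>x. 0 \<le> f x \<and> f x \<le> 1}"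

text \<open>On open sets this is the mass of the positive part of \<open>T\<close>; for a positive
  functional it is the usual Riesz set function with smooth competitors. The truncation by
  \<open>ennreal\<close> is harmless, since the zero function competes.\<close>

definition lam :: "(real^2) set \<Rightarrow> ennreal" where
  "lam U = (SUP f\<in>adm U. ennreal (T f))"

lemma admD: "f \<in> adm U \<Longrightarrow> f \<in> test_functions U" "f \<in> adm U \<Longrightarrow> 0 \<le> f x" "f \<in> adm U \<Longrightarrow> f x \<le> 1"
  by (auto simp: adm_def)

lemma adm_0: "(\<lambda>x. 0) \<in> adm U"
  by (simp add: adm_def test_functions_0)

lemma le_lam: "f \<in> adm U \<Longrightarrow> ennreal (T f) \<le> lam U"
  unfolding lam_def by (rule SUP_upper)

lemma lam_leI: "(\<And>f. f \<in> adm U \<Longrightarrow> ennreal (T f) \<le> c) \<Longrightarrow> lam U \<le> c"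
  unfolding lam_def by (rule SUP_least)

lemma lam_mono: "U \<subseteq> V \<Longrightarrow> lam U \<le> lam V"
  by (intro lam_leI le_lam) (auto simp: adm_def intro: test_functions_mono)

lemma lam_le: "U \<subseteq> \<Omega> \<Longrightarrow> lam U \<le> ennreal C"
proof (intro lam_leI ennreal_leI)
  fix f assume U: "U \<subseteq> \<Omega>" and f: "f \<in> adm U"
  have "\<bar>T f\<bar> \<le> C * 1"
    using admD[OF f] by (intro bound test_functions_mono[OF _ U]) (auto simp: abs_le_iff intro: order_trans[of _ 0])
  then show "T f \<le> C" by simp
qed

lemma lam_empty: "lam {} = 0"
proof -
  have "lam {} \<le> 0"
  proof (rule lam_leI)
    fix f assume "f \<in> adm {}"
    then have "f = (\<lambda>x. 0)" using test_functions_eq_0[of f "{}"] admD(1) by auto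
    then show "ennreal (T f) \<le> 0" by (simp add: zero)
  qed
  then show ?thesis by simp
qed

text \<open>A competitor for the union has compact support, which finitely many \<open>U n\<close>
  cover. A subordinate partition of unity cuts it into competitors for the single sets.\<close>

lemma lam_UN:
  fixes U :: "nat \<Rightarrow> (real^2) set"
  assumes op: "\<And>n. open (U n)" and sub: "\<And>n. U n \<subseteq> \<Omega>"
  shows "lam (\<Union>n. U n) \<le> (\<Sum>n. lam (U n))"
proof (rule lam_leI)
  fix f assume f: "f \<in> adm (\<Union>n. U n)"
  note fT = admD(1)[OF f]
  have cK: "compact (supp f)" by (rule test_functions_compact_supp[OF fT])
  obtain I where I: "finite I" "supp f \<subseteq> (\<Union>i\<in>I. U i)"
    using compactE_image[OF cK, of UNIV U] op test_functions_supp[OF fT] by metis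
  obtain \<eta> where \<eta>: "\<And>i. i \<in> I \<Longrightarrow> \<eta> i \<in> test_functions (U i)" "\<And>i x. 0 \<le> \<eta> i x"
    "\<And>x. (\<Sum>i\<in>I. \<eta> i x) \<le> 1" "\<And>x. x \<in> supp f \<Longrightarrow> (\<Sum>i\<in>I. \<eta> i x) = 1"
    using partition_of_unity[OF cK I(1) op I(2)] by metis
  have fO: "f \<in> test_functions \<Omega>" using sub by (intro test_functions_mono[OF fT]) auto
  have eq: "f = (\<lambda>x. \<Sum>i\<in>I. \<eta> i x * f x)"
  proof
    fix x
    show "f x = (\<Sum>i\<in>I. \<eta> i x * f x)"
      unfolding sum_distrib_right[symmetric]
      using \<eta>(4)[of x] notin_supp[of x f] by (cases "x \<in> supp f") simp_all
  qed
  have fi: "(\<lambda>x. \<eta> i x * f x) \<in> adm (U i)" if i: "i \<in> I" for i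
  proof -
    have "(\<lambda>x. \<eta> i x * f x) \<in> test_functions (U i)"
      using test_functions_mono[OF test_functions_mult_local[OF fT \<eta>(1)[OF i]], of "U i"] by simp
    moreover have "\<eta> i x \<le> 1" for x
      using member_le_sum[of i I "\<lambda>i. \<eta> i x"] i I(1) \<eta>(2) \<eta>(3)[of x] by (meson order_trans)
    ultimately show ?thesis
      using \<eta>(2) admD(2,3)[OF f] by (auto simp: adm_def intro: mult_le_one)
  qed
  have "T f = (\<Sum>i\<in>I. T (\<lambda>x. \<eta> i x * f x))"
    using fi sub by (subst eq, intro sum[OF I(1)]) (auto intro: test_functions_mono dest!: admD(1))
  also have "ennreal \<dots> \<le> (\<Sum>i\<in>I. ennreal (T (\<lambda>x. \<eta> i x * f x)))" by (rule ennreal_sum_le)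
  also have "\<dots> \<le> (\<Sum>i\<in>I. lam (U i))" by (intro sum_mono le_lam fi)
  also have "\<dots> \<le> (\<Sum>i. lam (U i))" by (rule sum_le_suminf) (auto simp: I)
  finally show "ennreal (T f) \<le> (\<Sum>n. lam (U n))" .
qed

text \<open>Only open sets inside \<Omega> compete, where \<open>T\<close> is bounded, so the value
  is at most \<open>C\<close> on subsets of \<Omega>. For any other set the family is empty and the
  infimum is \<open>top\<close>.\<close>

definition out :: "(real^2) set \<Rightarrow> ennreal" where
  "out A = (INF U\<in>{U. open U \<and> A \<subseteq> U \<and> U \<subseteq> \<Omega>}. lam U)"

lemma out_le: "open U \<Longrightarrow> A \<subseteq> U \<Longrightarrow> U \<subseteq> \<Omega> \<Longrightarrow> out A \<le> lam U"
  unfolding out_def by (rule INF_lower) auto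

lemma le_out: "(\<And>U. open U \<Longrightarrow> A \<subseteq> U \<Longrightarrow> U \<subseteq> \<Omega> \<Longrightarrow> c \<le> lam U) \<Longrightarrow> c \<le> out A"
  unfolding out_def by (rule INF_greatest) auto

lemma out_open: "open U \<Longrightarrow> U \<subseteq> \<Omega> \<Longrightarrow> out U = lam U"
  by (intro antisym out_le le_out lam_mono) auto

lemma out_mono: "A \<subseteq> B \<Longrightarrow> out A \<le> out B"
  by (rule le_out) (auto intro: out_le)

lemma out_fin: "A \<subseteq> \<Omega> \<Longrightarrow> out A \<le> ennreal C"
  using out_le[OF open_domain] lam_le[of \<Omega>] by (meson order_refl order_trans)

lemma out_UN:
  fixes A :: "nat \<Rightarrow> (real^2) set"
  assumes A: "\<And>n. A n \<subseteq> \<Omega>"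
  shows "out (\<Union>n. A n) \<le> (\<Sum>n. out (A n))"
proof (rule ennreal_le_epsilon)
  fix e :: real assume e: "0 < e"
  have "\<exists>U. open U \<and> A n \<subseteq> U \<and> U \<subseteq> \<Omega> \<and> lam U \<le> out (A n) + ennreal (e * (1/2) ^ Suc n)" for n
  proof (rule ccontr)
    assume H: "\<nexists>U. open U \<and> A n \<subseteq> U \<and> U \<subseteq> \<Omega> \<and> lam U \<le> out (A n) + ennreal (e * (1/2) ^ Suc n)"
    have "out (A n) + ennreal (e * (1/2) ^ Suc n) \<le> out (A n)"
    proof (rule le_out)
      fix U assume "open U" "A n \<subseteq> U" "U \<subseteq> \<Omega>"
      then have "\<not> lam U \<le> out (A n) + ennreal (e * (1/2) ^ Suc n)" using H by blast
      then show "out (A n) + ennreal (e * (1/2) ^ Suc n) \<le> lam U" by (simp add: less_imp_le not_le)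
    qed
    then have "out (A n) + ennreal (e * (1/2) ^ Suc n) \<le> out (A n) + 0" by simp
    moreover have "out (A n) \<noteq> top" using out_fin[OF A[of n]] by (auto simp: top_unique)
    ultimately have "ennreal (e * (1/2) ^ Suc n) \<le> 0" by (simp only: ennreal_add_left_cancel_le) simp
    moreover have "0 < e * (1/2) ^ Suc n" using e by simp
    ultimately show False by (simp add: ennreal_eq_0_iff)
  qed
  then obtain U where U: "\<And>n. open (U n)" "\<And>n. A n \<subseteq> U n" "\<And>n. U n \<subseteq> \<Omega>"
    "\<And>n. lam (U n) \<le> out (A n) + ennreal (e * (1/2) ^ Suc n)" by metis
  have "out (\<Union>n. A n) \<le> lam (\<Union>n. U n)"
    by (intro out_le open_UN ballI U(1) UN_mono UN_least U(2,3) subset_refl)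
  also have "\<dots> \<le> (\<Sum>n. lam (U n))" by (rule lam_UN[OF U(1,3)])
  also have "\<dots> \<le> (\<Sum>n. out (A n) + ennreal (e * (1/2) ^ Suc n))"
    using U(4) by (intro suminf_le) auto
  also have "\<dots> = (\<Sum>n. out (A n)) + (\<Sum>n. ennreal (e * (1/2) ^ Suc n))"
    by (rule suminf_add[symmetric]) auto
  also have "(\<Sum>n. ennreal (e * (1/2) ^ Suc n)) = ennreal e"
  proof -
    have "(\<lambda>n. e * (1/2) ^ Suc n) sums (e * 1)"
      by (rule sums_mult[OF power_half_series])
    then show ?thesis using e by (subst suminf_ennreal_eq) auto
  qed
  finally show "out (\<Union>n. A n) \<le> (\<Sum>n. out (A n)) + ennreal e" .
qed

lemma outer_measure_space_out: "outer_measure_space (Pow \<Omega>) out"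
  unfolding outer_measure_space_def positive_def increasing_def countably_subadditive_def
proof (intro conjI allI impI ballI)
  show "out {} = 0" using out_open[of "{}"] lam_empty by simp
  show "out x \<le> out y" if "x \<subseteq> y" for x y by (rule out_mono[OF that])
  show "out (\<Union>i. A i) \<le> (\<Sum>i. out (A i))" if "range A \<subseteq> Pow \<Omega>" for A :: "nat \<Rightarrow> (real^2) set"
    using that by (intro out_UN) auto
qed

text \<open>This gives the Caratheodory inequality for an open \<open>U\<close>. If \<open>f\<close>
  competes for \<open>V \<inter> U\<close>, then removing its support from \<open>V\<close> leaves
  an open set that still contains \<open>A - U\<close>. A competitor \<open>g\<close> for that set
  has support disjoint from that of \<open>f\<close>, so \<open>f + g\<close> competes for
  \<open>V\<close>.\<close>

lemma lam_split:
  assumes V: "open V" "V \<subseteq> \<Omega>" "A \<subseteq> V" and U: "open U" "U \<subseteq> \<Omega>"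
  shows "out (A \<inter> U) + out (A - U) \<le> lam V"
proof -
  have *: "ennreal (T f) + out (A - U) \<le> lam V" if f: "f \<in> adm (V \<inter> U)" for f
  proof -
    note fT = admD(1)[OF f]
    let ?K = "supp f"
    have K: "?K \<subseteq> V" "?K \<subseteq> U" using test_functions_supp[OF fT] by blast+
    have op: "open (V - ?K)" using V by (intro open_Diff) auto
    have "out (A - U) \<le> lam (V - ?K)"
      using V K op by (intro out_le) (auto simp only: subset_iff Diff_iff)
    moreover have "ennreal (T f) + lam (V - ?K) \<le> lam V"
    proof -
      have ff: "ennreal (T f) + ennreal (T g) \<le> lam V" if g: "g \<in> adm (V - ?K)" for g
      proof -
        note gT = admD(1)[OF g]
        have fV: "f \<in> test_functions V" by (rule test_functions_mono[OF fT]) simp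
        have gV: "g \<in> test_functions V" by (rule test_functions_mono[OF gT]) blast
        have "f x + g x \<le> 1 \<and> 0 \<le> f x + g x" for x
          using test_functions_eq_0[OF gT, of x] notin_supp[of x f] admD(2,3)[OF f, of x] admD(2,3)[OF g, of x]
          by (cases "x \<in> ?K") simp_all
        then have fg: "(\<lambda>x. f x + g x) \<in> adm V" using test_functions_add[OF fV gV] by (simp add: adm_def)
        have "T (\<lambda>x. f x + g x) = T f + T g"
          by (intro add test_functions_mono[OF fV V(2)] test_functions_mono[OF gV V(2)])
        \<comment> \<open>Needed when \<open>T f\<close> or \<open>T g\<close> is negative: its
          \<open>ennreal\<close> value is then 0, and the other function alone competes for
          \<open>V\<close>.\<close>
        moreover have "f \<in> adm V" "g \<in> adm V" using fV gV f g by (simp_all add: adm_def)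
        ultimately show ?thesis
          using le_lam[OF fg] le_lam[of f V] le_lam[of g V]
          by (cases "0 \<le> T f"; cases "0 \<le> T g") (auto simp: ennreal_neg)
      qed
      have "adm (V - ?K) \<noteq> {}" using adm_0 by blast
      then show ?thesis unfolding lam_def[of "V - ?K"]
        by (subst ennreal_SUP_add_right) (auto intro!: SUP_least ff)
    qed
    ultimately show ?thesis by (meson add_left_mono order_trans)
  qed
  have "out (A \<inter> U) \<le> lam (V \<inter> U)"
    using V U by (intro out_le) auto
  moreover have "lam (V \<inter> U) + out (A - U) \<le> lam V"
  proof -
    have "adm (V \<inter> U) \<noteq> {}" using adm_0 by blast
    then show ?thesis unfolding lam_def[of "V \<inter> U"]
      by (subst ennreal_SUP_add_left[symmetric]) (auto intro!: SUP_least *)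
  qed
  ultimately show ?thesis by (meson add_right_mono order_trans)
qed

text \<open>By \<open>lam_split\<close> the open subsets of \<Omega> satisfy Caratheodory's
  condition. The sets that satisfy it form a \<sigma>-algebra, which therefore contains the traces
  of all Borel sets.\<close>

lemma borel_subset_lambda_system: "borel_sets \<Omega> \<subseteq> lambda_system \<Omega> (Pow \<Omega>) out"
proof -
  interpret P: sigma_algebra \<Omega> "Pow \<Omega>" by (rule sigma_algebra_Pow)
  have ms: "measure_space \<Omega> (lambda_system \<Omega> (Pow \<Omega>) out) out"
    by (rule P.caratheodory_lemma[OF outer_measure_space_out])
  interpret L: sigma_algebra \<Omega> "lambda_system \<Omega> (Pow \<Omega>) out"
    using ms by (simp add: measure_space_def)
  have sub2: "out (A \<union> B) \<le> out A + out B" if "A \<subseteq> \<Omega>" "B \<subseteq> \<Omega>" for A B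
  proof -
    have "out (\<Union>n. binaryset A B n) \<le> (\<Sum>n. out (binaryset A B n))"
      using that by (intro out_UN) (auto simp: binaryset_def)
    moreover have "(\<Sum>n. out (binaryset A B n)) = out A + out B"
      using suminf_binaryset_eq[of out A B] outer_measure_space_out
      by (simp add: outer_measure_space_def positive_def)
    ultimately show ?thesis by (simp add: UN_binaryset_eq)
  qed
  have op: "U \<in> lambda_system \<Omega> (Pow \<Omega>) out" if U: "open U" "U \<subseteq> \<Omega>" for U
    unfolding P.lambda_system_eq
  proof (intro CollectI conjI ballI)
    fix A assume A: "A \<in> Pow \<Omega>"
    show "out (A \<inter> U) + out (A - U) = out A"
    proof (rule antisym)
      show "out (A \<inter> U) + out (A - U) \<le> out A"
        by (intro le_out lam_split U)
      have "A = (A \<inter> U) \<union> (A - U)" by blast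
      then show "out A \<le> out (A \<inter> U) + out (A - U)"
        using sub2[of "A \<inter> U" "A - U"] A by auto
    qed
  qed (use U in auto)
  have "B \<inter> \<Omega> \<in> lambda_system \<Omega> (Pow \<Omega>) out" if "B \<in> sets borel" for B
  proof -
    from that have "B \<in> sigma_sets UNIV {S. open S}" by (simp add: borel_def)
    then show ?thesis
    proof induction
      case (Basic a)
      then show ?case using open_domain by (intro op) auto
    next
      case (Compl a)
      have "(UNIV - a) \<inter> \<Omega> = \<Omega> - a \<inter> \<Omega>" by blast
      then show ?case using L.compl_sets[OF Compl.IH] by simp
    next
      case (Union a)
      have "(\<Union>i. a i) \<inter> \<Omega> = (\<Union>i. a i \<inter> \<Omega>)" by blast
      then show ?case using L.countable_UN[of "\<lambda>i. a i \<inter> \<Omega>" UNIV] Union.IH by auto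
    qed auto
  qed
  then show ?thesis
    by (auto simp: borel_sets_def sets_restrict_space Int_commute)
qed

definition mu :: "(real^2) measure" where
  "mu = measure_of \<Omega> (borel_sets \<Omega>) out"

lemma sets_mu: "sets mu = borel_sets \<Omega>"
  unfolding mu_def by (rule sigma_algebra.sets_measure_of_eq[OF sigma_algebra_borel_sets])

lemma emeasure_mu: "A \<in> borel_sets \<Omega> \<Longrightarrow> emeasure mu A = out A"
  unfolding mu_def
proof (rule emeasure_measure_of_sigma)
  have ms: "measure_space \<Omega> (lambda_system \<Omega> (Pow \<Omega>) out) out"
    by (rule sigma_algebra.caratheodory_lemma[OF sigma_algebra_Pow outer_measure_space_out])
  then show "positive (borel_sets \<Omega>) out" "countably_additive (borel_sets \<Omega>) out"
    using borel_subset_lambda_system unfolding measure_space_def positive_def countably_additive_def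
    by (meson subset_trans subsetD)+
qed (rule sigma_algebra_borel_sets)

lemma open_borel_sets: "open U \<Longrightarrow> U \<subseteq> \<Omega> \<Longrightarrow> U \<in> borel_sets \<Omega>"
  by (auto simp: borel_sets_def sets_restrict_space image_iff intro!: bexI[of _ U])

lemma finite_measure_mu: "finite_measure mu"
proof
  have "emeasure mu \<Omega> \<le> ennreal C"
    using out_fin[of \<Omega>] emeasure_mu[OF open_borel_sets[OF open_domain]] by simp
  then show "emeasure mu (space mu) \<noteq> \<infinity>"
    using space_borel_sets[OF sets_mu] by (auto simp: top_unique)
qed

lemma measure_mu_open: "open U \<Longrightarrow> U \<subseteq> \<Omega> \<Longrightarrow> ennreal (measure mu U) = lam U"
  using finite_measure.emeasure_eq_measure[OF finite_measure_mu, of U] emeasure_mu[OF open_borel_sets, of U] out_open[of U]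
  by simp

lemma le_measure_mu:
  assumes "open U" "U \<subseteq> \<Omega>" "f \<in> adm U"
  shows "T f \<le> measure mu U"
  using le_lam[OF assms(3)] measure_mu_open[OF assms(1,2)] by (metis ennreal_le_iff measure_nonneg)

lemma measure_mu_le:
  assumes "open U" "U \<subseteq> \<Omega>" "\<And>f. f \<in> adm U \<Longrightarrow> T f \<le> c"
  shows "measure mu U \<le> c"
proof -
  have "0 \<le> c" using assms(3)[OF adm_0] by (simp add: zero)
  moreover have "lam U \<le> ennreal c" using assms(3) by (intro lam_leI ennreal_leI)
  ultimately show ?thesis using measure_mu_open[OF assms(1,2)] by (metis ennreal_le_iff)
qed

text \<open>Since \<open>h\<close> is 1 on \<open>V\<close>, subtracting a competitor
  \<open>g\<close> for \<open>V\<close> leaves a competitor \<open>h - g\<close> for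
  \<open>U\<close>, so \<open>T h - T g\<close> is at most the mass of \<open>U\<close>. The
  supremum of \<open>- T g\<close> over all such \<open>g\<close> is the mass of \<open>V\<close>
  for the negative part.\<close>

lemma cutoff_le:
  assumes h: "h \<in> adm U" and U: "open U" "U \<subseteq> \<Omega>"
    and V: "open V" "\<And>x. x \<in> V \<Longrightarrow> h x = 1"
  shows "T h \<le> measure mu U - measure (test_functional.mu \<Omega> (\<lambda>f. - T f)) V"
proof -
  interpret n: test_functional \<Omega> "\<lambda>f. - T f" C by (rule uminus)
  note hU = admD(1)[OF h]
  have VU: "V \<subseteq> U"
    using V(2) test_functions_eq_0[OF hU] by (metis subsetI zero_neq_one)
  have "measure n.mu V \<le> measure mu U - T h"
  proof (rule n.measure_mu_le)
    fix g assume g: "g \<in> n.adm V"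
    note gU = test_functions_mono[OF n.admD(1)[OF g] VU]
    have "(\<lambda>x. h x - g x) \<in> adm U"
      unfolding adm_def
    proof (intro CollectI conjI allI)
      show "(\<lambda>x. h x - g x) \<in> test_functions U" by (rule test_functions_diff[OF hU gU])
      fix x
      show "0 \<le> h x - g x" "h x - g x \<le> 1"
        using V(2)[of x] test_functions_eq_0[OF n.admD(1)[OF g], of x] admD(2,3)[OF h, of x] n.admD(2,3)[OF g, of x]
        by (cases "x \<in> V"; simp)+
    qed
    from le_measure_mu[OF U this] show "- T g \<le> measure mu U - T h"
      using diff[OF test_functions_mono[OF hU U(2)] test_functions_mono[OF gU U(2)]] by simp
  qed (use V VU U in auto)
  then show ?thesis by simp
qed

end

section \<open>Layer-cake approximation: the functional is the difference of the two
  measures\<close>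

lemma sum_atLeast1_Suc_shift:
  fixes g :: "nat \<Rightarrow> real"
  shows "(\<Sum>j=1..Suc N. g j) = g 1 + (\<Sum>j=1..N. g (Suc j))"
  by (induction N) simp_all

text \<open>Telescoping \<open>min y (real j * e)\<close> writes \<open>y\<close> as a sum of
  increments. The increment number \<open>j\<close> is at least \<open>e\<close> when
  \<open>real (Suc j) * e < y\<close>, and it is at most \<open>e\<close> and vanishes unless
  \<open>real j * e < y\<close>. The shift between the two indices costs the additional
  \<open>e\<close>.\<close>

lemma sum_clamp:
  fixes y e :: real
  assumes "0 \<le> y" "y \<le> real N * e" "0 \<le> e"
  shows "(\<Sum>j=1..N. e * of_bool (real j * e < y)) \<le> y"
    and "y \<le> e + (\<Sum>j=1..N. e * of_bool (real j * e < y))"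
proof -
  let ?c = "\<lambda>j. min y (real (Suc j) * e) - min y (real j * e)"
  have y: "y = (\<Sum>j<N. ?c j)"
    using assms by (subst sum_lessThan_telescope) simp
  have sh: "(\<Sum>j=1..N. e * of_bool (real j * e < y)) = (\<Sum>j<N. e * of_bool (real (Suc j) * e < y))"
    by (rule sum.reindex_bij_witness[of _ Suc "\<lambda>j. j - 1"]) auto
  have "e * of_bool (real (Suc j) * e < y) \<le> ?c j" for j
    using assms(1,3) by (auto simp: min_def distrib_right)
  then show "(\<Sum>j=1..N. e * of_bool (real j * e < y)) \<le> y"
    unfolding sh by (subst (2) y) (rule sum_mono)
  have up: "?c j \<le> e * of_bool (real j * e < y)" for j
    using assms(1,3) by (auto simp: min_def distrib_right)
  have "y \<le> (\<Sum>j<N. e * of_bool (real j * e < y))"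
    by (subst y) (rule sum_mono[OF up])
  also have "\<dots> \<le> (\<Sum>j<Suc N. e * of_bool (real j * e < y))"
    using assms(3) by simp
  also have "\<dots> = e * of_bool (0 < y) + (\<Sum>j<N. e * of_bool (real (Suc j) * e < y))"
    by (subst sum.lessThan_Suc_shift) simp
  also have "\<dots> \<le> e + (\<Sum>j=1..N. e * of_bool (real j * e < y))"
    unfolding sh using assms(3) by simp
  finally show "y \<le> e + (\<Sum>j=1..N. e * of_bool (real j * e < y))" .
qed

context test_functional
begin

lemma integrable_mu:
  assumes f: "f \<in> test_functions \<Omega>"
  shows "integrable mu f"
proof -
  obtain M where "\<And>x. \<bar>f x\<bar> \<le> M" using test_functions_bounded[OF f] by blast
  then show ?thesis
    by (intro integrable_bounded[OF finite_measure_mu sets_mu measurable_borel_sets[OF sets_mu]]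
        test_functions_continuous[OF f])
qed

lemma integral_open_step:
  assumes "\<And>j. open (U j)" "\<And>j. U j \<subseteq> \<Omega>"
  shows "integrable mu (\<lambda>x. \<Sum>j=1..N. e * indicator (U j) x)"
    and "(\<integral>x. (\<Sum>j=1..N. e * indicator (U j) x) \<partial>mu) = (\<Sum>j=1..N. e * measure mu (U j))"
proof -
  interpret finite_measure mu by (rule finite_measure_mu)
  have U: "U j \<in> sets mu" for j using open_borel_sets[OF assms] by (simp add: sets_mu)
  show "integrable mu (\<lambda>x. \<Sum>j=1..N. e * indicator (U j) x)"
    using U by (intro Bochner_Integration.integrable_sum integrable_mult_right integrable_real_indicator)
      (auto simp: less_top[symmetric])
  show "(\<integral>x. (\<Sum>j=1..N. e * indicator (U j) x) \<partial>mu) = (\<Sum>j=1..N. e * measure mu (U j))"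
    using U by (subst Bochner_Integration.integral_sum) (auto simp: less_top[symmetric] sets.Int_space_eq2)
qed

text \<open>Smooth cutoffs \<open>h j\<close> between consecutive superlevel sets of
  \<open>f\<close> approximate \<open>f\<close> by \<open>e\<close> times their sum. By
  \<open>cutoff_le\<close> each \<open>T (h j)\<close> is at most the mass of the larger set minus
  the negative mass of the smaller one, and \<open>e\<close> times the sum of such masses is the
  integral of a step function close to \<open>f\<close>.\<close>

lemma le_integrals:
  assumes f: "f \<in> test_functions \<Omega>" and f0: "\<And>x. 0 \<le> f x"
  shows "T f \<le> (\<integral>x. f x \<partial>mu) - (\<integral>x. f x \<partial>test_functional.mu \<Omega> (\<lambda>f. - T f))"
proof -
  interpret n: test_functional \<Omega> "\<lambda>f. - T f" C by (rule uminus)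
  interpret fn: finite_measure n.mu by (rule n.finite_measure_mu)
  obtain M where M: "0 \<le> M" "\<And>x. \<bar>f x\<bar> \<le> M" using test_functions_bounded[OF f] by blast
  have cf: "continuous_on S f" for S by (rule test_functions_continuous[OF f])
  note int = integrable_mu[OF f] n.integrable_mu[OF f]
  \<comment> \<open>Error budget: \<open>2 * C\<close> stems from the distance \<open>2 * e\<close>
    between \<open>f\<close> and \<open>H\<close>. For the negative part one \<open>e\<close> is
    lost by rounding \<open>f\<close> to a step function and another by using
    \<open>U (Suc j)\<close> in place of \<open>U j\<close>.\<close>
  have main: "T f \<le> (\<integral>x. f x \<partial>mu) - (\<integral>x. f x \<partial>n.mu) + e * (2 * C + 2 * measure n.mu \<Omega>)" if e: "0 < e" for e
  proof -
    obtain N :: nat where "M / e \<le> real N" using real_arch_simple by blast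
    then have N: "M \<le> real N * e" using e by (simp add: field_simps)
    define U where "U j = {x. real j * e < f x}" for j
    have opU: "open (U j)" for j
      unfolding U_def by (rule open_Collect_less) (auto intro: continuous_on_const cf)
    have Usub: "U j \<subseteq> \<Omega>" for j
    proof
      fix x assume "x \<in> U j"
      then have "0 < f x" using e by (auto simp: U_def intro: le_less_trans[rotated])
      then show "x \<in> \<Omega>" using test_functions_eq_0[OF f, of x] by auto
    qed
    have "\<exists>h. h \<in> adm (U j) \<and> (\<forall>x\<in>U (Suc j). h x = 1)" if j: "j \<in> {1..N}" for j
    proof -
      \<comment> \<open>A cutoff is 1 on a compact set inside an open one. The closed superlevel set
        lies between \<open>U (Suc j)\<close> and \<open>U j\<close>, and it is compact because its
        level is positive.\<close>
      let ?K = "{x. real (Suc j) * e \<le> f x}"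
      have "closed ?K" by (rule closed_Collect_le) (auto intro: continuous_on_const cf)
      moreover have "?K \<subseteq> supp f"
      proof
        fix x assume "x \<in> ?K"
        moreover have "0 < real (Suc j) * e" using e by simp
        ultimately have "f x \<noteq> 0" by auto
        then show "x \<in> supp f" using notin_supp by blast
      qed
      ultimately have cK: "compact ?K"
        using compact_Int_closed[OF test_functions_compact_supp[OF f], of ?K] by (simp add: Int_absorb1)
      have "real j * e < real (Suc j) * e" using e by simp
      then have KU: "?K \<subseteq> U j" unfolding U_def by (auto simp only: mem_Collect_eq intro: less_le_trans)
      obtain h where h: "h \<in> test_functions (U j)" "\<And>x. 0 \<le> h x" "\<And>x. h x \<le> 1" "\<And>x. x \<in> ?K \<Longrightarrow> h x = 1"
        by (rule smooth_cutoff[OF cK opU KU]) blast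
      have "U (Suc j) \<subseteq> ?K" by (auto simp: U_def)
      with h show ?thesis by (auto simp only: adm_def mem_Collect_eq subset_iff intro!: exI[of _ h])
    qed
    then obtain h where h: "\<And>j. j \<in> {1..N} \<Longrightarrow> h j \<in> adm (U j)"
      "\<And>j x. j \<in> {1..N} \<Longrightarrow> x \<in> U (Suc j) \<Longrightarrow> h j x = 1" by metis
    have hO: "h j \<in> test_functions \<Omega>" if "j \<in> {1..N}" for j
      by (rule test_functions_mono[OF admD(1)[OF h(1)[OF that]] Usub])
    define H where "H x = (\<Sum>j=1..N. e * h j x)" for x
    define S where "S x = (\<Sum>j=1..N. e * of_bool (real j * e < f x))" for x
    have S: "S x \<le> f x" "f x \<le> e + S x" for x
      unfolding S_def using sum_clamp[of "f x" N e] f0[of x] M(2)[of x] N e by (simp_all add: abs_le_iff)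
    have Ssum: "S = (\<lambda>x. \<Sum>j=1..N. e * indicator (U j) x)"
      by (simp add: fun_eq_iff S_def U_def indicator_def of_bool_def)
    have HT: "H \<in> test_functions \<Omega>"
      unfolding H_def[abs_def] by (intro test_functions_sum test_functions_cmult hO)
    have TH: "T H = (\<Sum>j=1..N. e * T (h j))"
      unfolding H_def[abs_def] using hO by (subst sum) (auto simp: cmult test_functions_cmult)
    have "\<bar>f x - H x\<bar> \<le> 2 * e" for x
    proof -
      have "h j x \<le> of_bool (real j * e < f x)" if j: "j \<in> {1..N}" for j
        using admD(3)[OF h(1)[OF j], of x] test_functions_eq_0[OF admD(1)[OF h(1)[OF j]], of x]
        by (cases "x \<in> U j") (auto simp: U_def)
      then have "H x \<le> S x" unfolding H_def S_def using e by (intro sum_mono mult_left_mono) auto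
      moreover have "S x \<le> H x + e"
      proof -
        have "S x \<le> (\<Sum>j=1..Suc N. e * of_bool (real j * e < f x))" unfolding S_def using e by simp
        also have "\<dots> = e * of_bool (e < f x) + (\<Sum>j=1..N. e * of_bool (real (Suc j) * e < f x))"
          by (subst sum_atLeast1_Suc_shift) simp
        also have "\<dots> \<le> e + (\<Sum>j=1..N. e * h j x)"
        proof (intro add_mono sum_mono mult_left_mono)
          show "of_bool (real (Suc j) * e < f x) \<le> h j x" if j: "j \<in> {1..N}" for j
            using h(2)[OF j, of x] admD(2)[OF h(1)[OF j], of x] by (auto simp: U_def)
        qed (use e in auto)
        finally show ?thesis by (simp add: H_def)
      qed
      ultimately show ?thesis using S[of x] by linarith
    qed
    then have "\<bar>T (\<lambda>x. f x - H x)\<bar> \<le> C * (2 * e)" by (intro bound test_functions_diff f HT)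
    then have "T f \<le> T H + C * (2 * e)" using diff[OF f HT] by linarith
    also have "T H \<le> (\<Sum>j=1..N. e * (measure mu (U j) - measure n.mu (U (Suc j))))"
      unfolding TH using e h by (intro sum_mono mult_left_mono cutoff_le opU Usub) auto
    also have "\<dots> = (\<Sum>j=1..N. e * measure mu (U j)) - (\<Sum>j=1..N. e * measure n.mu (U (Suc j)))"
      by (simp add: right_diff_distrib sum_subtractf)
    also have "(\<Sum>j=1..N. e * measure mu (U j)) = (\<integral>x. S x \<partial>mu)"
      unfolding Ssum by (rule integral_open_step(2)[OF opU Usub, symmetric])
    also have "(\<integral>x. S x \<partial>mu) \<le> (\<integral>x. f x \<partial>mu)"
    proof (rule integral_mono)
      show "integrable mu S" unfolding Ssum by (rule integral_open_step(1)[OF opU Usub])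
    qed (auto simp: int S)
    finally have upper: "T f \<le> (\<integral>x. f x \<partial>mu) - (\<Sum>j=1..N. e * measure n.mu (U (Suc j))) + C * (2 * e)"
      by simp
    have "(\<integral>x. f x \<partial>n.mu) - 2 * e * measure n.mu \<Omega> \<le> (\<Sum>j=1..N. e * measure n.mu (U (Suc j)))"
    proof -
      have iS: "integrable n.mu S" unfolding Ssum by (rule n.integral_open_step(1)[OF opU Usub])
      have "(\<integral>x. f x \<partial>n.mu) \<le> (\<integral>x. e + S x \<partial>n.mu)"
        by (rule integral_mono) (auto simp: int S iS)
      also have "\<dots> = e * measure n.mu \<Omega> + (\<integral>x. S x \<partial>n.mu)"
        using iS by (simp add: space_borel_sets[OF n.sets_mu] mult.commute)
      also have "(\<integral>x. S x \<partial>n.mu) = (\<Sum>j=1..N. e * measure n.mu (U j))"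
        unfolding Ssum by (rule n.integral_open_step(2)[OF opU Usub])
      also have "\<dots> \<le> (\<Sum>j=1..Suc N. e * measure n.mu (U j))" using e by simp
      also have "\<dots> = e * measure n.mu (U 1) + (\<Sum>j=1..N. e * measure n.mu (U (Suc j)))"
        by (rule sum_atLeast1_Suc_shift)
      also have "measure n.mu (U 1) \<le> measure n.mu \<Omega>"
        using fn.bounded_measure[of "U 1"] by (simp add: space_borel_sets[OF n.sets_mu])
      finally show ?thesis using e by (simp add: mult_left_mono)
    qed
    with upper show ?thesis by (simp add: distrib_left algebra_simps)
  qed
  then have "T f - ((\<integral>x. f x \<partial>mu) - (\<integral>x. f x \<partial>n.mu)) \<le> 0"
    using C_nonneg by (intro le_0_if_le_mult[where C="2 * C + 2 * measure n.mu \<Omega>"]) (auto simp: diff_le_eq add.commute)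
  then show ?thesis by simp
qed

text \<open>For nonnegative \<open>f\<close> apply \<open>le_integrals\<close> to \<open>T\<close>
  and to \<open>- T\<close>. In general \<open>f\<close> is first made nonnegative by adding
  \<open>M\<close> times a cutoff that is 1 on the support of \<open>f\<close>, as constants are not
  test functions.\<close>

lemma eq_integrals:
  assumes f: "f \<in> test_functions \<Omega>"
  shows "T f = (\<integral>x. f x \<partial>mu) - (\<integral>x. f x \<partial>test_functional.mu \<Omega> (\<lambda>f. - T f))"
proof -
  interpret n: test_functional \<Omega> "\<lambda>f. - T f" C by (rule uminus)
  define I where "I f = (\<integral>x. f x \<partial>mu) - (\<integral>x. f x \<partial>n.mu)" for f :: "real^2 \<Rightarrow> real"
  have pos: "T f = I f" if f: "f \<in> test_functions \<Omega>" and f0: "\<And>x. 0 \<le> f x" for f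
    using le_integrals[OF f f0] n.le_integrals[OF f f0] by (simp add: I_def)
  obtain M where M: "0 \<le> M" "\<And>x. \<bar>f x\<bar> \<le> M" using test_functions_bounded[OF f] by blast
  obtain g where g: "g \<in> test_functions \<Omega>" "\<And>x. 0 \<le> g x" "\<And>x. g x \<le> 1" "\<And>x. x \<in> supp f \<Longrightarrow> g x = 1"
    using smooth_cutoff[OF test_functions_compact_supp[OF f] open_domain test_functions_supp[OF f]] by metis
  have Mg: "(\<lambda>x. M * g x) \<in> test_functions \<Omega>" by (rule test_functions_cmult[OF g(1)])
  have fMg: "(\<lambda>x. f x + M * g x) \<in> test_functions \<Omega>" by (rule test_functions_add[OF f Mg])
  have "0 \<le> f x + M * g x" for x
    using M(1) M(2)[of x] g(4)[of x] g(2)[of x] notin_supp[of x f]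
    by (cases "x \<in> supp f") (auto simp: abs_le_iff)
  then have 1: "T (\<lambda>x. f x + M * g x) = I (\<lambda>x. f x + M * g x)" by (rule pos[OF fMg])
  have 2: "T (\<lambda>x. M * g x) = I (\<lambda>x. M * g x)" using M(1) g(2) by (intro pos Mg) simp
  have "I (\<lambda>x. f x + M * g x) = I f + I (\<lambda>x. M * g x)"
    using integrable_mu[OF f] integrable_mu[OF Mg] n.integrable_mu[OF f] n.integrable_mu[OF Mg] by (simp add: I_def)
  then have "T f = I f" using 1 2 add[OF f Mg] by simp
  then show ?thesis by (simp add: I_def)
qed

theorem riesz:
  "\<exists>m. real_measure \<Omega> m \<and> (\<forall>A. A \<notin> borel_sets \<Omega> \<longrightarrow> m A = 0) \<and>
     (\<forall>f\<in>test_functions \<Omega>. T f = signed_integral \<Omega> m f)"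
proof -
  interpret n: test_functional \<Omega> "\<lambda>f. - T f" C by (rule uminus)
  interpret fm: finite_measure mu by (rule finite_measure_mu)
  interpret fn: finite_measure n.mu by (rule n.finite_measure_mu)
  \<comment> \<open>\<open>measure\<close> is 0 off the \<sigma>-algebra, which is exactly the
    default value that \<open>radon_measures\<close> prescribes.\<close>
  define m where "m A = measure mu A - measure n.mu A" for A
  have rm: "real_measure \<Omega> m"
  proof
    fix A :: "nat \<Rightarrow> (real^2) set"
    assume "\<And>n. A n \<in> borel_sets \<Omega>" "disjoint_family A"
    then show "(\<lambda>n. m (A n)) sums m (\<Union>n. A n)"
      unfolding m_def by (intro sums_diff fm.finite_measure_UNION fn.finite_measure_UNION)
        (auto simp: sets_mu n.sets_mu)
  qed
  have "m A = 0" if "A \<notin> borel_sets \<Omega>" for A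
    using that by (simp add: m_def measure_notin_sets sets_mu n.sets_mu)
  moreover have "T f = signed_integral \<Omega> m f" if f: "f \<in> test_functions \<Omega>" for f
  proof -
    obtain M where M: "\<And>x. \<bar>f x\<bar> \<le> M" using test_functions_bounded[OF f] by blast
    have "signed_integral \<Omega> m f = (\<integral>x. f x \<partial>mu) - (\<integral>x. f x \<partial>n.mu)"
      by (rule signed_integral_eq[OF rm finite_measure_mu sets_mu n.finite_measure_mu n.sets_mu])
        (use M in \<open>auto simp: m_def intro: measurable_borel_sets[OF sets_mu test_functions_continuous[OF f]]\<close>)
    then show ?thesis by (simp add: eq_integrals[OF f])
  qed
  ultimately show ?thesis using rm by blast
qed

end

section \<open>The dual norm through test functions\<close>

definition vtest :: "(real^2) set \<Rightarrow> (real^2 \<Rightarrow> real^'d) set" where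
  "vtest \<Omega> = {\<phi>. (\<forall>i. (\<lambda>x. \<phi> x $ i) \<in> test_functions \<Omega>) \<and> (\<forall>x. norm (\<phi> x) \<le> 1)}"

definition pairing :: "('d::finite) vdistr \<Rightarrow> (real^2 \<Rightarrow> real^'d) \<Rightarrow> real" where
  "pairing T \<phi> = (\<Sum>i\<in>UNIV. T (\<lambda>x. \<phi> x $ i) $ i)"

definition vnorm :: "(real^2) set \<Rightarrow> ('d::finite) vdistr \<Rightarrow> ereal" where
  "vnorm \<Omega> T = (SUP \<phi>\<in>vtest \<Omega>. ereal (pairing T \<phi>))"

definition linear_distr :: "(real^2) set \<Rightarrow> ('d::finite) vdistr \<Rightarrow> bool" where
  "linear_distr \<Omega> T \<longleftrightarrow>
     (\<forall>f\<in>test_functions \<Omega>. \<forall>g\<in>test_functions \<Omega>. T (\<lambda>x. f x + g x) = T f + T g) \<and>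
     (\<forall>f\<in>test_functions \<Omega>. \<forall>c. T (\<lambda>x. c * f x) = c *\<^sub>R T f)"

lemma linear_distr_add:
  "linear_distr \<Omega> T \<Longrightarrow> f \<in> test_functions \<Omega> \<Longrightarrow> g \<in> test_functions \<Omega> \<Longrightarrow> T (\<lambda>x. f x + g x) = T f + T g"
  and linear_distr_cmult:
  "linear_distr \<Omega> T \<Longrightarrow> f \<in> test_functions \<Omega> \<Longrightarrow> T (\<lambda>x. c * f x) = c *\<^sub>R T f"
  by (auto simp: linear_distr_def)

lemma linear_distr_zero: "linear_distr \<Omega> T \<Longrightarrow> T (\<lambda>x. 0) = 0"
  using linear_distr_cmult[OF _ test_functions_0, of \<Omega> T 0] by simp

lemma zero_vtest: "(\<lambda>x. 0) \<in> vtest \<Omega>"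
  by (simp add: vtest_def test_functions_0)

lemma pairing_le_vnorm: "\<phi> \<in> vtest \<Omega> \<Longrightarrow> ereal (pairing T \<phi>) \<le> vnorm \<Omega> T"
  unfolding vnorm_def by (rule SUP_upper)

lemma vnorm_leI: "(\<And>\<phi>. \<phi> \<in> vtest \<Omega> \<Longrightarrow> ereal (pairing T \<phi>) \<le> c) \<Longrightarrow> vnorm \<Omega> T \<le> c"
  unfolding vnorm_def by (rule SUP_least)

lemma vnorm_nonneg: "linear_distr \<Omega> T \<Longrightarrow> 0 \<le> vnorm \<Omega> T"
  using pairing_le_vnorm[OF zero_vtest, of T \<Omega>] by (simp add: pairing_def linear_distr_zero zero_ereal_def)

lemma vnorm_cong:
  assumes "\<And>f. f \<in> test_functions \<Omega> \<Longrightarrow> T f = S f"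
  shows "vnorm \<Omega> T = vnorm \<Omega> S"
  unfolding vnorm_def pairing_def using assms by (intro SUP_cong) (auto simp: vtest_def)

text \<open>The competing field is \<open>f / M\<close> along a coordinate axis, with either sign.
  The division by \<open>M\<close> is why \<open>M = 0\<close> is treated apart.\<close>

lemma abs_component_le_vnorm:
  fixes T :: "('d::finite) vdistr"
  assumes T: "linear_distr \<Omega> T" and c: "vnorm \<Omega> T \<le> ereal c"
    and f: "f \<in> test_functions \<Omega>" and M: "\<And>x. \<bar>f x\<bar> \<le> M"
  shows "\<bar>T f $ i\<bar> \<le> c * M"
proof (cases "M = 0")
  case True
  then have "f = (\<lambda>x. 0)" using M by auto
  then show ?thesis using True by (simp add: linear_distr_zero[OF T])
next
  case False
  then have "0 < M" using M[of 0] by linarith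
  have *: "s * (T f $ i) \<le> c * M" if s: "\<bar>s\<bar> = 1" for s
  proof -
    define \<phi> :: "real^2 \<Rightarrow> real^'d" where "\<phi> x = (s / M * f x) *\<^sub>R axis i 1" for x
    have comp: "(\<lambda>x. \<phi> x $ j) = (\<lambda>x. (if j = i then s / M else 0) * f x)" for j
      by (auto simp: \<phi>_def axis_def)
    have "\<phi> \<in> vtest \<Omega>"
      unfolding vtest_def
    proof (intro CollectI conjI allI)
      show "(\<lambda>x. \<phi> x $ j) \<in> test_functions \<Omega>" for j
        unfolding comp by (rule test_functions_cmult[OF f])
      show "norm (\<phi> x) \<le> 1" for x
        using M[of x] \<open>0 < M\<close> s by (simp add: \<phi>_def abs_mult)
    qed
    then have "ereal (pairing T \<phi>) \<le> ereal c" using pairing_le_vnorm c order_trans by blast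
    moreover have "pairing T \<phi> = (\<Sum>j\<in>UNIV. (if j = i then s / M * (T f $ j) else 0))"
      unfolding pairing_def comp by (intro sum.cong refl) (simp add: linear_distr_cmult[OF T f])
    ultimately have "s / M * (T f $ i) \<le> c" by simp
    then show ?thesis using \<open>0 < M\<close> by (simp add: field_simps)
  qed
  from *[of 1] *[of "-1"] show ?thesis by simp
qed

abbreviation sup_bounded :: "(real^2) set \<Rightarrow> ((real^2 \<Rightarrow> real) \<Rightarrow> real) \<Rightarrow> bool" where
  "sup_bounded U T \<equiv> \<exists>C. \<forall>f\<in>test_functions U. \<forall>M. (\<forall>x. \<bar>f x\<bar> \<le> M) \<longrightarrow> \<bar>T f\<bar> \<le> C * M"

lemma representable:
  fixes T :: "('d::finite) vdistr"
  assumes op: "open \<Omega>" and T: "linear_distr \<Omega> T"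
    and b: "\<And>i. sup_bounded \<Omega> (\<lambda>f. T f $ i)"
  shows "\<exists>\<mu>. represents \<Omega> \<mu> T"
proof -
  have "\<exists>m. real_measure \<Omega> m \<and> (\<forall>A. A \<notin> borel_sets \<Omega> \<longrightarrow> m A = 0) \<and>
     (\<forall>f\<in>test_functions \<Omega>. T f $ i = signed_integral \<Omega> m f)" for i
  proof -
    obtain C where C: "\<And>f M. f \<in> test_functions \<Omega> \<Longrightarrow> (\<forall>x. \<bar>f x\<bar> \<le> M) \<Longrightarrow> \<bar>T f $ i\<bar> \<le> C * M"
      using b by metis
    interpret test_functional \<Omega> "\<lambda>f. T f $ i" C
      by standard (simp_all add: op linear_distr_add[OF T] linear_distr_cmult[OF T] C)
    show ?thesis by (rule riesz)
  qed
  then obtain m where m: "\<And>i. real_measure \<Omega> (m i)" "\<And>i A. A \<notin> borel_sets \<Omega> \<Longrightarrow> m i A = 0"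
    "\<And>i f. f \<in> test_functions \<Omega> \<Longrightarrow> T f $ i = signed_integral \<Omega> (m i) f" by metis
  define \<mu> where "\<mu> A = (\<chi> i. m i A)" for A
  have "(\<lambda>n. \<mu> (A n)) sums \<mu> (\<Union>n. A n)" if "\<forall>n. A n \<in> borel_sets \<Omega>" "disjoint_family A" for A :: "nat \<Rightarrow> (real^2) set"
    unfolding sums_def
  proof (rule vec_tendstoI)
    show "(\<lambda>n. (\<Sum>i<n. \<mu> (A i)) $ j) \<longlonglongrightarrow> \<mu> (\<Union>n. A n) $ j" for j
      using real_measure.sums_UN[OF m(1), of A j] that by (simp add: \<mu>_def sums_def)
  qed
  then have "\<mu> \<in> radon_measures \<Omega>" using m(2) by (auto simp: radon_measures_def \<mu>_def vec_eq_iff)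
  moreover have "T f = distr_of_measure \<Omega> \<mu> f" if "f \<in> test_functions \<Omega>" for f
    using m(3)[OF that] by (simp add: vec_eq_iff distr_of_measure_def \<mu>_def)
  ultimately show ?thesis unfolding represents_def by blast
qed

text \<open>Shortening the vectors makes the field vanish off a compact set without leaving the unit
  ball; a Stone-Weierstrass polynomial times a cutoff makes it smooth; division by
  \<open>1 + d\<close> restores the norm bound. Each of the three changes costs at most
  \<open>d\<close>, hence \<open>e / 3\<close>.\<close>

lemma C0_approx:
  fixes \<phi> :: "real^2 \<Rightarrow> real^'d"
  assumes op: "open \<Omega>" and \<phi>: "\<phi> \<in> C0 \<Omega>" "\<And>x. x \<in> \<Omega> \<Longrightarrow> norm (\<phi> x) \<le> 1" and e: "0 < e"
  obtains \<psi> where "\<psi> \<in> vtest \<Omega>" "\<And>x. x \<in> \<Omega> \<Longrightarrow> norm (\<phi> x - \<psi> x) \<le> e"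
proof -
  define d where "d = e / 3"
  have d: "0 < d" using e by (simp add: d_def)
  \<comment> \<open>The length is reduced by \<open>d\<close>, or to 0 if it was below
    \<open>d\<close>. The maximum in the denominator keeps the factor continuous where the field
    vanishes.\<close>
  define \<phi>1 where "\<phi>1 x = (max 0 (norm (\<phi> x) - d) / max d (norm (\<phi> x))) *\<^sub>R \<phi> x" for x
  have cont: "continuous_on \<Omega> \<phi>" using \<phi>(1) by (simp add: C0_def)
  have c1: "continuous_on \<Omega> \<phi>1"
    unfolding \<phi>1_def using cont d by (intro continuous_intros) auto
  have near: "norm (\<phi> x - \<phi>1 x) \<le> d \<and> norm (\<phi>1 x) \<le> norm (\<phi> x)" for x
  proof (cases "norm (\<phi> x) \<le> d")
    case True
    then show ?thesis by (simp add: \<phi>1_def)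
  next
    case False
    then have p: "0 < norm (\<phi> x)" "max 0 (norm (\<phi> x) - d) = norm (\<phi> x) - d" "max d (norm (\<phi> x)) = norm (\<phi> x)"
      using d by auto
    have "\<phi> x - \<phi>1 x = (d / norm (\<phi> x)) *\<^sub>R \<phi> x"
      unfolding \<phi>1_def p using p(1) by (simp add: diff_divide_distrib scaleR_diff_left)
    moreover have "norm (\<phi>1 x) = norm (\<phi> x) - d" unfolding \<phi>1_def p using False p(1) by simp
    ultimately show ?thesis using d p(1) by simp
  qed
  define K where "K = {x\<in>\<Omega>. d \<le> norm (\<phi> x)}"
  have cK: "compact K" using \<phi>(1) d by (auto simp: K_def C0_def)
  have K\<Omega>: "K \<subseteq> \<Omega>" by (auto simp: K_def)
  obtain h where h: "h \<in> test_functions \<Omega>" "\<And>x. 0 \<le> h x" "\<And>x. h x \<le> 1" "\<And>x. x \<in> K \<Longrightarrow> h x = 1"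
    using smooth_cutoff[OF cK op K\<Omega>] by metis
  have "continuous_on (supp h) \<phi>1" by (rule continuous_on_subset[OF c1 test_functions_supp[OF h(1)]])
  then obtain g where g: "polynomial_function g" "\<And>x. x \<in> supp h \<Longrightarrow> norm (\<phi>1 x - g x) < d"
    using Stone_Weierstrass_polynomial_function[OF test_functions_compact_supp[OF h(1)] _ d, of \<phi>1] by metis
  define \<psi>0 where "\<psi>0 x = h x *\<^sub>R g x" for x
  have hphi: "h x *\<^sub>R \<phi>1 x = \<phi>1 x" if "x \<in> \<Omega>" for x
    using that h(4)[of x] by (cases "x \<in> K") (auto simp: K_def \<phi>1_def)
  have n0: "norm (\<phi>1 x - \<psi>0 x) \<le> d" if x: "x \<in> \<Omega>" for x
  proof (cases "x \<in> supp h")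
    case True
    have "\<phi>1 x - \<psi>0 x = h x *\<^sub>R (\<phi>1 x - g x)" using hphi[OF x] by (simp add: \<psi>0_def scaleR_diff_right)
    then have "norm (\<phi>1 x - \<psi>0 x) \<le> 1 * d"
      using g(2)[OF True] h(2,3)[of x] d by (simp only: norm_scaleR) (intro mult_mono, auto)
    then show ?thesis by simp
  next
    case False
    then have "h x = 0" by (rule notin_supp)
    then show ?thesis using hphi[OF x] d by (simp add: \<psi>0_def)
  qed
  have b0: "norm (\<psi>0 x) \<le> 1 + d" for x
  proof (cases "x \<in> \<Omega>")
    case True
    have "norm (\<psi>0 x) \<le> norm (\<phi>1 x) + norm (\<phi>1 x - \<psi>0 x)" by (metis norm_minus_commute norm_triangle_sub)
    then show ?thesis using n0[OF True] near[of x] \<phi>(2)[OF True] by linarith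
  next
    case False
    then show ?thesis using test_functions_eq_0[OF h(1) False] d by (simp add: \<psi>0_def)
  qed
  define \<psi> where "\<psi> x = (1 / (1 + d)) *\<^sub>R \<psi>0 x" for x
  have "\<psi> \<in> vtest \<Omega>"
    unfolding vtest_def
  proof (intro CollectI conjI allI)
    fix i
    have "real_polynomial_function (\<lambda>x. g x $ i)"
      using g(1) bounded_linear_vec_nth[of i] unfolding polynomial_function_def comp_def by blast
    then have "(\<lambda>x. (1 / (1 + d)) * (g x $ i * h x)) \<in> test_functions \<Omega>"
      by (intro test_functions_cmult test_functions_mult h(1) smooth_real_polynomial_function)
    then show "(\<lambda>x. \<psi> x $ i) \<in> test_functions \<Omega>" by (simp add: \<psi>_def \<psi>0_def mult_ac)
  next
    show "norm (\<psi> x) \<le> 1" for x using b0[of x] d by (simp add: \<psi>_def)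
  qed
  moreover have "norm (\<phi> x - \<psi> x) \<le> e" if x: "x \<in> \<Omega>" for x
  proof -
    have "\<psi>0 x - \<psi> x = (d / (1 + d)) *\<^sub>R \<psi>0 x"
    proof -
      have "1 - 1 / (1 + d) = d / (1 + d)" using d by (simp add: field_simps)
      then show ?thesis unfolding \<psi>_def by (metis scaleR_diff_left scaleR_one)
    qed
    then have "norm (\<psi>0 x - \<psi> x) \<le> d"
      using mult_left_mono[OF b0[of x], of "d / (1 + d)"] d by simp
    moreover have "\<phi> x - \<psi> x = (\<phi> x - \<phi>1 x) + ((\<phi>1 x - \<psi>0 x) + (\<psi>0 x - \<psi> x))" by simp
    ultimately show ?thesis
      using near[of x] n0[OF x] norm_triangle_ineq[of "\<phi> x - \<phi>1 x" "(\<phi>1 x - \<psi>0 x) + (\<psi>0 x - \<psi> x)"]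
        norm_triangle_ineq[of "\<phi>1 x - \<psi>0 x" "\<psi>0 x - \<psi> x"] by (simp add: d_def)
  qed
  ultimately show thesis by (rule that)
qed

lemma vtest_C0:
  fixes \<phi> :: "real^2 \<Rightarrow> real^'d"
  assumes \<phi>: "\<phi> \<in> vtest \<Omega>"
  shows "\<phi> \<in> C0 \<Omega>"
proof -
  have ti: "(\<lambda>x. \<phi> x $ i) \<in> test_functions \<Omega>" for i using \<phi> by (simp add: vtest_def)
  have cont: "continuous_on S \<phi>" for S
    unfolding continuous_on_componentwise[of S \<phi>] Basis_vec_def
    by (auto simp: inner_axis intro: test_functions_continuous[OF ti])
  have "compact {x\<in>\<Omega>. e \<le> norm (\<phi> x)}" if e: "0 < e" for e
  proof -
    let ?K = "\<Union>i\<in>UNIV. supp (\<lambda>x. \<phi> x $ i)"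
    have K: "compact ?K" by (intro compact_UN finite test_functions_compact_supp[OF ti])
    have "closed {x. e \<le> norm (\<phi> x)}"
      by (rule closed_Collect_le) (auto intro!: continuous_on_norm cont)
    moreover have "{x. e \<le> norm (\<phi> x)} \<subseteq> ?K"
    proof
      fix x assume "x \<in> {x. e \<le> norm (\<phi> x)}"
      then have "\<phi> x \<noteq> 0" using e by auto
      then obtain i where "\<phi> x $ i \<noteq> 0" by (auto simp: vec_eq_iff)
      then have "x \<in> supp (\<lambda>x. \<phi> x $ i)" using notin_supp[of x "\<lambda>x. \<phi> x $ i"] by argo
      then show "x \<in> ?K" by (rule UN_I[OF UNIV_I])
    qed
    moreover have "?K \<subseteq> \<Omega>" by (intro UN_least test_functions_supp[OF ti])
    ultimately have "{x\<in>\<Omega>. e \<le> norm (\<phi> x)} = ?K \<inter> {x. e \<le> norm (\<phi> x)}" by (simp only: set_eq_iff Int_iff mem_Collect_eq subset_iff) metis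
    then show ?thesis using compact_Int_closed[OF K \<open>closed _\<close>] by simp
  qed
  then show ?thesis using cont by (simp add: C0_def)
qed

lemma radon_measures_component:
  assumes "\<mu> \<in> radon_measures \<Omega>"
  shows "real_measure \<Omega> (\<lambda>A. \<mu> A $ i)"
proof
  fix A :: "nat \<Rightarrow> (real^2) set"
  assume "\<And>n. A n \<in> borel_sets \<Omega>" "disjoint_family A"
  then have "(\<lambda>n. \<mu> (A n)) sums \<mu> (\<Union>n. A n)" using assms by (auto simp: radon_measures_def)
  then show "(\<lambda>n. \<mu> (A n) $ i) sums (\<mu> (\<Union>n. A n) $ i)"
    by (rule bounded_linear.sums[OF bounded_linear_vec_nth])
qed

text \<open>Test fields belong to the unit ball of \<open>C0\<close> and by \<open>C0_approx\<close>
  are uniformly dense in it, and integrals against a finite measure are continuous for the supremum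
  norm.\<close>

lemma dual_norm_eq_vnorm:
  fixes \<mu> :: "(real^2) set \<Rightarrow> real^'d"
  assumes op: "open \<Omega>" and \<mu>: "\<mu> \<in> radon_measures \<Omega>"
  shows "dual_norm \<Omega> \<mu> = vnorm \<Omega> (distr_of_measure \<Omega> \<mu>)"
proof (rule antisym)
  define L where "L \<phi> = (\<Sum>i\<in>UNIV. signed_integral \<Omega> (\<lambda>A. \<mu> A $ i) (\<lambda>x. \<phi> x $ i))" for \<phi> :: "real^2 \<Rightarrow> real^'d"
  have L: "pairing (distr_of_measure \<Omega> \<mu>) \<phi> = L \<phi>" for \<phi>
    by (simp add: pairing_def distr_of_measure_def L_def)
  have dn: "dual_norm \<Omega> \<mu> = (SUP \<phi>\<in>{\<phi>. \<phi> \<in> C0 \<Omega> \<and> (\<forall>x\<in>\<Omega>. norm (\<phi> x) \<le> 1)}. ereal (L \<phi>))"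
    by (simp add: dual_norm_def L_def)
  show "vnorm \<Omega> (distr_of_measure \<Omega> \<mu>) \<le> dual_norm \<Omega> \<mu>"
  proof (rule vnorm_leI)
    fix \<phi> :: "real^2 \<Rightarrow> real^'d" assume \<phi>: "\<phi> \<in> vtest \<Omega>"
    then show "ereal (pairing (distr_of_measure \<Omega> \<mu>) \<phi>) \<le> dual_norm \<Omega> \<mu>"
      unfolding L dn using vtest_C0[OF \<phi>] by (intro SUP_upper) (simp add: vtest_def)
  qed
  have "\<exists>C\<ge>0. \<forall>\<phi> M. continuous_on \<Omega> \<phi> \<longrightarrow> (\<forall>x\<in>\<Omega>. \<bar>\<phi> x\<bar> \<le> M) \<longrightarrow> \<bar>signed_integral \<Omega> (\<lambda>A. \<mu> A $ i) \<phi>\<bar> \<le> C * M" for i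
    by (rule real_measure.abs_signed_integral_le[OF radon_measures_component[OF \<mu>]])
  then obtain C where C: "\<And>i. 0 \<le> C i" "\<And>i \<phi> M. continuous_on \<Omega> \<phi> \<Longrightarrow> (\<forall>x\<in>\<Omega>. \<bar>\<phi> x\<bar> \<le> M) \<Longrightarrow> \<bar>signed_integral \<Omega> (\<lambda>A. \<mu> A $ i) \<phi>\<bar> \<le> C i * M"
    by metis
  define D where "D = (\<Sum>i\<in>UNIV. C i)"
  have D: "0 \<le> D" unfolding D_def using C(1) by (simp add: sum_nonneg)
  show "dual_norm \<Omega> \<mu> \<le> vnorm \<Omega> (distr_of_measure \<Omega> \<mu>)"
    unfolding dn
  proof (rule SUP_least)
    fix \<phi> :: "real^2 \<Rightarrow> real^'d" assume "\<phi> \<in> {\<phi>. \<phi> \<in> C0 \<Omega> \<and> (\<forall>x\<in>\<Omega>. norm (\<phi> x) \<le> 1)}"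
    then have \<phi>: "\<phi> \<in> C0 \<Omega>" "\<And>x. x \<in> \<Omega> \<Longrightarrow> norm (\<phi> x) \<le> 1" by auto
    have c\<phi>: "continuous_on \<Omega> (\<lambda>x. \<phi> x $ i)" for i
      using \<phi>(1) by (auto simp: C0_def intro: continuous_on_component)
    show "ereal (L \<phi>) \<le> vnorm \<Omega> (distr_of_measure \<Omega> \<mu>)"
    proof (rule ereal_le_epsilon)
      fix \<epsilon> :: ereal assume \<epsilon>: "0 < \<epsilon>"
      show "ereal (L \<phi>) \<le> vnorm \<Omega> (distr_of_measure \<Omega> \<mu>) + \<epsilon>"
      proof (cases \<epsilon>)
        case (real r)
        \<comment> \<open>\<open>D\<close> sums the constants of the components. The summand 1
          avoids a division by 0 and still leaves \<open>D * e \<le> r\<close>.\<close>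
        define e where "e = r / (D + 1)"
        have e: "0 < e" using \<epsilon> D real by (simp add: e_def)
        obtain \<psi> where \<psi>: "\<psi> \<in> vtest \<Omega>" "\<And>x. x \<in> \<Omega> \<Longrightarrow> norm (\<phi> x - \<psi> x) \<le> e"
          using C0_approx[OF op \<phi> e] by blast
        have c\<psi>: "continuous_on \<Omega> (\<lambda>x. \<psi> x $ i)" for i
          using vtest_C0[OF \<psi>(1)] by (auto simp: C0_def intro: continuous_on_component)
        have "signed_integral \<Omega> (\<lambda>A. \<mu> A $ i) (\<lambda>x. \<phi> x $ i) \<le> signed_integral \<Omega> (\<lambda>A. \<mu> A $ i) (\<lambda>x. \<psi> x $ i) + C i * e" for i
        proof -
          have "\<bar>\<phi> x $ i - \<psi> x $ i\<bar> \<le> e" if "x \<in> \<Omega>" for x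
            using component_le_norm_cart[of "\<phi> x - \<psi> x" i] \<psi>(2)[OF that] by simp
          moreover have "continuous_on \<Omega> (\<lambda>x. \<phi> x $ i - \<psi> x $ i)" by (intro continuous_intros c\<phi> c\<psi>)
          ultimately have 1: "\<bar>signed_integral \<Omega> (\<lambda>A. \<mu> A $ i) (\<lambda>x. \<phi> x $ i - \<psi> x $ i)\<bar> \<le> C i * e"
            and 2: "continuous_on \<Omega> (\<lambda>x. \<phi> x $ i - \<psi> x $ i)" "\<And>x. x \<in> \<Omega> \<Longrightarrow> \<bar>\<phi> x $ i - \<psi> x $ i\<bar> \<le> e"
            using C(2)[of "\<lambda>x. \<phi> x $ i - \<psi> x $ i" e i] by auto
          have "\<bar>\<psi> x $ i\<bar> \<le> 1" for x
            using \<psi>(1) component_le_norm_cart[of "\<psi> x" i] by (auto simp: vtest_def intro: order_trans)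
          then show ?thesis
            using real_measure.signed_integral_add[OF radon_measures_component[OF \<mu>, of i] 2 c\<psi>, of i 1] 1 by simp
        qed
        then have "L \<phi> \<le> (\<Sum>i\<in>UNIV. signed_integral \<Omega> (\<lambda>A. \<mu> A $ i) (\<lambda>x. \<psi> x $ i) + C i * e)"
          unfolding L_def by (intro sum_mono)
        also have "\<dots> = L \<psi> + D * e" by (simp add: L_def D_def sum.distrib sum_distrib_right)
        also have "D * e \<le> r" using D \<epsilon> real by (simp add: e_def field_simps)
        finally have "ereal (L \<phi>) \<le> ereal (pairing (distr_of_measure \<Omega> \<mu>) \<psi>) + \<epsilon>" by (simp add: L real)
        then show ?thesis using pairing_le_vnorm[OF \<psi>(1)] by (meson add_right_mono order_trans)
      qed (use \<epsilon> in auto)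
    qed
  qed
qed

text \<open>\<open>vnorm\<close> sees only the values on test functions, so the representing measure
  picked by \<open>SOME\<close> does not matter. If there is none, \<open>vnorm\<close> must be
  infinite: a finite value bounds each component by the supremum norm, and the Riesz theorem would
  supply a measure.\<close>

theorem M_norm_eq_vnorm:
  assumes op: "open \<Omega>" and T: "linear_distr \<Omega> T"
  shows "M_norm \<Omega> T = vnorm \<Omega> T"
proof (cases "\<exists>\<mu>. represents \<Omega> \<mu> T")
  case True
  define \<mu> where "\<mu> = (SOME \<mu>. represents \<Omega> \<mu> T)"
  have \<mu>: "represents \<Omega> \<mu> T" unfolding \<mu>_def using True by (rule someI_ex)
  have "M_norm \<Omega> T = vnorm \<Omega> (distr_of_measure \<Omega> \<mu>)"
    unfolding M_norm_def \<mu>_def[symmetric] using True \<mu> dual_norm_eq_vnorm[OF op, of \<mu>]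
    by (simp only: if_True represents_def)
  also have "\<dots> = vnorm \<Omega> T" using \<mu> by (intro vnorm_cong) (simp add: represents_def)
  finally show ?thesis .
next
  case False
  have "vnorm \<Omega> T = \<infinity>"
  proof (rule ccontr)
    assume "vnorm \<Omega> T \<noteq> \<infinity>"
    then obtain c where c: "vnorm \<Omega> T = ereal c" using vnorm_nonneg[OF T] by (cases "vnorm \<Omega> T") auto
    have "\<exists>\<mu>. represents \<Omega> \<mu> T"
      using abs_component_le_vnorm[OF T, of c] c by (intro representable[OF op T]) (metis order_refl)
    with False show False by blast
  qed
  with False show ?thesis by (simp add: M_norm_def)
qed

section \<open>Distributions with measure-valued gradient on Lipschitz domains\<close>

lemma test_function_measurable_lebesgue:
  assumes "f \<in> test_functions \<Omega>"
  shows "f \<in> borel_measurable (lebesgue_on S)"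
proof -
  have "f \<in> borel_measurable borel"
    by (rule borel_measurable_continuous_onI[OF test_functions_continuous[OF assms]])
  then have "f \<in> borel_measurable lebesgue" by (simp add: measurable_completion)
  then show ?thesis by (rule measurable_restrict_space1)
qed

lemma integrable_mult_test_function:
  assumes u: "integrable (lebesgue_on \<Omega>) u" and f: "f \<in> test_functions U"
  shows "integrable (lebesgue_on \<Omega>) (\<lambda>x. u x * f x)"
proof -
  obtain M where M: "0 \<le> M" "\<And>x. \<bar>f x\<bar> \<le> M" using test_functions_bounded[OF f] by blast
  have "integrable (lebesgue_on \<Omega>) (\<lambda>x. u x * M)" using u by simp
  then show ?thesis
    by (rule Bochner_Integration.integrable_bound)
      (use M u test_function_measurable_lebesgue[OF f] in \<open>auto simp: abs_mult intro!: mult_left_mono borel_measurable_times\<close>)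
qed

lemma abs_integral_mult_le:
  fixes u g :: "real^2 \<Rightarrow> real"
  assumes u: "integrable (lebesgue_on \<Omega>) u" and g: "\<And>x. \<bar>g x\<bar> \<le> M"
  shows "\<bar>\<integral>x. u x * g x \<partial>lebesgue_on \<Omega>\<bar> \<le> M * (\<integral>x. \<bar>u x\<bar> \<partial>lebesgue_on \<Omega>)"
proof (cases "integrable (lebesgue_on \<Omega>) (\<lambda>x. u x * g x)")
  case True
  have "\<bar>\<integral>x. u x * g x \<partial>lebesgue_on \<Omega>\<bar> \<le> (\<integral>x. \<bar>u x * g x\<bar> \<partial>lebesgue_on \<Omega>)"
    by (rule integral_abs_bound)
  also have "\<dots> \<le> (\<integral>x. M * \<bar>u x\<bar> \<partial>lebesgue_on \<Omega>)"
  proof (rule integral_mono)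
    show "integrable (lebesgue_on \<Omega>) (\<lambda>x. \<bar>u x * g x\<bar>)" using True by (rule integrable_abs)
    show "\<bar>u x * g x\<bar> \<le> M * \<bar>u x\<bar>" for x
      using mult_left_mono[OF g[of x], of "\<bar>u x\<bar>"] by (simp add: abs_mult mult.commute)
  qed (use u in simp)
  finally show ?thesis by simp
next
  case False
  have "0 \<le> M" using g[of 0] by linarith
  then show ?thesis using False by (simp add: not_integrable_integral_eq)
qed

text \<open>The vector \<open>a\<close> serves twice, as the direction of averaging and as the
  component of \<open>W\<close> that is estimated. Only so does the gradient of \<open>u\<close>
  meet the derivative of the mean in the direction in which it is free of derivatives of
  \<open>f\<close>. Hence each admissible direction yields one component of
  \<open>W\<close>.\<close>

lemma directional_bound:
  assumes W: "linear_distr \<Omega> W" and u: "integrable (lebesgue_on \<Omega>) u"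
    and A3: "\<And>f M i. f \<in> test_functions \<Omega> \<Longrightarrow> (\<And>x. \<bar>f x\<bar> \<le> M) \<Longrightarrow> \<bar>(grad \<Omega> u f - W f) $ i\<bar> \<le> c * M"
    and A4: "\<And>f M i j. f \<in> test_functions \<Omega> \<Longrightarrow> (\<And>x. \<bar>f x\<bar> \<le> M) \<Longrightarrow> \<bar>W (partial j f) $ i\<bar> \<le> c * M"
    and D: "\<And>x s. x \<in> D \<Longrightarrow> s \<in> {0..1} \<Longrightarrow> x + s *\<^sub>R a \<in> \<Omega>"
  shows "sup_bounded D (\<lambda>f. \<Sum>i\<in>UNIV. a $ i * W f $ i)"
proof -
  define S where "S = (\<Sum>i\<in>UNIV. \<bar>a $ i\<bar>)"
  define I where "I = (\<integral>x. \<bar>u x\<bar> \<partial>lebesgue_on \<Omega>)"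
  \<comment> \<open>\<open>2 * I\<close> comes from a difference of two values of \<open>f\<close>.
    \<open>S\<close> bounds one contraction with \<open>a\<close>; it occurs twice in the last term,
    where both the component of \<open>W\<close> and the derivative are taken along
    \<open>a\<close>.\<close>
  have "\<bar>\<Sum>i\<in>UNIV. a $ i * W f $ i\<bar> \<le> (2 * I + S * c + S * (S * c)) * M"
    if f: "f \<in> test_functions D" and M: "\<And>x. \<bar>f x\<bar> \<le> M" for f M
  proof -
    note sf = test_functions_smooth[OF f]
    define A where "A = seg_avg (\<lambda>_. 1) a f"
    define \<psi> where "\<psi> = seg_avg (\<lambda>s. 1 - s) a f"
    have c1: "continuous_on {0..1} (\<lambda>s::real. 1 - s)" by (intro continuous_intros)
    have c0: "continuous_on {0..1} (\<lambda>s::real. 1::real)" by (intro continuous_intros)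
    have AT: "A \<in> test_functions \<Omega>" unfolding A_def by (rule test_functions_seg_avg[OF f c0 D])
    have PT: "\<psi> \<in> test_functions \<Omega>" unfolding \<psi>_def by (rule test_functions_seg_avg[OF f c1 D])
    have AM: "\<bar>A x\<bar> \<le> M" for x unfolding A_def by (rule abs_seg_avg_le[OF sf c0]) (auto simp: M)
    have PM: "\<bar>\<psi> x\<bar> \<le> M" for x unfolding \<psi>_def by (rule abs_seg_avg_le[OF sf c1]) (auto simp: M)
    note pT = test_functions_partial[OF PT]
    have f_eq: "f = (\<lambda>x. A x + (a $ 1 * partial 1 \<psi> x + a $ 2 * partial 2 \<psi> x))"
      using directional_partial_seg_avg_weighted[OF sf, of a] by (auto simp: A_def \<psi>_def sum_2)
    have Wf: "W f = W A + (a $ 1 *\<^sub>R W (partial 1 \<psi>) + a $ 2 *\<^sub>R W (partial 2 \<psi>))"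
      by (subst f_eq) (simp add: linear_distr_add[OF W] linear_distr_cmult[OF W] AT pT
          test_functions_add test_functions_cmult)
    have Wfi: "W f $ i = W A $ i + (\<Sum>j\<in>UNIV. a $ j * W (partial j \<psi>) $ i)" for i
      by (simp add: Wf sum_2)
    have bnd: "\<bar>\<Sum>i\<in>UNIV. a $ i * y i\<bar> \<le> S * B" if "\<And>i. \<bar>y i\<bar> \<le> B" for y :: "2 \<Rightarrow> real" and B
    proof -
      have "\<bar>\<Sum>i\<in>UNIV. a $ i * y i\<bar> \<le> (\<Sum>i\<in>UNIV. \<bar>a $ i * y i\<bar>)" by (rule sum_abs)
      also have "\<dots> \<le> (\<Sum>i\<in>UNIV. \<bar>a $ i\<bar> * B)"
        by (intro sum_mono) (simp add: abs_mult mult_left_mono that)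
      finally show ?thesis by (simp add: S_def sum_distrib_right)
    qed
    have 1: "\<bar>\<Sum>i\<in>UNIV. a $ i * (\<Sum>j\<in>UNIV. a $ j * W (partial j \<psi>) $ i)\<bar> \<le> S * (S * (c * M))"
      by (intro bnd A4 PT PM)
    have 2: "\<bar>\<Sum>i\<in>UNIV. a $ i * (grad \<Omega> u A - W A) $ i\<bar> \<le> S * (c * M)"
      by (intro bnd A3 AT AM)
    \<comment> \<open>The derivative of \<open>A\<close> along \<open>a\<close> is
      \<open>f x - f (x - a)\<close>, so pairing with the gradient costs only \<open>2 * M\<close>
      times the L1 norm of \<open>u\<close>.\<close>
    have "(\<Sum>i\<in>UNIV. a $ i * grad \<Omega> u A $ i) = - (\<integral>x. u x * (f x - f (x - a)) \<partial>lebesgue_on \<Omega>)"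
    proof -
      have d: "f x - f (x - a) = a $ 1 * partial 1 A x + a $ 2 * partial 2 A x" for x
        using directional_partial_seg_avg_1[OF sf, of a x] by (simp add: A_def sum_2)
      have "(\<integral>x. u x * (f x - f (x - a)) \<partial>lebesgue_on \<Omega>) =
          (\<integral>x. a $ 1 * (u x * partial 1 A x) + a $ 2 * (u x * partial 2 A x) \<partial>lebesgue_on \<Omega>)"
        unfolding d by (simp add: algebra_simps)
      also have "\<dots> = a $ 1 * (\<integral>x. u x * partial 1 A x \<partial>lebesgue_on \<Omega>) + a $ 2 * (\<integral>x. u x * partial 2 A x \<partial>lebesgue_on \<Omega>)"
        using integrable_mult_test_function[OF u test_functions_partial[OF AT]] by simp
      finally show ?thesis by (simp add: grad_def distr_deriv_def distr_of_fun_def sum_2)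
    qed
    moreover have "\<bar>f x - f (x - a)\<bar> \<le> 2 * M" for x using M[of x] M[of "x - a"] by linarith
    ultimately have 3: "\<bar>\<Sum>i\<in>UNIV. a $ i * grad \<Omega> u A $ i\<bar> \<le> 2 * M * I"
      using abs_integral_mult_le[OF u, of "\<lambda>x. f x - f (x - a)" "2 * M"] by (simp add: I_def)
    have "(\<Sum>i\<in>UNIV. a $ i * W f $ i) = (\<Sum>i\<in>UNIV. a $ i * grad \<Omega> u A $ i)
        - (\<Sum>i\<in>UNIV. a $ i * (grad \<Omega> u A - W A) $ i)
        + (\<Sum>i\<in>UNIV. a $ i * (\<Sum>j\<in>UNIV. a $ j * W (partial j \<psi>) $ i))"
      unfolding Wfi sum_subtractf[symmetric] sum.distrib[symmetric]
      by (intro sum.cong refl) (simp add: algebra_simps)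
    with 1 2 3 have "\<bar>\<Sum>i\<in>UNIV. a $ i * W f $ i\<bar> \<le> 2 * M * I + S * (c * M) + S * (S * (c * M))" by linarith
    then show ?thesis by (simp add: algebra_simps)
  qed
  then show ?thesis by blast
qed

text \<open>In the interior short coordinate vectors do. At a boundary point the vectors are
  multiples of \<open>e2\<close> tilted by \<epsilon> to either side along \<open>e1\<close>: a step
  in such a direction gains at least as much height as the Lipschitz graph can gain below
  it.\<close>

lemma lipschitz_domain_directions:
  assumes \<Omega>: "bounded_lipschitz_domain \<Omega>" and z: "z \<in> closure \<Omega>"
  shows "\<exists>r>0. \<exists>a b. a $ 1 * b $ 2 - a $ 2 * b $ 1 \<noteq> 0 \<and>
    (\<forall>x\<in>\<Omega> \<inter> ball z r. \<forall>s\<in>{0..1}. x + s *\<^sub>R a \<in> \<Omega> \<and> x + s *\<^sub>R b \<in> \<Omega>)"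
proof (cases "z \<in> \<Omega>")
  case True
  then obtain r where r: "0 < r" "ball z r \<subseteq> \<Omega>"
    using \<Omega> unfolding bounded_lipschitz_domain_def open_contains_ball by blast
  have mem: "x + s *\<^sub>R ((r / 2) *\<^sub>R axis i 1) \<in> \<Omega>" if "x \<in> ball z (r / 2)" "s \<in> {0..1}" for x s i
  proof -
    have "norm (s *\<^sub>R ((r / 2) *\<^sub>R (axis i 1 :: real^2))) \<le> r / 2"
      using that r(1) by (simp add: mult_left_le_one_le)
    then have "dist z (x + s *\<^sub>R ((r / 2) *\<^sub>R axis i 1)) < r / 2 + r / 2"
      using that(1) norm_triangle_ineq[of "x - z" "s *\<^sub>R ((r / 2) *\<^sub>R (axis i 1 :: real^2))"]
      by (simp add: dist_norm norm_minus_commute[of z] add_diff_eq algebra_simps)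
    then show ?thesis using r(2) by auto
  qed
  have "((r / 2) *\<^sub>R axis 1 1 :: real^2) $ 1 * ((r / 2) *\<^sub>R axis 2 1 :: real^2) $ 2 -
        ((r / 2) *\<^sub>R axis 1 1 :: real^2) $ 2 * ((r / 2) *\<^sub>R axis 2 1 :: real^2) $ 1 \<noteq> 0"
    using r(1) by (simp add: axis_def)
  moreover have "\<forall>x\<in>\<Omega> \<inter> ball z (r / 2). \<forall>s\<in>{0..1}. x + s *\<^sub>R ((r / 2) *\<^sub>R axis 1 1) \<in> \<Omega> \<and> x + s *\<^sub>R ((r / 2) *\<^sub>R axis 2 1) \<in> \<Omega>"
    using mem by blast
  moreover have "0 < r / 2" using r(1) by simp
  ultimately show ?thesis by blast
next
  case False
  then have "z \<in> frontier \<Omega>"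
    using z \<Omega> by (simp add: frontier_def bounded_lipschitz_domain_def interior_open)
  then obtain r e1 e2 L \<gamma> where r: "0 < r" and e: "norm e1 = 1" "norm e2 = 1" "e1 \<bullet> e2 = 0"
    and L: "L-lipschitz_on UNIV \<gamma>" and ep: "\<Omega> \<inter> ball z r = {x \<in> ball z r. \<gamma> (x \<bullet> e1) < x \<bullet> e2}"
    using \<Omega> unfolding bounded_lipschitz_domain_def lipschitz_boundary_def by blast
  have L0: "0 \<le> L" by (rule lipschitz_on_nonneg[OF L])
  have e': "e1 \<bullet> e1 = 1" "e2 \<bullet> e2 = 1" "e2 \<bullet> e1 = 0"
    using e by (simp_all add: dot_square_norm inner_commute)
  \<comment> \<open>The tilted vectors have norm at most 2, so a step of factor \<open>r / 4\<close>
    from the half ball stays in the ball. The choice \<open>1 / (L + 1)\<close> gives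
    \<open>L * \<epsilon> \<le> 1\<close> and also covers \<open>L = 0\<close>.\<close>
  define h where "h = r / 4"
  define \<epsilon> where "\<epsilon> = 1 / (L + 1)"
  have h: "0 < h" using r by (simp add: h_def)
  have \<epsilon>: "0 < \<epsilon>" "\<epsilon> \<le> 1" "L * \<epsilon> \<le> 1" using L0 by (simp_all add: \<epsilon>_def field_simps)
  have mem: "x + s *\<^sub>R (h *\<^sub>R (e2 + k *\<^sub>R e1)) \<in> \<Omega>"
    if x: "x \<in> \<Omega>" "x \<in> ball z (r / 2)" and s: "s \<in> {0..1}" and k: "\<bar>k\<bar> = \<epsilon>" for x s k
  proof -
    let ?y = "x + s *\<^sub>R (h *\<^sub>R (e2 + k *\<^sub>R e1))"
    have "norm (e2 + k *\<^sub>R e1) \<le> 2" using norm_triangle_ineq[of e2 "k *\<^sub>R e1"] e k \<epsilon> by simp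
    then have "norm (s *\<^sub>R (h *\<^sub>R (e2 + k *\<^sub>R e1))) \<le> 1 * (h * 2)"
      unfolding norm_scaleR using s h by (intro mult_mono) auto
    then have "norm (s *\<^sub>R (h *\<^sub>R (e2 + k *\<^sub>R e1))) \<le> r / 2" by (simp add: h_def)
    then have yb: "?y \<in> ball z r"
      using x(2) norm_triangle_ineq[of "x - z" "s *\<^sub>R (h *\<^sub>R (e2 + k *\<^sub>R e1))"]
      by (simp add: dist_norm norm_minus_commute[of z] add_diff_eq algebra_simps)
    have "x \<in> ball z r" using x(2) r by auto
    then have gx: "\<gamma> (x \<bullet> e1) < x \<bullet> e2" using x(1) ep by blast
    have y1: "?y \<bullet> e1 = x \<bullet> e1 + s * h * k" and y2: "?y \<bullet> e2 = x \<bullet> e2 + s * h"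
      using e e' by (simp_all add: inner_add_left algebra_simps)
    have "\<bar>\<gamma> (?y \<bullet> e1) - \<gamma> (x \<bullet> e1)\<bar> \<le> L * \<bar>s * h * k\<bar>"
      using lipschitz_onD[OF L, of "?y \<bullet> e1" "x \<bullet> e1"] unfolding y1 by (simp add: dist_real_def)
    also have "\<dots> = s * h * (L * \<epsilon>)" using s h k by (simp add: abs_mult)
    also have "\<dots> \<le> s * h * 1" using s h \<epsilon> by (intro mult_left_mono) auto
    finally have "\<gamma> (?y \<bullet> e1) < ?y \<bullet> e2" using gx y2 by linarith
    then show ?thesis using ep yb by blast
  qed
  define a where "a = h *\<^sub>R (e2 + \<epsilon> *\<^sub>R e1)"
  define b where "b = h *\<^sub>R (e2 + (- \<epsilon>) *\<^sub>R e1)"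
  \<comment> \<open>Lagrange's identity: orthonormal vectors have determinant 1 or -1, and the
    determinant of \<open>a\<close> and \<open>b\<close> is a nonzero multiple of it.\<close>
  have "(e1 $ 1 * e2 $ 2 - e1 $ 2 * e2 $ 1)\<^sup>2 = (e1 \<bullet> e1) * (e2 \<bullet> e2) - (e1 \<bullet> e2)\<^sup>2"
    by (simp add: inner_vec_def sum_2 power2_eq_square algebra_simps)
  then have "e1 $ 1 * e2 $ 2 - e1 $ 2 * e2 $ 1 \<noteq> 0" using e e' by auto
  moreover have "a $ 1 * b $ 2 - a $ 2 * b $ 1 = 2 * h\<^sup>2 * \<epsilon> * (e1 $ 1 * e2 $ 2 - e1 $ 2 * e2 $ 1)"
    by (simp add: a_def b_def power2_eq_square algebra_simps)
  ultimately have "a $ 1 * b $ 2 - a $ 2 * b $ 1 \<noteq> 0" using h \<epsilon> by simp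
  moreover have "\<forall>x\<in>\<Omega> \<inter> ball z (r / 2). \<forall>s\<in>{0..1}. x + s *\<^sub>R a \<in> \<Omega> \<and> x + s *\<^sub>R b \<in> \<Omega>"
  proof (intro ballI conjI)
    fix x :: "real^2" and s :: real assume x: "x \<in> \<Omega> \<inter> ball z (r / 2)" and s: "s \<in> {0..1::real}"
    show "x + s *\<^sub>R a \<in> \<Omega>" unfolding a_def using x s \<epsilon> by (intro mem) auto
    show "x + s *\<^sub>R b \<in> \<Omega>" unfolding b_def using x s \<epsilon> by (intro mem) auto
  qed
  moreover have "0 < r / 2" using r by simp
  ultimately show ?thesis by blast
qed

text \<open>Near each point of the closure two independent directional bounds determine both
  components of \<open>W\<close>. Compactness of the closure and a partition of unity add the local
  bounds up.\<close>

lemma bounded_on_lipschitz_domain: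
  assumes \<Omega>: "bounded_lipschitz_domain \<Omega>"
    and W: "linear_distr \<Omega> W" and u: "integrable (lebesgue_on \<Omega>) u"
    and A3: "\<And>f M i. f \<in> test_functions \<Omega> \<Longrightarrow> (\<And>x. \<bar>f x\<bar> \<le> M) \<Longrightarrow> \<bar>(grad \<Omega> u f - W f) $ i\<bar> \<le> c * M"
    and A4: "\<And>f M i j. f \<in> test_functions \<Omega> \<Longrightarrow> (\<And>x. \<bar>f x\<bar> \<le> M) \<Longrightarrow> \<bar>W (partial j f) $ i\<bar> \<le> c * M"
  shows "sup_bounded \<Omega> (\<lambda>f. W f $ i)"
proof -
  have local: "\<exists>r>0. sup_bounded (\<Omega> \<inter> ball z r) (\<lambda>f. W f $ i)"
    if z: "z \<in> closure \<Omega>" for z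
  proof -
    obtain r a b where r: "0 < r" and ab: "a $ 1 * b $ 2 - a $ 2 * b $ 1 \<noteq> 0"
      and sa: "\<And>x s. x \<in> \<Omega> \<inter> ball z r \<Longrightarrow> s \<in> {0..1} \<Longrightarrow> x + s *\<^sub>R a \<in> \<Omega>"
      and sb: "\<And>x s. x \<in> \<Omega> \<inter> ball z r \<Longrightarrow> s \<in> {0..1} \<Longrightarrow> x + s *\<^sub>R b \<in> \<Omega>"
      using lipschitz_domain_directions[OF \<Omega> z] by blast
    define d where "d = a $ 1 * b $ 2 - a $ 2 * b $ 1"
    have "sup_bounded (\<Omega> \<inter> ball z r) (\<lambda>f. \<Sum>i\<in>UNIV. a $ i * W f $ i)"
      by (rule directional_bound[where c=c, OF W u]) (fact A3 A4 sa)+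
    then obtain Ca where Ca: "\<And>f M. f \<in> test_functions (\<Omega> \<inter> ball z r) \<Longrightarrow> \<forall>x. \<bar>f x\<bar> \<le> M \<Longrightarrow> \<bar>\<Sum>i\<in>UNIV. a $ i * W f $ i\<bar> \<le> Ca * M"
      by metis
    have "sup_bounded (\<Omega> \<inter> ball z r) (\<lambda>f. \<Sum>i\<in>UNIV. b $ i * W f $ i)"
      by (rule directional_bound[where c=c, OF W u]) (fact A3 A4 sb)+
    then obtain Cb where Cb: "\<And>f M. f \<in> test_functions (\<Omega> \<inter> ball z r) \<Longrightarrow> \<forall>x. \<bar>f x\<bar> \<le> M \<Longrightarrow> \<bar>\<Sum>i\<in>UNIV. b $ i * W f $ i\<bar> \<le> Cb * M"
      by metis
    have "\<bar>W f $ i\<bar> \<le> (((\<bar>b $ 1\<bar> + \<bar>b $ 2\<bar>) * Ca + (\<bar>a $ 1\<bar> + \<bar>a $ 2\<bar>) * Cb) / \<bar>d\<bar>) * M"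
      if f: "f \<in> test_functions (\<Omega> \<inter> ball z r)" "\<forall>x. \<bar>f x\<bar> \<le> M" for f M
    proof -
      define X where "X = (\<Sum>i\<in>UNIV. a $ i * W f $ i)"
      define Y where "Y = (\<Sum>i\<in>UNIV. b $ i * W f $ i)"
      have X: "\<bar>X\<bar> \<le> Ca * M" unfolding X_def by (rule Ca[OF f])
      have Y: "\<bar>Y\<bar> \<le> Cb * M" unfolding Y_def by (rule Cb[OF f])
      \<comment> \<open>Cramer's rule for the linear system with rows \<open>a\<close> and
        \<open>b\<close>.\<close>
      have 1: "d * W f $ 1 = b $ 2 * X - a $ 2 * Y" and 2: "d * W f $ 2 = a $ 1 * Y - b $ 1 * X"
        by (simp_all add: d_def X_def Y_def sum_2 algebra_simps)
      have *: "\<bar>\<beta> * X - \<alpha> * Y\<bar> \<le> (\<bar>b $ 1\<bar> + \<bar>b $ 2\<bar>) * (Ca * M) + (\<bar>a $ 1\<bar> + \<bar>a $ 2\<bar>) * (Cb * M)"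
        if "\<bar>\<beta>\<bar> \<le> \<bar>b $ 1\<bar> + \<bar>b $ 2\<bar>" "\<bar>\<alpha>\<bar> \<le> \<bar>a $ 1\<bar> + \<bar>a $ 2\<bar>" for \<alpha> \<beta>
      proof -
        have "\<bar>\<beta> * X\<bar> \<le> (\<bar>b $ 1\<bar> + \<bar>b $ 2\<bar>) * (Ca * M)" unfolding abs_mult using that X by (intro mult_mono) auto
        moreover have "\<bar>\<alpha> * Y\<bar> \<le> (\<bar>a $ 1\<bar> + \<bar>a $ 2\<bar>) * (Cb * M)" unfolding abs_mult using that Y by (intro mult_mono) auto
        ultimately show ?thesis by linarith
      qed
      have "\<bar>d * W f $ i\<bar> \<le> (\<bar>b $ 1\<bar> + \<bar>b $ 2\<bar>) * (Ca * M) + (\<bar>a $ 1\<bar> + \<bar>a $ 2\<bar>) * (Cb * M)"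
        using exhaust_2[of i] *[of "b $ 2" "a $ 2"] *[of "- (b $ 1)" "- (a $ 1)"] by (auto simp: 1 2)
      moreover have "0 < \<bar>d\<bar>" using ab by (simp add: d_def)
      ultimately show ?thesis by (simp add: abs_mult field_simps)
    qed
    then show ?thesis using r by blast
  qed
  then obtain r C where rC: "\<And>z. z \<in> closure \<Omega> \<Longrightarrow> 0 < r z"
    "\<And>z f M. z \<in> closure \<Omega> \<Longrightarrow> f \<in> test_functions (\<Omega> \<inter> ball z (r z)) \<Longrightarrow> \<forall>x. \<bar>f x\<bar> \<le> M \<Longrightarrow> \<bar>W f $ i\<bar> \<le> C z * M"
    by metis
  \<comment> \<open>The closure is covered, rather than the support of a given \<open>f\<close>, so
    that the finitely many local constants do not depend on \<open>f\<close>.\<close>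
  have K: "compact (closure \<Omega>)" using \<Omega> by (simp add: bounded_lipschitz_domain_def)
  have "closure \<Omega> \<subseteq> (\<Union>z\<in>closure \<Omega>. ball z (r z))"
  proof
    fix z assume "z \<in> closure \<Omega>"
    then show "z \<in> (\<Union>z\<in>closure \<Omega>. ball z (r z))" using rC(1) by (intro UN_I) auto
  qed
  then obtain Z where Z: "Z \<subseteq> closure \<Omega>" "finite Z" "closure \<Omega> \<subseteq> (\<Union>z\<in>Z. ball z (r z))"
    using compactE_image[OF K, of "closure \<Omega>" "\<lambda>z. ball z (r z)"] by (metis open_ball)
  obtain \<eta> where \<eta>: "\<And>z. z \<in> Z \<Longrightarrow> \<eta> z \<in> test_functions (ball z (r z))" "\<And>z x. 0 \<le> \<eta> z x"
    "\<And>x. (\<Sum>z\<in>Z. \<eta> z x) \<le> 1" "\<And>x. x \<in> closure \<Omega> \<Longrightarrow> (\<Sum>z\<in>Z. \<eta> z x) = 1"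
    using partition_of_unity[OF K Z(2) _ Z(3)] by (metis open_ball)
  have "\<bar>W f $ i\<bar> \<le> (\<Sum>z\<in>Z. C z) * M" if f: "f \<in> test_functions \<Omega>" and M: "\<forall>x. \<bar>f x\<bar> \<le> M" for f M
  proof -
    have eq: "f = (\<lambda>x. \<Sum>z\<in>Z. \<eta> z x * f x)"
    proof
      fix x
      have "x \<in> closure \<Omega> \<or> f x = 0" using test_functions_eq_0[OF f, of x] closure_subset[of \<Omega>] by auto
      then show "f x = (\<Sum>z\<in>Z. \<eta> z x * f x)"
        unfolding sum_distrib_right[symmetric] using \<eta>(4)[of x] by auto
    qed
    have loc: "(\<lambda>x. \<eta> z x * f x) \<in> test_functions (\<Omega> \<inter> ball z (r z))" if "z \<in> Z" for z
      by (rule test_functions_mult_local[OF f \<eta>(1)[OF that]])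
    have glob: "(\<lambda>x. \<eta> z x * f x) \<in> test_functions \<Omega>" if "z \<in> Z" for z
      by (rule test_functions_mono[OF loc[OF that]]) simp
    have "W (\<lambda>x. \<Sum>z\<in>Y. \<eta> z x * f x) = (\<Sum>z\<in>Y. W (\<lambda>x. \<eta> z x * f x))" if "finite Y" "Y \<subseteq> Z" for Y
      using that
    proof (induction Y)
      case empty
      then show ?case by (simp add: linear_distr_zero[OF W])
    next
      case (insert z Y)
      then have "W (\<lambda>x. \<eta> z x * f x + (\<Sum>z\<in>Y. \<eta> z x * f x)) = W (\<lambda>x. \<eta> z x * f x) + W (\<lambda>x. \<Sum>z\<in>Y. \<eta> z x * f x)"
        by (intro linear_distr_add[OF W] glob test_functions_sum) auto
      then show ?case using insert by simp
    qed
    from this[OF Z(2) subset_refl] have "W f = (\<Sum>z\<in>Z. W (\<lambda>x. \<eta> z x * f x))"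
      unfolding eq[symmetric] .
    then have "\<bar>W f $ i\<bar> \<le> (\<Sum>z\<in>Z. \<bar>W (\<lambda>x. \<eta> z x * f x) $ i\<bar>)"
      using sum_abs[of "\<lambda>z. W (\<lambda>x. \<eta> z x * f x) $ i" Z] by simp
    also have "\<dots> \<le> (\<Sum>z\<in>Z. C z * M)"
    proof (rule sum_mono)
      fix z assume z: "z \<in> Z"
      have "\<bar>\<eta> z x * f x\<bar> \<le> M" for x
      proof -
        have "\<eta> z x \<le> (\<Sum>z\<in>Z. \<eta> z x)" using z Z(2) \<eta>(2) by (intro member_le_sum) auto
        then have "\<eta> z x \<le> 1" using \<eta>(3)[of x] by linarith
        then have "\<bar>\<eta> z x\<bar> * \<bar>f x\<bar> \<le> 1 * M" using \<eta>(2)[of z x] M by (intro mult_mono) auto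
        then show ?thesis by (simp add: abs_mult)
      qed
      then show "\<bar>W (\<lambda>x. \<eta> z x * f x) $ i\<bar> \<le> C z * M"
        using Z(1) z by (intro rC(2) loc) auto
    qed
    finally show ?thesis by (simp add: sum_distrib_right)
  qed
  then show ?thesis by blast
qed

section \<open>The operators on distributions\<close>

text \<open>With \<open>natural4\<close> below, this extends \<open>nabla\<close> and
  \<open>nabla_N\<close> from measures to distributions, because the limit of the fields is
  differentiated before it is known to be a measure. The minus signs are those of
  \<open>distr_deriv\<close>.\<close>

definition grad4 :: "2 vdistr \<Rightarrow> 4 vdistr" where
  "grad4 W = (\<lambda>\<phi>. vector [- (W (partial 1 \<phi>) $ 1), - (W (partial 2 \<phi>) $ 1),
     - (W (partial 1 \<phi>) $ 2), - (W (partial 2 \<phi>) $ 2)])"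

definition natural4 :: "2 vdistr \<Rightarrow> 4 vdistr" where
  "natural4 W = (\<lambda>\<phi>. vector [W (partial 2 \<phi>) $ 1 - W (partial 1 \<phi>) $ 2,
     - (W (partial 1 \<phi>) $ 1) - W (partial 2 \<phi>) $ 2,
     W (partial 1 \<phi>) $ 1 - W (partial 2 \<phi>) $ 2,
     - (W (partial 2 \<phi>) $ 1) - W (partial 1 \<phi>) $ 2])"

abbreviation (input) weights :: "real \<Rightarrow> real^4" where
  "weights t \<equiv> vector [t, 1 / sqrt 2, 1 / sqrt 2, 1 / sqrt 2]"

lemma nabla_eq_grad4: "nabla \<Omega> w = grad4 (distr_of_measure \<Omega> w)"
  by (simp add: nabla_def grad4_def distr_deriv_def distr_comp_def)

lemma nabla_N_eq_natural4: "nabla_N \<Omega> w = natural4 (distr_of_measure \<Omega> w)"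
  by (simp add: fun_eq_iff nabla_N_def natural4_def curl_def divergence_def sh1_def sh2_def
      distr_deriv_def distr_comp_def)

lemma curl_eq: "curl \<Omega> w \<phi> = distr_of_measure \<Omega> w (partial 2 \<phi>) $ 1 - distr_of_measure \<Omega> w (partial 1 \<phi>) $ 2"
  by (simp add: curl_def distr_deriv_def distr_comp_def)

lemma diag_mult_component: "(diag b *v y) $ i = b $ i * y $ i"
  by (simp add: diag_def matrix_vector_mult_def if_distrib[of "\<lambda>c. c * _"] cong: if_cong)

lemma norm_le_1_iff_4: "norm (x :: real^4) \<le> 1 \<longleftrightarrow> (x $ 1)\<^sup>2 + (x $ 2)\<^sup>2 + (x $ 3)\<^sup>2 + (x $ 4)\<^sup>2 \<le> 1"
  by (simp add: norm_le_square inner_vec_def sum_4 power2_eq_square)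

lemma partial_test_add:
  "f \<in> test_functions \<Omega> \<Longrightarrow> g \<in> test_functions \<Omega> \<Longrightarrow>
    partial i (\<lambda>x. f x + g x) = (\<lambda>x. partial i f x + partial i g x)"
  by (rule partial_add) (auto intro: smooth_differentiable test_functions_smooth)

lemma partial_test_cmult:
  "f \<in> test_functions \<Omega> \<Longrightarrow> partial i (\<lambda>x. c * f x) = (\<lambda>x. c * partial i f x)"
  by (subst partial_mult)
    (auto intro: smooth_differentiable test_functions_smooth simp: partial_const)

lemma linear_distr_of_measure:
  assumes w: "w \<in> radon_measures \<Omega>"
  shows "linear_distr \<Omega> (distr_of_measure \<Omega> w)"
  unfolding linear_distr_def
proof (intro conjI ballI allI)
  fix f g assume f: "f \<in> test_functions \<Omega>" and g: "g \<in> test_functions \<Omega>"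
  obtain M where M: "\<And>x. \<bar>f x\<bar> \<le> M" using test_functions_bounded[OF f] by blast
  obtain M' where M': "\<And>x. \<bar>g x\<bar> \<le> M'" using test_functions_bounded[OF g] by blast
  show "distr_of_measure \<Omega> w (\<lambda>x. f x + g x) = distr_of_measure \<Omega> w f + distr_of_measure \<Omega> w g"
    by (simp add: vec_eq_iff distr_of_measure_def real_measure.signed_integral_add[OF radon_measures_component[OF w]
        test_functions_continuous[OF f] M test_functions_continuous[OF g] M'])
next
  fix f c
  show "distr_of_measure \<Omega> w (\<lambda>x. c * f x) = c *\<^sub>R distr_of_measure \<Omega> w f"
    by (simp add: vec_eq_iff distr_of_measure_def real_measure.signed_integral_cmult[OF radon_measures_component[OF w]])
qed

lemma linear_distr_grad:
  assumes u: "integrable (lebesgue_on \<Omega>) u"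
  shows "linear_distr \<Omega> (grad \<Omega> u)"
  unfolding linear_distr_def
proof (intro conjI ballI allI)
  fix f g assume f: "f \<in> test_functions \<Omega>" and g: "g \<in> test_functions \<Omega>"
  show "grad \<Omega> u (\<lambda>x. f x + g x) = grad \<Omega> u f + grad \<Omega> u g"
    using integrable_mult_test_function[OF u test_functions_partial[OF f]]
      integrable_mult_test_function[OF u test_functions_partial[OF g]]
    by (simp add: vec_eq_iff grad_def distr_deriv_def distr_of_fun_def partial_test_add[OF f g] distrib_left)
next
  fix f c assume f: "f \<in> test_functions \<Omega>"
  show "grad \<Omega> u (\<lambda>x. c * f x) = c *\<^sub>R grad \<Omega> u f"
    by (simp add: vec_eq_iff grad_def distr_deriv_def distr_of_fun_def partial_test_cmult[OF f] mult.left_commute[of _ c])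
qed

lemma linear_distr_diff:
  "linear_distr \<Omega> T \<Longrightarrow> linear_distr \<Omega> S \<Longrightarrow> linear_distr \<Omega> (\<lambda>\<phi>. T \<phi> - S \<phi>)"
  by (simp add: linear_distr_def scaleR_diff_right)

lemma linear_partial:
  assumes W: "linear_distr \<Omega> W"
  shows "f \<in> test_functions \<Omega> \<Longrightarrow> g \<in> test_functions \<Omega> \<Longrightarrow>
      W (partial i (\<lambda>x. f x + g x)) = W (partial i f) + W (partial i g)"
    and "f \<in> test_functions \<Omega> \<Longrightarrow> W (partial i (\<lambda>x. c * f x)) = c *\<^sub>R W (partial i f)"
    and "f \<in> test_functions \<Omega> \<Longrightarrow> g \<in> test_functions \<Omega> \<Longrightarrow>
      W (partial i (\<lambda>x. f x - g x)) = W (partial i f) - W (partial i g)"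
proof -
  show a: "W (partial i (\<lambda>x. f x + g x)) = W (partial i f) + W (partial i g)"
    if "f \<in> test_functions \<Omega>" "g \<in> test_functions \<Omega>" for f g
    using that by (simp add: partial_test_add linear_distr_add[OF W] test_functions_partial)
  show c: "W (partial i (\<lambda>x. c * f x)) = c *\<^sub>R W (partial i f)" if "f \<in> test_functions \<Omega>" for f c
    using that by (simp add: partial_test_cmult linear_distr_cmult[OF W] test_functions_partial)
  show "W (partial i (\<lambda>x. f x - g x)) = W (partial i f) - W (partial i g)"
    if "f \<in> test_functions \<Omega>" "g \<in> test_functions \<Omega>"
    using a[OF that(1) test_functions_cmult[OF that(2), of "-1"]] c[OF that(2), of "-1"] by simp
qed

lemma linear_distr_grad4: "linear_distr \<Omega> W \<Longrightarrow> linear_distr \<Omega> (grad4 W)"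
  unfolding linear_distr_def[of \<Omega> "grad4 W"]
  by (simp add: vec_eq_iff forall_4 grad4_def linear_partial)

lemma linear_distr_diag_natural4: "linear_distr \<Omega> W \<Longrightarrow> linear_distr \<Omega> (\<lambda>\<phi>. diag b *v natural4 W \<phi>)"
  unfolding linear_distr_def[of \<Omega> "\<lambda>\<phi>. diag b *v natural4 W \<phi>"]
  by (simp add: vec_eq_iff forall_4 natural4_def linear_partial diag_mult_component algebra_simps)

section \<open>Comparison of the weighted natural gradient with the full gradient\<close>

lemma vtest_4I:
  assumes "\<psi>1 \<in> test_functions \<Omega>" "\<psi>2 \<in> test_functions \<Omega>" "\<psi>3 \<in> test_functions \<Omega>" "\<psi>4 \<in> test_functions \<Omega>"
    and "\<And>x. (\<psi>1 x)\<^sup>2 + (\<psi>2 x)\<^sup>2 + (\<psi>3 x)\<^sup>2 + (\<psi>4 x)\<^sup>2 \<le> 1"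
  shows "(\<lambda>x. vector [\<psi>1 x, \<psi>2 x, \<psi>3 x, \<psi>4 x] :: real^4) \<in> vtest \<Omega>"
  using assms by (simp add: vtest_def forall_4 norm_le_1_iff_4)

text \<open>
  The test fields \<open>\<psi>'\<close> below are the images of \<open>\<psi>\<close> under the adjoint of the orthogonal
  transformation that takes \<open>\<nabla> w\<close> to \<open>\<nabla>\<^sub>N w / \<surd>2\<close>, or its inverse.
\<close>

lemma pairing_natural4_curl_free:
  assumes W: "linear_distr \<Omega> W" and \<psi>: "\<psi> \<in> vtest \<Omega>"
    and curl0: "\<And>f. f \<in> test_functions \<Omega> \<Longrightarrow> W (partial 2 f) $ 1 - W (partial 1 f) $ 2 = 0"
  shows "\<exists>\<psi>'\<in>vtest \<Omega>. pairing (\<lambda>\<phi>. diag (weights t) *v natural4 W \<phi>) \<psi>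
      = pairing (grad4 W) \<psi>'"
proof -
  define c :: real where "c = 1 / sqrt 2"
  have c: "c * c = 1 / 2" by (simp add: c_def)
  \<comment> \<open>The first entry of \<open>\<psi>\<close> pairs with the curl, which is 0, so it
    is left out here and the weight \<open>t\<close> disappears with it.\<close>
  define \<psi>' where "\<psi>' x = (vector [c * (\<psi> x $ 2 - \<psi> x $ 3), c * \<psi> x $ 4, c * \<psi> x $ 4,
      c * (\<psi> x $ 2 + \<psi> x $ 3)] :: real^4)" for x
  have ti: "(\<lambda>x. \<psi> x $ i) \<in> test_functions \<Omega>" for i using \<psi> by (simp add: vtest_def)
  have nb: "(\<psi> x $ 1)\<^sup>2 + (\<psi> x $ 2)\<^sup>2 + (\<psi> x $ 3)\<^sup>2 + (\<psi> x $ 4)\<^sup>2 \<le> 1" for x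
    using \<psi> by (simp add: vtest_def norm_le_1_iff_4)
  have "\<psi>' \<in> vtest \<Omega>"
    unfolding \<psi>'_def[abs_def]
  proof (intro vtest_4I test_functions_cmult test_functions_add test_functions_diff ti)
    fix x
    let ?L = "(c * (\<psi> x $ 2 - \<psi> x $ 3))\<^sup>2 + (c * \<psi> x $ 4)\<^sup>2 + (c * \<psi> x $ 4)\<^sup>2 + (c * (\<psi> x $ 2 + \<psi> x $ 3))\<^sup>2"
    have "?L
        = (c * c) * (2 * ((\<psi> x $ 2)\<^sup>2 + (\<psi> x $ 3)\<^sup>2 + (\<psi> x $ 4)\<^sup>2))"
      by (simp add: power2_eq_square algebra_simps)
    also have "\<dots> = (\<psi> x $ 2)\<^sup>2 + (\<psi> x $ 3)\<^sup>2 + (\<psi> x $ 4)\<^sup>2" by (simp add: c)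
    also have "\<dots> \<le> (\<psi> x $ 1)\<^sup>2 + (\<psi> x $ 2)\<^sup>2 + (\<psi> x $ 3)\<^sup>2 + (\<psi> x $ 4)\<^sup>2" by simp
    also have "\<dots> \<le> 1" by (rule nb)
    finally show "?L \<le> 1" .
  qed
  moreover have "pairing (\<lambda>\<phi>. diag (vector [t, c, c, c]) *v natural4 W \<phi>) \<psi> = pairing (grad4 W) \<psi>'"
    using curl0[OF ti, of 1]
    by (simp add: pairing_def sum_4 diag_mult_component natural4_def grad4_def \<psi>'_def
        linear_partial[OF W] ti test_functions_add test_functions_diff test_functions_cmult algebra_simps)
  ultimately show ?thesis unfolding c_def by blast
qed

lemma pairing_grad4_natural4:
  assumes W: "linear_distr \<Omega> W" and \<psi>: "\<psi> \<in> vtest \<Omega>" and t: "1 / sqrt 2 \<le> t"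
  shows "\<exists>\<psi>'\<in>vtest \<Omega>. pairing (grad4 W) \<psi>
      = pairing (\<lambda>\<phi>. diag (weights t) *v natural4 W \<phi>) \<psi>'"
proof -
  define c :: real where "c = 1 / sqrt 2"
  have c: "c * c = 1 / 2" "0 < c" by (simp_all add: c_def)
  have t': "0 < t" "c \<le> t" using t c(2) by (auto simp: c_def[symmetric])
  \<comment> \<open>\<open>t * k = c * c\<close>: a smaller factor in the curl entry of the new
    field undoes the weight \<open>t\<close>. For \<open>t\<close> \<ge> 1 / sqrt 2 it is at most
    \<open>c\<close>, which keeps the field in the unit ball.\<close>
  define k where "k = 1 / (2 * t)"
  have k: "t * k = 1 / 2" "k * k \<le> 1 / 2" "0 < k"
  proof -
    show "t * k = 1 / 2" "0 < k" using t' by (simp_all add: k_def)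
    have "c * c \<le> t * t" using t' c by (intro mult_mono) auto
    then show "k * k \<le> 1 / 2" using t' c by (simp add: k_def field_simps)
  qed
  define \<psi>' where "\<psi>' x = (vector [k * (\<psi> x $ 3 - \<psi> x $ 2), c * (\<psi> x $ 1 + \<psi> x $ 4),
      c * (\<psi> x $ 4 - \<psi> x $ 1), c * (\<psi> x $ 2 + \<psi> x $ 3)] :: real^4)" for x
  have ti: "(\<lambda>x. \<psi> x $ i) \<in> test_functions \<Omega>" for i using \<psi> by (simp add: vtest_def)
  have nb: "(\<psi> x $ 1)\<^sup>2 + (\<psi> x $ 2)\<^sup>2 + (\<psi> x $ 3)\<^sup>2 + (\<psi> x $ 4)\<^sup>2 \<le> 1" for x
    using \<psi> by (simp add: vtest_def norm_le_1_iff_4)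
  have "\<psi>' \<in> vtest \<Omega>"
    unfolding \<psi>'_def[abs_def]
  proof (intro vtest_4I test_functions_cmult test_functions_add test_functions_diff ti)
    fix x
    let ?L = "(k * (\<psi> x $ 3 - \<psi> x $ 2))\<^sup>2 + (c * (\<psi> x $ 1 + \<psi> x $ 4))\<^sup>2 + (c * (\<psi> x $ 4 - \<psi> x $ 1))\<^sup>2 + (c * (\<psi> x $ 2 + \<psi> x $ 3))\<^sup>2"
    have "?L
        = (k * k) * (\<psi> x $ 3 - \<psi> x $ 2)\<^sup>2 + (c * c) * ((\<psi> x $ 1 + \<psi> x $ 4)\<^sup>2 + (\<psi> x $ 4 - \<psi> x $ 1)\<^sup>2 + (\<psi> x $ 2 + \<psi> x $ 3)\<^sup>2)"
      by (simp add: power2_eq_square algebra_simps)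
    also have "\<dots> \<le> (1 / 2) * (\<psi> x $ 3 - \<psi> x $ 2)\<^sup>2 + (c * c) * ((\<psi> x $ 1 + \<psi> x $ 4)\<^sup>2 + (\<psi> x $ 4 - \<psi> x $ 1)\<^sup>2 + (\<psi> x $ 2 + \<psi> x $ 3)\<^sup>2)"
      by (intro add_right_mono mult_right_mono k(2)) simp
    also have "\<dots> = (\<psi> x $ 1)\<^sup>2 + (\<psi> x $ 2)\<^sup>2 + (\<psi> x $ 3)\<^sup>2 + (\<psi> x $ 4)\<^sup>2"
      by (simp add: c power2_eq_square algebra_simps)
    also have "\<dots> \<le> 1" by (rule nb)
    finally show "?L \<le> 1" .
  qed
  moreover have "pairing (grad4 W) \<psi> = pairing (\<lambda>\<phi>. diag (vector [t, c, c, c]) *v natural4 W \<phi>) \<psi>'"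
  proof -
    define D where "D i j l = W (partial j (\<lambda>x. \<psi> x $ l)) $ i" for i j :: 2 and l :: 4
    have "pairing (\<lambda>\<phi>. diag (vector [t, c, c, c]) *v natural4 W \<phi>) \<psi>' =
      (t * k) * ((D 1 2 3 - D 1 2 2) - (D 2 1 3 - D 2 1 2))
      + (c * c) * (- (D 1 1 1 + D 1 1 4) - (D 2 2 1 + D 2 2 4))
      + (c * c) * ((D 1 1 4 - D 1 1 1) - (D 2 2 4 - D 2 2 1))
      + (c * c) * (- (D 1 2 2 + D 1 2 3) - (D 2 1 2 + D 2 1 3))"
      by (simp add: pairing_def sum_4 diag_mult_component natural4_def \<psi>'_def D_def
        linear_partial[OF W] ti test_functions_add test_functions_diff test_functions_cmult algebra_simps)
    also have "\<dots> = - D 1 1 1 - D 1 2 2 - D 2 1 3 - D 2 2 4"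
      unfolding c k by (simp add: field_simps)
    also have "\<dots> = pairing (grad4 W) \<psi>" by (simp add: pairing_def sum_4 grad4_def D_def)
    finally show ?thesis by simp
  qed
  ultimately show ?thesis unfolding c_def by blast
qed

lemma R_functional_le_ICTV:
  assumes op: "open \<Omega>" and u: "integrable (lebesgue_on \<Omega>) u"
  shows "R_functional \<Omega> (weights t) u \<le> ICTV \<Omega> u"
  unfolding ICTV_def
proof (rule INF_greatest)
  fix w assume "w \<in> {w \<in> radon_measures \<Omega>. \<forall>\<phi>\<in>test_functions \<Omega>. curl \<Omega> w \<phi> = 0}"
  then have w: "w \<in> radon_measures \<Omega>" and c0: "\<And>\<phi>. \<phi> \<in> test_functions \<Omega> \<Longrightarrow> curl \<Omega> w \<phi> = 0" by auto
  let ?W = "distr_of_measure \<Omega> w" and ?b = "weights t"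
  have W: "linear_distr \<Omega> ?W" by (rule linear_distr_of_measure[OF w])
  have "vnorm \<Omega> (\<lambda>\<phi>. diag ?b *v natural4 ?W \<phi>) \<le> vnorm \<Omega> (grad4 ?W)"
  proof (rule vnorm_leI)
    fix \<psi> :: "real^2 \<Rightarrow> real^4" assume "\<psi> \<in> vtest \<Omega>"
    then obtain \<psi>' where "\<psi>' \<in> vtest \<Omega>" "pairing (\<lambda>\<phi>. diag ?b *v natural4 ?W \<phi>) \<psi> = pairing (grad4 ?W) \<psi>'"
      using pairing_natural4_curl_free[OF W] c0[unfolded curl_eq] by blast
    then show "ereal (pairing (\<lambda>\<phi>. diag ?b *v natural4 ?W \<phi>) \<psi>) \<le> vnorm \<Omega> (grad4 ?W)"
      using pairing_le_vnorm by metis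
  qed
  then have "M_norm \<Omega> (\<lambda>\<phi>. diag ?b *v nabla_N \<Omega> w \<phi>) \<le> M_norm \<Omega> (nabla \<Omega> w)"
    unfolding nabla_N_eq_natural4 nabla_eq_grad4
    by (simp add: M_norm_eq_vnorm[OF op] linear_distr_diag_natural4[OF W] linear_distr_grad4[OF W])
  then show "R_functional \<Omega> ?b u \<le> M_norm \<Omega> (\<lambda>\<phi>. grad \<Omega> u \<phi> - ?W \<phi>) + M_norm \<Omega> (nabla \<Omega> w)"
    unfolding R_functional_def by (intro INF_lower2[OF w] add_left_mono)
qed


section \<open>Lebesgue spaces on bounded domains\<close>

lemma integrable_Lp:
  assumes \<Omega>: "open \<Omega>" "bounded \<Omega>" and p: "1 \<le> p" and u: "u \<in> Lp \<Omega> p"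
  shows "integrable (lebesgue_on \<Omega>) u"
proof (rule Bochner_Integration.integrable_bound)
  have "\<Omega> \<in> lmeasurable" using \<Omega> by (intro lmeasurable_open)
  then have "integrable (lebesgue_on \<Omega>) (\<lambda>x. 1::real)"
    by (intro finite_measure.integrable_const finite_measure_lebesgue_on)
  then show "integrable (lebesgue_on \<Omega>) (\<lambda>x. 1 + \<bar>u x\<bar> powr p)"
    using u by (simp add: Lp_def)
  show "u \<in> borel_measurable (lebesgue_on \<Omega>)" using u by (simp add: Lp_def)
  have "\<bar>y\<bar> \<le> 1 + \<bar>y\<bar> powr p" for y :: real
  proof (cases "\<bar>y\<bar> \<le> 1")
    case True
    then show ?thesis using powr_ge_zero[of "\<bar>y\<bar>" p] by linarith
  next
    case False
    then have "\<bar>y\<bar> powr 1 \<le> \<bar>y\<bar> powr p" using p by (intro powr_mono) auto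
    then show ?thesis using False by simp
  qed
  then show "AE x in lebesgue_on \<Omega>. norm (u x) \<le> norm (1 + \<bar>u x\<bar> powr p)"
    by (intro AE_I2) (simp add: abs_of_nonneg)
qed

lemma integrable_Lp_diff:
  assumes p: "1 \<le> p" and u: "u \<in> Lp \<Omega> p" and v: "v \<in> Lp \<Omega> p"
  shows "integrable (lebesgue_on \<Omega>) (\<lambda>x. \<bar>v x - u x\<bar> powr p)"
proof (rule Bochner_Integration.integrable_bound)
  show "integrable (lebesgue_on \<Omega>) (\<lambda>x. 2 powr p * (\<bar>v x\<bar> powr p + \<bar>u x\<bar> powr p))"
    using u v by (simp add: Lp_def)
  have [measurable]: "u \<in> borel_measurable (lebesgue_on \<Omega>)" "v \<in> borel_measurable (lebesgue_on \<Omega>)"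
    using u v by (auto simp: Lp_def)
  show "(\<lambda>x. \<bar>v x - u x\<bar> powr p) \<in> borel_measurable (lebesgue_on \<Omega>)" by measurable
  have "\<bar>a - b\<bar> powr p \<le> 2 powr p * (\<bar>a\<bar> powr p + \<bar>b\<bar> powr p)" for a b :: real
  proof -
    have "\<bar>a - b\<bar> \<le> 2 * max \<bar>a\<bar> \<bar>b\<bar>" by linarith
    then have "\<bar>a - b\<bar> powr p \<le> (2 * max \<bar>a\<bar> \<bar>b\<bar>) powr p" using p by (intro powr_mono2) auto
    also have "\<dots> = 2 powr p * (max \<bar>a\<bar> \<bar>b\<bar>) powr p" by (simp add: powr_mult)
    also have "(max \<bar>a\<bar> \<bar>b\<bar>) powr p \<le> \<bar>a\<bar> powr p + \<bar>b\<bar> powr p" by (simp add: max_def)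
    finally show ?thesis by simp
  qed
  then show "AE x in lebesgue_on \<Omega>. norm (\<bar>v x - u x\<bar> powr p) \<le> norm (2 powr p * (\<bar>v x\<bar> powr p + \<bar>u x\<bar> powr p))"
    by (intro AE_I2) (simp add: abs_of_nonneg)
qed

text \<open>Splitting at |y| = d gives |y| \<le> d + d^(1-p) |y|^p for every d > 0. After
  integration over the bounded domain, \<open>d\<close> makes the first term small and then large
  \<open>n\<close> the second.\<close>

lemma Lp_tendsto_imp_L1_tendsto:
  assumes \<Omega>: "open \<Omega>" "bounded \<Omega>" and p: "1 \<le> p" and u: "u \<in> Lp \<Omega> p" and v: "\<And>n. v n \<in> Lp \<Omega> p"
    and lim: "(\<lambda>n. Lp_dist \<Omega> p (v n) u) \<longlonglongrightarrow> 0"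
  shows "(\<lambda>n. \<integral>x. \<bar>v n x - u x\<bar> \<partial>lebesgue_on \<Omega>) \<longlonglongrightarrow> 0"
proof -
  interpret finite_measure "lebesgue_on \<Omega>"
    using \<Omega> by (intro finite_measure_lebesgue_on lmeasurable_open)
  define I where "I n = (\<integral>x. \<bar>v n x - u x\<bar> powr p \<partial>lebesgue_on \<Omega>)" for n
  define A where "A = measure (lebesgue_on \<Omega>) (space (lebesgue_on \<Omega>))"
  have I0: "0 \<le> I n" for n unfolding I_def by (rule integral_nonneg_AE) simp
  have "(\<lambda>n. (Lp_dist \<Omega> p (v n) u) powr p) \<longlonglongrightarrow> 0"
    by (rule tendsto_zero_powrI[OF lim tendsto_const]) (use p in \<open>auto simp: Lp_dist_def\<close>)
  moreover have "(Lp_dist \<Omega> p (v n) u) powr p = I n" for n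
    using p I0[of n] by (simp add: Lp_dist_def I_def powr_powr)
  ultimately have I: "I \<longlonglongrightarrow> 0" by simp
  have est: "(\<integral>x. \<bar>v n x - u x\<bar> \<partial>lebesgue_on \<Omega>) \<le> d * A + d powr (1 - p) * I n" if d: "0 < d" for d n
  proof -
    have iv: "integrable (lebesgue_on \<Omega>) (\<lambda>x. \<bar>v n x - u x\<bar>)"
      using integrable_Lp[OF \<Omega> p] u v by auto
    have ip: "integrable (lebesgue_on \<Omega>) (\<lambda>x. d powr (1 - p) * \<bar>v n x - u x\<bar> powr p)"
      using integrable_Lp_diff[OF p u v] by simp
    have "\<bar>y\<bar> \<le> d + d powr (1 - p) * \<bar>y\<bar> powr p" for y :: real
    proof (cases "\<bar>y\<bar> \<le> d")
      case True
      have "0 \<le> d powr (1 - p) * \<bar>y\<bar> powr p" by simp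
      with True show ?thesis by linarith
    next
      case False
      then have y: "0 < \<bar>y\<bar>" using d by linarith
      have "\<bar>y\<bar> powr (1 - p) \<le> d powr (1 - p)" using False d p by (intro powr_mono2') auto
      then have "\<bar>y\<bar> powr (1 - p) * \<bar>y\<bar> powr p \<le> d powr (1 - p) * \<bar>y\<bar> powr p" by (intro mult_right_mono) auto
      moreover have "\<bar>y\<bar> powr (1 - p) * \<bar>y\<bar> powr p = \<bar>y\<bar>" using y by (simp add: powr_add[symmetric])
      ultimately show ?thesis using d by linarith
    qed
    then have "(\<integral>x. \<bar>v n x - u x\<bar> \<partial>lebesgue_on \<Omega>) \<le> (\<integral>x. d + d powr (1 - p) * \<bar>v n x - u x\<bar> powr p \<partial>lebesgue_on \<Omega>)"
      by (intro integral_mono iv Bochner_Integration.integrable_add integrable_const ip)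
    also have "\<dots> = d * A + d powr (1 - p) * I n"
      by (subst Bochner_Integration.integral_add[OF integrable_const ip]) (simp add: A_def I_def mult.commute)
    finally show ?thesis .
  qed
  show ?thesis
  proof (rule tendstoI)
    fix e :: real assume e: "0 < e"
    have A: "0 \<le> A" by (simp add: A_def)
    define d where "d = e / (2 * (A + 1))"
    have d: "0 < d" "d * A \<le> e / 2" using e A by (simp_all add: d_def field_simps)
    have "(\<lambda>n. d powr (1 - p) * I n) \<longlonglongrightarrow> d powr (1 - p) * 0" by (intro tendsto_intros I)
    then have "\<forall>\<^sub>F n in sequentially. d powr (1 - p) * I n < e / 2"
      using e by (intro order_tendstoD(2)[where y="d powr (1 - p) * 0"]) auto
    then show "\<forall>\<^sub>F n in sequentially. dist (\<integral>x. \<bar>v n x - u x\<bar> \<partial>lebesgue_on \<Omega>) 0 < e"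
    proof eventually_elim
      case (elim n)
      have "0 \<le> (\<integral>x. \<bar>v n x - u x\<bar> \<partial>lebesgue_on \<Omega>)" by (rule integral_nonneg_AE) simp
      then show ?case using est[OF d(1), of n] elim d(2) by simp
    qed
  qed
qed

lemma tendsto_grad:
  assumes u: "integrable (lebesgue_on \<Omega>) u" and v: "\<And>n. integrable (lebesgue_on \<Omega>) (v n)"
    and lim: "(\<lambda>n. \<integral>x. \<bar>v n x - u x\<bar> \<partial>lebesgue_on \<Omega>) \<longlonglongrightarrow> 0"
    and f: "f \<in> test_functions \<Omega>"
  shows "(\<lambda>n. grad \<Omega> (v n) f) \<longlonglongrightarrow> grad \<Omega> u f"
proof (rule vec_tendstoI)
  fix i
  note pf = test_functions_partial[OF f, of i]
  obtain M where M: "0 \<le> M" "\<And>x. \<bar>partial i f x\<bar> \<le> M" using test_functions_bounded[OF pf] by blast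
  have "(\<lambda>n. grad \<Omega> (v n) f $ i - grad \<Omega> u f $ i) \<longlonglongrightarrow> 0"
  proof (rule Lim_null_comparison)
    show "(\<lambda>n. M * (\<integral>x. \<bar>v n x - u x\<bar> \<partial>lebesgue_on \<Omega>)) \<longlonglongrightarrow> 0"
      using tendsto_mult_right_zero[OF lim, of M] by simp
    have "norm (grad \<Omega> (v n) f $ i - grad \<Omega> u f $ i) \<le> M * (\<integral>x. \<bar>v n x - u x\<bar> \<partial>lebesgue_on \<Omega>)" for n
    proof -
      have "grad \<Omega> (v n) f $ i - grad \<Omega> u f $ i = - (\<integral>x. (v n x - u x) * partial i f x \<partial>lebesgue_on \<Omega>)"
        using integrable_mult_test_function[OF u pf] integrable_mult_test_function[OF v pf]
        by (simp add: grad_def distr_deriv_def distr_of_fun_def left_diff_distrib)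
      moreover have "\<bar>\<integral>x. (v n x - u x) * partial i f x \<partial>lebesgue_on \<Omega>\<bar> \<le> M * (\<integral>x. \<bar>v n x - u x\<bar> \<partial>lebesgue_on \<Omega>)"
        using u v M(2) by (intro abs_integral_mult_le) auto
      ultimately show ?thesis by simp
    qed
    then show "\<forall>\<^sub>F n in sequentially. norm (grad \<Omega> (v n) f $ i - grad \<Omega> u f $ i) \<le> M * (\<integral>x. \<bar>v n x - u x\<bar> \<partial>lebesgue_on \<Omega>)"
      by simp
  qed
  then show "(\<lambda>n. grad \<Omega> (v n) f $ i) \<longlonglongrightarrow> grad \<Omega> u f $ i" by (rule LIM_zero_cancel)
qed


section \<open>Compactness and the lower bound\<close>

text \<open>The result is a finer filter rather than a subsequence: the index type is arbitrary, and
  a product of balls is compact by Tychonoff's theorem but need not be sequentially compact.\<close>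

lemma pointwise_cluster_point:
  fixes Y :: "'n \<Rightarrow> 'a \<Rightarrow> 'b::euclidean_space"
  assumes F: "F \<noteq> bot" and B: "\<forall>\<^sub>F n in F. \<forall>a. norm (Y n a) \<le> B a"
  obtains G y where "G \<noteq> bot" "G \<le> F" "\<And>a. ((\<lambda>n. Y n a) \<longlongrightarrow> y a) G"
proof -
  let ?K = "PiE UNIV (\<lambda>a. cball 0 (B a)) :: ('a \<Rightarrow> 'b) set"
  have "compactin (product_topology (\<lambda>i::'a. euclidean :: 'b topology) UNIV) ?K"
    unfolding compactin_PiE by auto
  then have K: "compact ?K" unfolding euclidean_product_topology by simp
  have "filtermap Y F \<noteq> bot" using F by (simp add: filtermap_bot_iff)
  moreover have "\<forall>\<^sub>F x in filtermap Y F. x \<in> ?K"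
    unfolding eventually_filtermap using B by eventually_elim auto
  ultimately obtain y where y: "inf (nhds y) (filtermap Y F) \<noteq> bot"
    using K unfolding compact_filter by blast
  \<comment> \<open>\<open>G\<close> adds to \<open>F\<close> the preimages of the neighbourhoods of
    \<open>y\<close>. It is proper since \<open>y\<close> is a cluster point of the image
    filter.\<close>
  define G where "G = inf F (filtercomap Y (nhds y))"
  have "G \<noteq> bot"
  proof
    assume "G = bot"
    then have "eventually (\<lambda>_. False) G" by simp
    then obtain P Q where P: "eventually P F" and Q: "eventually Q (filtercomap Y (nhds y))" and PQ: "\<And>n. P n \<and> Q n \<longrightarrow> False"
      unfolding G_def eventually_inf by blast
    obtain R where R: "eventually R (nhds y)" "\<And>n. R (Y n) \<Longrightarrow> Q n"
      using Q unfolding eventually_filtercomap by blast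
    have "eventually (\<lambda>z. \<not> R z) (filtermap Y F)"
      unfolding eventually_filtermap using P by eventually_elim (use PQ R(2) in blast)
    then have "eventually (\<lambda>_. False) (inf (nhds y) (filtermap Y F))"
      using R(1) unfolding eventually_inf by blast
    then show False using y by (simp add: trivial_limit_def)
  qed
  moreover have "G \<le> F" by (simp add: G_def)
  moreover have "((\<lambda>n. Y n a) \<longlongrightarrow> y a) G" for a
  proof -
    have "filterlim Y (nhds y) G"
      unfolding G_def by (rule filterlim_mono[OF filterlim_filtercomap]) auto
    then show ?thesis
      using continuous_on_tendsto_compose[OF continuous_on_product_coordinates[of a]] by simp
  qed
  ultimately show thesis by (rule that)
qed

text \<open>This allows a bound on the sum of two norms to be proved for one pair of test fields at
  a time, which is how limits are taken below. Fixing \<psi> = 0 first shows that the norm of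
  \<open>A\<close> is finite, so that it can be subtracted.\<close>

lemma vnorm_add_le:
  fixes A :: "('a::finite) vdistr" and B :: "('b::finite) vdistr"
  assumes A: "linear_distr \<Omega> A" and B: "linear_distr \<Omega> B"
    and le: "\<And>\<phi> \<psi>. \<phi> \<in> vtest \<Omega> \<Longrightarrow> \<psi> \<in> vtest \<Omega> \<Longrightarrow> pairing A \<phi> + pairing B \<psi> \<le> c"
  shows "vnorm \<Omega> A + vnorm \<Omega> B \<le> ereal c"
proof -
  have 1: "vnorm \<Omega> A \<le> ereal (c - pairing B \<psi>)" if "\<psi> \<in> vtest \<Omega>" for \<psi>
    using le[OF _ that] by (intro vnorm_leI) (simp add: le_diff_eq)
  obtain a where a: "vnorm \<Omega> A = ereal a"
    using 1[OF zero_vtest] vnorm_nonneg[OF A] by (cases "vnorm \<Omega> A") auto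
  have "vnorm \<Omega> B \<le> ereal (c - a)"
    using 1 by (intro vnorm_leI) (fastforce simp: a)
  then show ?thesis
    using vnorm_nonneg[OF B] by (cases "vnorm \<Omega> B") (auto simp: a)
qed

lemma vnorm_le_of_add_le:
  assumes A: "linear_distr \<Omega> A" and B: "linear_distr \<Omega> B" and le: "vnorm \<Omega> A + vnorm \<Omega> B \<le> c"
  shows "vnorm \<Omega> A \<le> c" "vnorm \<Omega> B \<le> c"
  using order_trans[OF add_left_mono[OF vnorm_nonneg[OF B]] le]
    order_trans[OF add_right_mono[OF vnorm_nonneg[OF A]] le] by simp_all

lemma tendsto_pairing:
  assumes "\<And>f. f \<in> test_functions \<Omega> \<Longrightarrow> ((\<lambda>n. T n f) \<longlongrightarrow> S f) G" and "\<phi> \<in> vtest \<Omega>"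
  shows "((\<lambda>n. pairing (T n) \<phi>) \<longlongrightarrow> pairing S \<phi>) G"
  unfolding pairing_def using assms
  by (intro tendsto_sum tendsto_vec_nth) (auto simp: vtest_def)

lemma tendsto_grad4:
  assumes "\<And>f. f \<in> test_functions \<Omega> \<Longrightarrow> ((\<lambda>n. T n f) \<longlongrightarrow> S f) G" and f: "f \<in> test_functions \<Omega>"
  shows "((\<lambda>n. grad4 (T n) f) \<longlongrightarrow> grad4 S f) G"
proof (rule vec_tendstoI)
  have *: "((\<lambda>n. - (T n (partial j f) $ i)) \<longlongrightarrow> - (S (partial j f) $ i)) G" for i j
    by (intro tendsto_minus tendsto_vec_nth assms(1) test_functions_partial f)
  show "((\<lambda>n. grad4 (T n) f $ k) \<longlongrightarrow> grad4 S f $ k) G" for k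
    using exhaust_4[of k] by (auto simp: grad4_def *)
qed

lemma linear_distr_limit:
  fixes T :: "'n \<Rightarrow> ('d::finite) vdistr"
  assumes G: "G \<noteq> bot" and T: "\<forall>\<^sub>F n in G. linear_distr \<Omega> (T n)"
    and lim: "\<And>f. f \<in> test_functions \<Omega> \<Longrightarrow> ((\<lambda>n. T n f) \<longlongrightarrow> S f) G"
  shows "linear_distr \<Omega> S"
  unfolding linear_distr_def
proof (intro conjI ballI allI)
  fix f g assume f: "f \<in> test_functions \<Omega>" and g: "g \<in> test_functions \<Omega>"
  have "((\<lambda>n. T n (\<lambda>x. f x + g x)) \<longlongrightarrow> S (\<lambda>x. f x + g x)) G" by (intro lim test_functions_add f g)
  moreover have "((\<lambda>n. T n (\<lambda>x. f x + g x)) \<longlongrightarrow> S f + S g) G"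
    by (rule Lim_transform_eventually[OF tendsto_add[OF lim[OF f] lim[OF g]]])
      (use T in \<open>eventually_elim, simp add: linear_distr_add f g\<close>)
  ultimately show "S (\<lambda>x. f x + g x) = S f + S g" by (rule tendsto_unique[OF G])
next
  fix f c assume f: "f \<in> test_functions \<Omega>"
  have "((\<lambda>n. T n (\<lambda>x. c * f x)) \<longlongrightarrow> S (\<lambda>x. c * f x)) G" by (intro lim test_functions_cmult f)
  moreover have "((\<lambda>n. T n (\<lambda>x. c * f x)) \<longlongrightarrow> c *\<^sub>R S f) G"
    by (rule Lim_transform_eventually[OF tendsto_scaleR[OF tendsto_const lim[OF f]]])
      (use T in \<open>eventually_elim, simp add: linear_distr_cmult f\<close>)
  ultimately show "S (\<lambda>x. c * f x) = c *\<^sub>R S f" by (rule tendsto_unique[OF G])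
qed

text \<open>A distribution is no competitor in \<open>ICTV\<close>. The real bound \<open>c\<close>
  controls both norms separately, which feeds \<open>bounded_on_lipschitz_domain\<close>; the
  measure obtained agrees with \<open>W\<close> on test functions, so all norms and the curl
  condition carry over to it.\<close>

lemma ICTV_le_of_distribution:
  assumes \<Omega>: "bounded_lipschitz_domain \<Omega>" and u: "integrable (lebesgue_on \<Omega>) u"
    and W: "linear_distr \<Omega> W" and curl0: "\<And>f. f \<in> test_functions \<Omega> \<Longrightarrow> W (partial 2 f) $ 1 - W (partial 1 f) $ 2 = 0"
    and le: "vnorm \<Omega> (\<lambda>\<phi>. grad \<Omega> u \<phi> - W \<phi>) + vnorm \<Omega> (grad4 W) \<le> ereal c"
  shows "extend_infinity \<Omega> (ICTV \<Omega>) u \<le> ereal c"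
proof -
  have op: "open \<Omega>" using \<Omega> by (simp add: bounded_lipschitz_domain_def)
  note lu = linear_distr_grad[OF u]
  note lD = linear_distr_diff[OF lu W]
  note l4 = linear_distr_grad4[OF W]
  note v1 = vnorm_le_of_add_le(1)[OF lD l4 le] and v2 = vnorm_le_of_add_le(2)[OF lD l4 le]
  have A3: "\<bar>(grad \<Omega> u f - W f) $ i\<bar> \<le> c * M" if "f \<in> test_functions \<Omega>" "\<And>x. \<bar>f x\<bar> \<le> M" for f M i
    by (rule abs_component_le_vnorm[OF lD v1 that])
  have A4: "\<bar>W (partial j f) $ i\<bar> \<le> c * M" if "f \<in> test_functions \<Omega>" "\<And>x. \<bar>f x\<bar> \<le> M" for f M i j
  proof -
    have k: "\<bar>grad4 W f $ k\<bar> \<le> c * M" for k by (rule abs_component_le_vnorm[OF l4 v2 that])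
    show ?thesis
      using k[of 1] k[of 2] k[of 3] k[of 4] exhaust_2[of i] exhaust_2[of j] by (auto simp: grad4_def)
  qed
  have WB: "sup_bounded \<Omega> (\<lambda>f. W f $ i)" for i
    by (rule bounded_on_lipschitz_domain[where c=c, OF \<Omega> W u]) (fact A3 A4)+
  obtain w where w: "represents \<Omega> w W" using representable[OF op W WB] by blast
  have wr: "w \<in> radon_measures \<Omega>" and wW: "\<And>f. f \<in> test_functions \<Omega> \<Longrightarrow> W f = distr_of_measure \<Omega> w f"
    using w by (auto simp: represents_def)
  have "\<exists>\<mu>. represents \<Omega> \<mu> (grad \<Omega> u)"
  proof (rule representable[OF op lu])
    fix i
    obtain C where C: "\<And>f M. f \<in> test_functions \<Omega> \<Longrightarrow> \<forall>x. \<bar>f x\<bar> \<le> M \<Longrightarrow> \<bar>W f $ i\<bar> \<le> C * M" using WB by metis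
    have "\<bar>grad \<Omega> u f $ i\<bar> \<le> (c + C) * M" if f: "f \<in> test_functions \<Omega>" "\<forall>x. \<bar>f x\<bar> \<le> M" for f M
      using A3[OF f(1), of M i] C[OF f] f(2) by (simp add: distrib_right)
    then show "sup_bounded \<Omega> (\<lambda>f. grad \<Omega> u f $ i)" by blast
  qed
  then have "u \<in> BV \<Omega>" using u by (simp add: BV_def)
  have "ICTV \<Omega> u \<le> M_norm \<Omega> (\<lambda>\<phi>. grad \<Omega> u \<phi> - distr_of_measure \<Omega> w \<phi>) + M_norm \<Omega> (nabla \<Omega> w)"
    unfolding ICTV_def
  proof (rule INF_lower, intro CollectI conjI ballI wr)
    fix f assume f: "f \<in> test_functions \<Omega>"
    show "curl \<Omega> w f = 0"
      using curl0[OF f] wW[OF test_functions_partial[OF f]] by (simp add: curl_eq)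
  qed
  also have "\<dots> = vnorm \<Omega> (\<lambda>\<phi>. grad \<Omega> u \<phi> - distr_of_measure \<Omega> w \<phi>) + vnorm \<Omega> (grad4 (distr_of_measure \<Omega> w))"
    using linear_distr_of_measure[OF wr]
    by (simp add: nabla_eq_grad4 M_norm_eq_vnorm[OF op] linear_distr_diff[OF lu] linear_distr_grad4)
  also have "vnorm \<Omega> (\<lambda>\<phi>. grad \<Omega> u \<phi> - distr_of_measure \<Omega> w \<phi>) = vnorm \<Omega> (\<lambda>\<phi>. grad \<Omega> u \<phi> - W \<phi>)"
    by (rule vnorm_cong) (simp add: wW)
  also have "vnorm \<Omega> (grad4 (distr_of_measure \<Omega> w)) = vnorm \<Omega> (grad4 W)"
    by (rule vnorm_cong) (simp add: grad4_def wW test_functions_partial)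
  also note le
  finally show ?thesis using \<open>u \<in> BV \<Omega>\<close> by (simp add: extend_infinity_def)
qed

lemma ICTV_le_limit:
  assumes \<Omega>: "bounded_lipschitz_domain \<Omega>" and p: "1 \<le> p"
    and u: "u \<in> Lp \<Omega> p" and v: "\<And>n. v n \<in> Lp \<Omega> p" and lim: "(\<lambda>n. Lp_dist \<Omega> p (v n) u) \<longlonglongrightarrow> 0"
    and t: "filterlim t at_top sequentially"
    and freq: "\<exists>\<^sub>F n in sequentially. extend_infinity \<Omega>
       (R_functional \<Omega> (weights (t n))) (v n) < ereal c"
  shows "extend_infinity \<Omega> (ICTV \<Omega>) u \<le> ereal c"
proof -
  have op: "open \<Omega>" and bd: "bounded \<Omega>" using \<Omega> by (auto simp: bounded_lipschitz_domain_def)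
  define b where "b n = weights (t n)" for n
  have iu: "integrable (lebesgue_on \<Omega>) u" by (rule integrable_Lp[OF op bd p u])
  have iv: "integrable (lebesgue_on \<Omega>) (v n)" for n by (rule integrable_Lp[OF op bd p v])
  note L1 = Lp_tendsto_imp_L1_tendsto[OF op bd p u v lim]
  have gl: "(\<lambda>n. grad \<Omega> (v n) f) \<longlonglongrightarrow> grad \<Omega> u f" if "f \<in> test_functions \<Omega>" for f
    by (rule tendsto_grad[OF iu iv L1 that])
  define S where "S = {n. extend_infinity \<Omega> (R_functional \<Omega> (b n)) (v n) < ereal c}"
  \<comment> \<open>A liminf below \<open>c\<close> yields the bound only for infinitely many
    \<open>n\<close>. Restricting the sequential filter to these indices does the work of passing to
    a subsequence.\<close>
  define F where "F = inf sequentially (principal S)"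
  have F: "F \<noteq> bot"
    using freq unfolding F_def S_def b_def frequently_def trivial_limit_def eventually_inf_principal by simp
  have FS: "\<forall>\<^sub>F n in F. n \<in> S" unfolding F_def eventually_inf_principal by simp
  define E where "E n w = M_norm \<Omega> (\<lambda>\<phi>. grad \<Omega> (v n) \<phi> - distr_of_measure \<Omega> w \<phi>)
     + M_norm \<Omega> (\<lambda>\<phi>. diag (b n) *v nabla_N \<Omega> w \<phi>)" for n w
  have "\<exists>w. w \<in> radon_measures \<Omega> \<and> E n w < ereal c" if "n \<in> S" for n
  proof -
    have "R_functional \<Omega> (b n) (v n) < ereal c"
      using that by (simp add: S_def extend_infinity_def split: if_splits)
    then show ?thesis unfolding R_functional_def E_def[symmetric] INF_less_iff by blast
  qed
  then obtain w where w: "\<And>n. n \<in> S \<Longrightarrow> w n \<in> radon_measures \<Omega>" "\<And>n. n \<in> S \<Longrightarrow> E n (w n) < ereal c"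
    by metis
  define X where "X n = distr_of_measure \<Omega> (w n)" for n
  have lX: "linear_distr \<Omega> (X n)" if "n \<in> S" for n
    unfolding X_def by (rule linear_distr_of_measure[OF w(1)[OF that]])
  define P where "P n = (\<lambda>\<phi>. grad \<Omega> (v n) \<phi> - X n \<phi>)" for n
  define Q where "Q n = (\<lambda>\<phi>. diag (b n) *v natural4 (X n) \<phi>)" for n
  have lP: "linear_distr \<Omega> (P n)" and lQ: "linear_distr \<Omega> (Q n)" if "n \<in> S" for n
    unfolding P_def Q_def using linear_distr_diff[OF linear_distr_grad[OF iv] lX] linear_distr_diag_natural4[OF lX] that
    by blast+
  have sum: "vnorm \<Omega> (P n) + vnorm \<Omega> (Q n) \<le> ereal c" if n: "n \<in> S" for n
    using w(2)[OF n] lP[OF n] lQ[OF n]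
    by (simp add: E_def nabla_N_eq_natural4 X_def[symmetric] P_def Q_def M_norm_eq_vnorm[OF op])
  note v1 = vnorm_le_of_add_le(1)[OF lP lQ sum] and v2 = vnorm_le_of_add_le(2)[OF lP lQ sum]
  have pair: "pairing (P n) \<phi> + pairing (Q n) \<psi> \<le> c"
    if n: "n \<in> S" and "\<phi> \<in> vtest \<Omega>" "\<psi> \<in> vtest \<Omega>" for n \<phi> \<psi>
  proof -
    have "ereal (pairing (P n) \<phi>) + ereal (pairing (Q n) \<psi>) \<le> ereal c"
      using that by (intro order_trans[OF add_mono sum[OF n]] pairing_le_vnorm)
    then show ?thesis by simp
  qed
  have "\<exists>B. \<forall>n\<in>S. norm (X n f) \<le> B" if f: "f \<in> test_functions \<Omega>" for f
  proof -
    obtain M where M: "0 \<le> M" "\<And>x. \<bar>f x\<bar> \<le> M" using test_functions_bounded[OF f] by blast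
    obtain K where K: "\<And>n. norm (grad \<Omega> (v n) f) \<le> K"
      using convergent_imp_Bseq[OF convergentI[OF gl[OF f]]] by (auto simp: Bseq_def)
    have "norm (X n f) \<le> K + (\<Sum>i\<in>(UNIV::2 set). c * M)" if n: "n \<in> S" for n
    proof -
      have "norm (P n f) \<le> (\<Sum>i\<in>UNIV. \<bar>P n f $ i\<bar>)" by (rule norm_le_l1_cart)
      also have "\<dots> \<le> (\<Sum>i\<in>(UNIV::2 set). c * M)"
        by (intro sum_mono abs_component_le_vnorm[OF lP[OF n] v1[OF n n n] f M(2)])
      finally show ?thesis
        using K[of n] norm_triangle_ineq4[of "grad \<Omega> (v n) f" "P n f"] by (simp add: P_def)
    qed
    then show ?thesis by blast
  qed
  then obtain B where B: "\<And>f n. f \<in> test_functions \<Omega> \<Longrightarrow> n \<in> S \<Longrightarrow> norm (X n f) \<le> B f" by metis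
  \<comment> \<open>The cluster point needs a bound at every argument, while the values of
    \<open>X n\<close> off the test functions are arbitrary. They are reset to 0 there.\<close>
  define Y where "Y n f = (if f \<in> test_functions \<Omega> then X n f else 0)" for n f
  have YB: "\<forall>\<^sub>F n in F. \<forall>f. norm (Y n f) \<le> max 0 (B f)"
    using FS by eventually_elim (auto simp: Y_def le_max_iff_disj B)
  obtain G W where G: "G \<noteq> bot" "G \<le> F" and YW: "\<And>f. ((\<lambda>n. Y n f) \<longlongrightarrow> W f) G"
    by (rule pointwise_cluster_point[OF F YB]) blast
  have Gseq: "G \<le> sequentially" using G(2) by (simp add: F_def)
  have GS: "\<forall>\<^sub>F n in G. n \<in> S" using FS G(2) by (rule filter_leD[rotated])
  have XW: "((\<lambda>n. X n f) \<longlongrightarrow> W f) G" if "f \<in> test_functions \<Omega>" for f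
    using YW[of f] that by (simp add: Y_def)
  have lW: "linear_distr \<Omega> W"
    by (rule linear_distr_limit[OF G(1) _ XW]) (use GS in \<open>eventually_elim, simp add: lX\<close>)
  have tG: "filterlim t at_top G" by (rule filterlim_mono[OF t order_refl Gseq])
  have curl0: "W (partial 2 f) $ 1 - W (partial 1 f) $ 2 = 0" if f: "f \<in> test_functions \<Omega>" for f
  proof -
    obtain M where M: "0 \<le> M" "\<And>x. \<bar>f x\<bar> \<le> M" using test_functions_bounded[OF f] by blast
    let ?c = "\<lambda>n. X n (partial 2 f) $ 1 - X n (partial 1 f) $ 2"
    have l1: "(?c \<longlongrightarrow> W (partial 2 f) $ 1 - W (partial 1 f) $ 2) G"
      by (intro tendsto_diff tendsto_vec_nth XW test_functions_partial f)
    have l2: "(?c \<longlongrightarrow> 0) G"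
    proof (rule Lim_null_comparison)
      show "((\<lambda>n. c * M / t n) \<longlongrightarrow> 0) G"
        by (rule real_tendsto_divide_at_top[OF tendsto_const tG])
      have "\<forall>\<^sub>F n in G. 0 < t n" using tG by (simp add: filterlim_at_top_dense)
      with GS show "\<forall>\<^sub>F n in G. norm (?c n) \<le> c * M / t n"
      proof eventually_elim
        case (elim n)
        have "\<bar>Q n f $ 1\<bar> \<le> c * M"
          using elim(1) by (intro abs_component_le_vnorm[OF lQ v2 f M(2)])
        then have "t n * \<bar>?c n\<bar> \<le> c * M"
          using elim(2) by (simp add: Q_def diag_mult_component natural4_def b_def abs_mult)
        then show ?case using elim(2) by (simp add: field_simps)
      qed
    qed
    show ?thesis by (rule tendsto_unique[OF G(1) l1 l2])
  qed
  have le: "vnorm \<Omega> (\<lambda>\<phi>. grad \<Omega> u \<phi> - W \<phi>) + vnorm \<Omega> (grad4 W) \<le> ereal c"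
  proof (rule vnorm_add_le)
    show "linear_distr \<Omega> (\<lambda>\<phi>. grad \<Omega> u \<phi> - W \<phi>)" by (rule linear_distr_diff[OF linear_distr_grad[OF iu] lW])
    show "linear_distr \<Omega> (grad4 W)" by (rule linear_distr_grad4[OF lW])
    fix \<phi> :: "real^2 \<Rightarrow> real^2" and \<psi> :: "real^2 \<Rightarrow> real^4"
    assume \<phi>: "\<phi> \<in> vtest \<Omega>" and \<psi>: "\<psi> \<in> vtest \<Omega>"
    \<comment> \<open>No limit of \<open>Q n\<close> is at hand, since its curl weight grows. It is
      exchanged for \<open>grad4 (X n)\<close> at fixed \<open>n\<close> with \<open>t n\<close>
      large, and only then is the limit taken.\<close>
    have "((\<lambda>n. pairing (P n) \<phi> + pairing (grad4 (X n)) \<psi>) \<longlongrightarrow>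
        pairing (\<lambda>\<phi>. grad \<Omega> u \<phi> - W \<phi>) \<phi> + pairing (grad4 W) \<psi>) G"
      unfolding P_def by (intro tendsto_add tendsto_pairing[OF _ \<phi>] tendsto_pairing[OF _ \<psi>] tendsto_grad4[OF XW] tendsto_diff XW
          tendsto_mono[OF Gseq gl])
    moreover have "\<forall>\<^sub>F n in G. pairing (P n) \<phi> + pairing (grad4 (X n)) \<psi> \<le> c"
    proof -
      have "\<forall>\<^sub>F n in G. 1 / sqrt 2 \<le> t n" using tG by (simp add: filterlim_at_top)
      with GS show ?thesis
      proof eventually_elim
        case (elim n)
        obtain \<psi>' where "\<psi>' \<in> vtest \<Omega>" "pairing (grad4 (X n)) \<psi> = pairing (Q n) \<psi>'"
          using pairing_grad4_natural4[OF lX[OF elim(1)] \<psi> elim(2)] unfolding Q_def b_def by blast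
        then show ?case using pair[OF elim(1) \<phi>] by simp
      qed
    qed
    ultimately show "pairing (\<lambda>\<phi>. grad \<Omega> u \<phi> - W \<phi>) \<phi> + pairing (grad4 W) \<psi> \<le> c"
      by (rule tendsto_upperbound[OF _ _ G(1)])
  qed
  show ?thesis by (rule ICTV_le_of_distribution[OF \<Omega> iu lW _ le]) (rule curl0)
qed

lemma ICTV_le_liminf:
  assumes \<Omega>: "bounded_lipschitz_domain \<Omega>" and p: "1 \<le> p"
    and u: "u \<in> Lp \<Omega> p" and v: "\<And>n. v n \<in> Lp \<Omega> p" and lim: "(\<lambda>n. Lp_dist \<Omega> p (v n) u) \<longlonglongrightarrow> 0"
    and t: "filterlim t at_top sequentially"
  shows "extend_infinity \<Omega> (ICTV \<Omega>) u \<le> liminf (\<lambda>n. extend_infinity \<Omega>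
       (R_functional \<Omega> (weights (t n))) (v n))"
    (is "?I \<le> liminf ?F")
proof (rule ccontr)
  assume "\<not> ?I \<le> liminf ?F"
  \<comment> \<open>A real number strictly in between, because the compactness argument needs finite
    norm bounds even when the ICTV side is infinite.\<close>
  then obtain c where c: "liminf ?F < ereal c" "ereal c < ?I"
    using ereal_dense2[of "liminf ?F" ?I] by (auto simp only: not_le)
  have "\<exists>\<^sub>F n in sequentially. ?F n < ereal c"
  proof (rule ccontr)
    assume "\<not> (\<exists>\<^sub>F n in sequentially. ?F n < ereal c)"
    then have "\<forall>\<^sub>F n in sequentially. ereal c \<le> ?F n" by (simp only: not_frequently not_less)
    then have "ereal c \<le> liminf ?F" by (rule Liminf_bounded)
    from leD[OF this] c(1) show False by contradiction
  qed
  then have "?I \<le> ereal c" by (rule ICTV_le_limit[OF \<Omega> p u v lim t])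
  from leD[OF this] c(2) show False by contradiction
qed

theorem theorem2:
  fixes \<Omega> :: "(real^2) set" and p :: real
  assumes "bounded_lipschitz_domain \<Omega>"
    and "1 \<le> p" and "p < 2"
  shows "gamma_converges_at_top (Lp \<Omega> p) (Lp_dist \<Omega> p)
    (\<lambda>t. extend_infinity \<Omega>
       (R_functional \<Omega> (vector [t, 1 / sqrt 2, 1 / sqrt 2, 1 / sqrt 2])))
    (extend_infinity \<Omega> (ICTV \<Omega>))"
  unfolding gamma_converges_at_top_def gamma_converges_def
proof (intro allI impI ballI conjI)
  fix t :: "nat \<Rightarrow> real" and u v
  assume "(\<forall>n. 0 < t n) \<and> filterlim t at_top sequentially" "u \<in> Lp \<Omega> p"
    "(\<forall>n. v n \<in> Lp \<Omega> p) \<and> (\<lambda>n. Lp_dist \<Omega> p (v n) u) \<longlonglongrightarrow> 0"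
  then show "extend_infinity \<Omega> (ICTV \<Omega>) u \<le> liminf (\<lambda>n. extend_infinity \<Omega>
       (R_functional \<Omega> (weights (t n))) (v n))"
    by (intro ICTV_le_liminf[OF assms(1,2)]) blast+
next
  fix t :: "nat \<Rightarrow> real" and u
  assume t: "(\<forall>n. 0 < t n) \<and> filterlim t at_top sequentially" and u: "u \<in> Lp \<Omega> p"
  let ?F = "\<lambda>n. extend_infinity \<Omega> (R_functional \<Omega> (weights (t n)))"
  have op: "open \<Omega>" using assms(1) by (simp add: bounded_lipschitz_domain_def)
  \<comment> \<open>The constant sequence recovers: outside \<open>BV\<close> both sides are
    infinite, and inside the inequality between the two infima holds for every
    \<open>t\<close>.\<close>
  have "?F n u \<le> extend_infinity \<Omega> (ICTV \<Omega>) u" for n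
    using R_functional_le_ICTV[OF op] by (simp add: extend_infinity_def BV_def)
  then have "limsup (\<lambda>n. ?F n u) \<le> extend_infinity \<Omega> (ICTV \<Omega>) u" by (intro Limsup_bounded) simp
  moreover have "(\<lambda>n. Lp_dist \<Omega> p u u) \<longlonglongrightarrow> 0" by (simp add: Lp_dist_def)
  ultimately show "\<exists>v. (\<forall>n. v n \<in> Lp \<Omega> p) \<and> (\<lambda>n. Lp_dist \<Omega> p (v n) u) \<longlonglongrightarrow> 0 \<and>
      limsup (\<lambda>n. ?F n (v n)) \<le> extend_infinity \<Omega> (ICTV \<Omega>) u"
    using u by (intro exI[of _ "\<lambda>_. u"]) simp
qed

end
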